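(* Let $W$ be a finite Coxeter group of type $E_6$ and let $o$ be a nonzero $W$-orbit of smallest cardinality ($27$). Let $\alpha_1,\alpha_2$ be distinct almost positive roots, represented by collections $C_1$ and $C_2$ of line segments (their diagrams constructed from $o$). Then $\alpha_1$ and $\alpha_2$ are compatible if and only if both of the following conditions hold: (1) No two active segments cross within the annulus between the outer ring of the pair and the next smaller $(h+2)$-gon. (2) If two active segments, one from $C_1$ and one from $C_2$, connect the same origin point to points on the innermost $(h+2)$-gon, then either both segments are contained in a common line or the union of the two segments does not cross the gray zone.
   Context: Setting. $(W,S)$ is the finite irreducible Coxeter system of type $E_6$, represented as a real reflection group on a Euclidean space $V$ so that only the origin is fixed by $W$. $\Phi$ is the root system for $W$ with simple roots $\alpha_s$ ($s\in S$) and positive roots $\Phi^+$. The almost positive roots are $\Phi_{\ge-1}=\Phi^+\cup\{-\alpha_s:s\in S\}$. $S=S_+\sqcup S_-$ is a bipartition of the Coxeter diagram, $c_\pm=\prod_{s\in S_\pm}s$, $c=c_-c_+$, and $h=12$ is the order of $c$. Compatibility. For $\varepsilon\in\{+,-\}$ define the involution $\tau_\varepsilon$ on $\Phi_{\ge-1}$ by $\tau_\varepsilon(\alpha)=\alpha$ if $\alpha=-\alpha_s$ with $s\in S_{-\varepsilon}$, and $\tau_\varepsilon(\alpha)=c_\varepsilon(\alpha)$ otherwise. Compatibility is the unique $\langle\tau_+,\tau_-\rangle$-invariant binary relation on $\Phi_{\ge-1}$ such that for every $s\in S$, $\beta$ is compatible with $-\alpha_s$ iff $\alpha_s$ has coefficient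 $0$ in the simple root expansion of $\beta$. Every $\langle\tau_+,\tau_-\rangle$-orbit in $\Phi_{\ge -1}$ contains a negative simple root. Coxeter plane. Let $(c_s)_{s\in S}$ be a positive eigenvector, for the smallest eigenvalue, of the Gram matrix of the unit simple roots $\alpha_s/|\alpha_s|$, and $(\omega_s)$ the basis dual to the unit simple roots. The Coxeter plane is $P=\mathrm{span}(\lambda,\mu)$, $\lambda=\sum_{s\in S_+}c_s\omega_s$, $\mu=\sum_{s\in S_-}c_s\omega_s$; the angle between $\lambda$ and $\mu$ is $\pi/h$. Use polar coordinates on $P$ with $\lambda$ at angle $0$ and $\mu$ at angle $\pi/h$. Diagrams of almost positive roots. The orthogonal projection of $o$ to $P$ consists of the vertices of two concentric regular $h$-gons of distinct radii centered at the origin, together with three further elements of $o$ projecting to the origin; the latter are called origin points and are kept distinguishable (labeled by the corresponding element of $o$). All vertices have angle $k\pi/h$ with $1\le k\le 2h$ an integer. Each $h$-gon is enlarged to a regular $(h+2)$-gon (a ring) with the same distance of vertices to the origin, by subdividing each of its two edges perpendicular to $\mathbb{R}\lambda$ or $\mathbb{R}\mu$ by a new vertex and then making the polygons regular while preserving their relative orientation (interlaced). Explicitly, $x\in o$ with projection at radius $r>0$ and angle $k\pi/h$ is sent to the point $\hat x$ at radius $r$ and angle $(k+2)\pi/(h+2)$ if $1\le k\le h$, and $(k+4)\pi/(h+2)$ if $h+1\le k\le 2h$; for each radius $r>0$ that occurs, the corresponding ring is the regular $(h+2)$-gon of radius $r$ centered at the origin whose vertices include all $\hat x$ of radius $r$.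 If $x$ projects to the origin, $\hat x$ is the origin labeled by $x$. The diagram of $-\alpha_s$ is the collection of (labeled) line segments $\hat x\,\widehat{sx}$ over all $x\in o$ with $sx\ne x$. Let $L'_+$ and $L'_-$ be the lines through the origin at angles $\pi/(h+2)$ and $2\pi/(h+2)$. Let $\tau_\varepsilon$ act on labeled segments $AB$ as follows: if neither endpoint is at the origin, reflect both endpoints in $L'_\varepsilon$; if $A$ is an origin point and $AB$ is not perpendicular to $L'_\varepsilon$, reflect $B$ in $L'_\varepsilon$ and replace the label $x$ of $A$ by $c_\varepsilon x$; if $A$ is an origin point and $AB$ is perpendicular to $L'_\varepsilon$, fix $AB$. The diagrams of all almost positive roots are uniquely determined by requiring that the diagram of $\tau_\varepsilon(\beta)$ be the image under $\tau_\varepsilon$ of the diagram of $\beta$. Outer rings and active segments. The outer ring of a segment is the larger of the rings containing its endpoints (the ring of the non-origin endpoint if one endpoint is an origin point; the common ring if both endpoints lie on the same ring). The outer ring of a pair of segments is the larger of their two outer rings. Given the diagrams $C_1,C_2$ of two roots, a segment of $C_1\cup C_2$ with outer ring $R$ is active (with respect to the two roots) if $R$ is the outermost ring of the diagram, or, recursively, if it shares an endpoint with an active segment of $C_1\cup C_2$ whose outer ring is the next larger ring than $R$ (origin points with different labels are different endpoints). The annulus between a ring and the next smaller ring is the region inside the former polygon and outside the latter; for the innermost ring it is the whole region inside it. Two segments cross if they intersect in a point of the relative interior of both and do not coincide as unlabeled segments; they cross within a region if such an intersection point lies in the region. Gray zone. The gray zone is the union of the two opposite acute wedges bounded by the line through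 the origin perpendicular to $L'_+$ and the line through the origin perpendicular to $L'_-$; its complement (taking the gray zone open) consists of two closed obtuse wedges, and no ring vertex lies in the open gray zone. The union of two segments with an endpoint at the origin crosses the gray zone if their non-origin endpoints lie in different closed obtuse wedges. *)

theory Defs
  imports "HOL-Analysis.Analysis"
begin

section \<open>Reflection groups and root systems\<close>

definition reflect :: "'a::euclidean_space \<Rightarrow> 'a \<Rightarrow> 'a" where
  "reflect a x = x - (2 * (x \<bullet> a) / (a \<bullet> a)) *\<^sub>R a"

text \<open>A simple reflection \<open>s\<close> is identified with its simple root \<open>\<alpha>\<^sub>s\<close>; it acts as
  \<^term>\<open>reflect a\<close> for \<open>a = \<alpha>\<^sub>s\<close>.\<close>

text \<open>Reflections are involutions, so closure under composition with generators already gives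
  the generated group.\<close>

inductive_set refl_group :: "'a::euclidean_space set \<Rightarrow> ('a \<Rightarrow> 'a) set" for B where
  one: "id \<in> refl_group B"
| step: "a \<in> B \<Longrightarrow> w \<in> refl_group B \<Longrightarrow> reflect a \<circ> w \<in> refl_group B"

definition orbit :: "'a::euclidean_space set \<Rightarrow> 'a \<Rightarrow> 'a set" where
  "orbit B v = (\<lambda>w. w v) ` refl_group B"

definition smallest_nonzero_orbit :: "'a::euclidean_space set \<Rightarrow> 'a set \<Rightarrow> bool" where
  "smallest_nonzero_orbit B X \<longleftrightarrow>
     (\<exists>v. v \<noteq> 0 \<and> X = orbit B v) \<and> (\<forall>w. w \<noteq> 0 \<longrightarrow> card X \<le> card (orbit B w))"

definition fixes_only_origin :: "'a::euclidean_space set \<Rightarrow> bool" where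
  "fixes_only_origin B \<longleftrightarrow> (\<forall>v. (\<forall>w\<in>refl_group B. w v = v) \<longrightarrow> v = 0)"

text \<open>Order of a transformation under composition, \<open>0\<close> if infinite.\<close>

definition map_order :: "('a \<Rightarrow> 'a) \<Rightarrow> nat" where
  "map_order f = (if \<exists>n>0. f ^^ n = id then LEAST n. n > 0 \<and> f ^^ n = id else 0)"

text \<open>Roots need not be crystallographic: there are exactly two opposite roots for each
  reflecting hyperplane.\<close>

definition root_system :: "'a::euclidean_space set \<Rightarrow> bool" where
  "root_system \<Phi> \<longleftrightarrow> finite \<Phi> \<and> 0 \<notin> \<Phi> \<and>
     (\<forall>a\<in>\<Phi>. reflect a ` \<Phi> = \<Phi>) \<and> (\<forall>a\<in>\<Phi>. \<Phi> \<inter> span {a} = {a, - a})"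

definition simple_system :: "'a::euclidean_space set \<Rightarrow> 'a set \<Rightarrow> bool" where
  "simple_system \<Phi> \<Delta> \<longleftrightarrow> \<Delta> \<subseteq> \<Phi> \<and> independent \<Delta> \<and> \<Phi> \<subseteq> span \<Delta> \<and>
     (\<forall>b\<in>\<Phi>. (\<forall>a\<in>\<Delta>. representation \<Delta> b a \<ge> 0) \<or> (\<forall>a\<in>\<Delta>. representation \<Delta> b a \<le> 0))"

definition positive_roots :: "'a::euclidean_space set \<Rightarrow> 'a set \<Rightarrow> 'a set" where
  "positive_roots \<Phi> \<Delta> = {b \<in> \<Phi>. \<forall>a\<in>\<Delta>. representation \<Delta> b a \<ge> 0}"

definition almost_positive_roots :: "'a::euclidean_space set \<Rightarrow> 'a set \<Rightarrow> 'a set" where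
  "almost_positive_roots \<Phi> \<Delta> = positive_roots \<Phi> \<Delta> \<union> uminus ` \<Delta>"

definition coxeter_matrix :: "'a::euclidean_space \<Rightarrow> 'a \<Rightarrow> nat" where
  "coxeter_matrix a b = map_order (reflect a \<circ> reflect b)"

text \<open>The \<open>E\<^sub>6\<close> diagram in Bourbaki's numbering: the path 1-3-4-5-6 with 2 attached to 4.\<close>

definition E6_edges :: "nat set set" where
  "E6_edges = {{1,3}, {3,4}, {4,5}, {5,6}, {2,4}}"

definition type_E6 :: "'a::euclidean_space set \<Rightarrow> bool" where
  "type_E6 \<Delta> \<longleftrightarrow> (\<exists>f. bij_betw f {1..6::nat} \<Delta> \<and>
     (\<forall>i\<in>{1..6}. \<forall>j\<in>{1..6}. i \<noteq> j \<longrightarrow>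
        coxeter_matrix (f i) (f j) = (if {i, j} \<in> E6_edges then 3 else 2)))"

section \<open>The bipartition, the maps \<open>\<tau>\<^sub>\<epsilon>\<close>, and compatibility\<close>

datatype sign = Plus | Minus

fun opp :: "sign \<Rightarrow> sign" where
  "opp Plus = Minus"
| "opp Minus = Plus"

text \<open>From here on, \<open>S \<epsilon>\<close> is the set of simple roots \<open>\<alpha>\<^sub>s\<close> with \<open>s \<in> S\<^sub>\<epsilon>\<close>.\<close>

definition simples :: "(sign \<Rightarrow> 'a set) \<Rightarrow> 'a set" where
  "simples S = S Plus \<union> S Minus"

definition bipartition :: "(sign \<Rightarrow> 'a::euclidean_space set) \<Rightarrow> bool" where
  "bipartition S \<longleftrightarrow> S Plus \<inter> S Minus = {} \<and>
     (\<forall>\<epsilon>. \<forall>a\<in>S \<epsilon>. \<forall>b\<in>S \<epsilon>. a \<noteq> b \<longrightarrow> \<not> coxeter_matrix a b \<ge> 3)"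

text \<open>The reflections in \<open>S \<epsilon>\<close> commute, so the order of the factors is irrelevant.\<close>

definition c_half :: "(sign \<Rightarrow> 'a::euclidean_space set) \<Rightarrow> sign \<Rightarrow> 'a \<Rightarrow> 'a" where
  "c_half S \<epsilon> = Finite_Set.fold (\<lambda>a w. reflect a \<circ> w) id (S \<epsilon>)"

definition coxeter_number :: "(sign \<Rightarrow> 'a::euclidean_space set) \<Rightarrow> nat" where
  "coxeter_number S = map_order (c_half S Minus \<circ> c_half S Plus)"

definition tau :: "(sign \<Rightarrow> 'a::euclidean_space set) \<Rightarrow> sign \<Rightarrow> 'a \<Rightarrow> 'a" where
  "tau S \<epsilon> b = (if b \<in> uminus ` S (opp \<epsilon>) then b else c_half S \<epsilon> b)"

definition compatible :: "'a::euclidean_space set \<Rightarrow> (sign \<Rightarrow> 'a set) \<Rightarrow> ('a \<times> 'a) set" where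
  "compatible \<Phi> S = (let A = almost_positive_roots \<Phi> (simples S) in
     (THE R. R \<subseteq> A \<times> A \<and>
        (\<forall>\<epsilon>. \<forall>b\<in>A. \<forall>b'\<in>A. (tau S \<epsilon> b, tau S \<epsilon> b') \<in> R \<longleftrightarrow> (b, b') \<in> R) \<and>
        (\<forall>a\<in>simples S. \<forall>b\<in>A. (b, - a) \<in> R \<longleftrightarrow> representation (simples S) b a = 0)))"

section \<open>The Coxeter plane\<close>

text \<open>In a real normed space \<^term>\<open>sgn a\<close> is the unit vector \<open>a / |a|\<close>.\<close>

definition gram_eigenvector :: "'a::euclidean_space set \<Rightarrow> real \<Rightarrow> ('a \<Rightarrow> real) \<Rightarrow> bool" where
  "gram_eigenvector \<Delta> e v \<longleftrightarrow> (\<exists>a\<in>\<Delta>. v a \<noteq> 0) \<and>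
     (\<forall>a\<in>\<Delta>. (\<Sum>b\<in>\<Delta>. (sgn a \<bullet> sgn b) * v b) = e * v a)"

definition coxeter_eigenvector :: "'a::euclidean_space set \<Rightarrow> ('a \<Rightarrow> real) \<Rightarrow> bool" where
  "coxeter_eigenvector \<Delta> c \<longleftrightarrow> (\<forall>a\<in>\<Delta>. c a > 0) \<and>
     (\<exists>e. gram_eigenvector \<Delta> e c \<and> (\<forall>e' v. gram_eigenvector \<Delta> e' v \<longrightarrow> e \<le> e'))"

definition dual_vec :: "'a::euclidean_space set \<Rightarrow> 'a \<Rightarrow> 'a" where
  "dual_vec \<Delta> a = (THE w. \<forall>b\<in>\<Delta>. w \<bullet> sgn b = (if b = a then 1 else 0))"

text \<open>\<open>plane_vec S c Plus\<close> is \<open>\<lambda>\<close> and \<open>plane_vec S c Minus\<close> is \<open>\<mu>\<close>.\<close>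

definition plane_vec :: "(sign \<Rightarrow> 'a::euclidean_space set) \<Rightarrow> ('a \<Rightarrow> real) \<Rightarrow> sign \<Rightarrow> 'a" where
  "plane_vec S c \<epsilon> = (\<Sum>a\<in>S \<epsilon>. c a *\<^sub>R dual_vec (simples S) a)"

text \<open>Orthogonal projection to the Coxeter plane, in the orthonormal frame obtained from
  \<open>(\<lambda>, \<mu>)\<close> by Gram-Schmidt. Identifying the plane with \<open>\<complex>\<close> in this way puts \<open>\<lambda>\<close> at
  angle 0 and \<open>\<mu>\<close> in the upper half plane, hence at angle \<open>\<pi>/h\<close>.\<close>

definition plane_proj :: "(sign \<Rightarrow> 'a::euclidean_space set) \<Rightarrow> ('a \<Rightarrow> real) \<Rightarrow> 'a \<Rightarrow> complex" where
  "plane_proj S c x =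
     (let e1 = sgn (plane_vec S c Plus); m = plane_vec S c Minus;
          e2 = sgn (m - (m \<bullet> e1) *\<^sub>R e1)
      in Complex (x \<bullet> e1) (x \<bullet> e2))"

section \<open>Diagrams of almost positive roots\<close>

text \<open>In the definitions below \<open>X\<close> is the orbit \<open>o\<close>.
  A point of a diagram is a labeled origin point or a vertex of a ring;
  a labeled segment is the set of its two endpoints.\<close>

datatype 'a point = Origin 'a | Vertex complex

type_synonym 'a segment = "'a point set"

fun loc :: "'a point \<Rightarrow> complex" where
  "loc (Origin x) = 0"
| "loc (Vertex z) = z"

definition hat :: "(sign \<Rightarrow> 'a::euclidean_space set) \<Rightarrow> ('a \<Rightarrow> real) \<Rightarrow> 'a \<Rightarrow> 'a point" where
  "hat S c x =
     (let h = coxeter_number S; z = plane_proj S c x; r = cmod z in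
      if z = 0 then Origin x
      else let k = (THE k::nat. 1 \<le> k \<and> k \<le> 2 * h \<and> z = rcis r (real k * pi / real h))
           in Vertex (rcis r (real (if k \<le> h then k + 2 else k + 4) * pi / real (h + 2))))"

definition neg_simple_diagram ::
  "(sign \<Rightarrow> 'a::euclidean_space set) \<Rightarrow> ('a \<Rightarrow> real) \<Rightarrow> 'a set \<Rightarrow> 'a \<Rightarrow> 'a segment set" where
  "neg_simple_diagram S c X a =
     {{hat S c x, hat S c (reflect a x)} | x. x \<in> X \<and> reflect a x \<noteq> x}"

text \<open>Unit direction of the line \<open>L'\<^sub>\<epsilon>\<close>, for \<open>n = h + 2\<close>.\<close>

definition mirror_dir :: "nat \<Rightarrow> sign \<Rightarrow> complex" where
  "mirror_dir n \<epsilon> = cis ((case \<epsilon> of Plus \<Rightarrow> 1 | Minus \<Rightarrow> 2) * pi / real n)"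

text \<open>\<open>u\<^sup>2 * cnj z\<close> is the reflection of \<open>z\<close> in the line through 0 and the unit number \<open>u\<close>.\<close>

fun tau_point :: "(sign \<Rightarrow> 'a::euclidean_space set) \<Rightarrow> sign \<Rightarrow> 'a point \<Rightarrow> 'a point" where
  "tau_point S \<epsilon> (Origin x) = Origin (c_half S \<epsilon> x)"
| "tau_point S \<epsilon> (Vertex z) = Vertex ((mirror_dir (coxeter_number S + 2) \<epsilon>)\<^sup>2 * cnj z)"

definition tau_segment ::
  "(sign \<Rightarrow> 'a::euclidean_space set) \<Rightarrow> sign \<Rightarrow> 'a segment \<Rightarrow> 'a segment" where
  "tau_segment S \<epsilon> T =
     (if \<exists>x z. T = {Origin x, Vertex z} \<and> z \<bullet> mirror_dir (coxeter_number S + 2) \<epsilon> = 0 then T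
      else tau_point S \<epsilon> ` T)"

text \<open>Outside the almost positive roots the value is irrelevant; it is set to \<open>{}\<close> to make the
  family unique.\<close>

definition diagram ::
  "'a::euclidean_space set \<Rightarrow> (sign \<Rightarrow> 'a set) \<Rightarrow> ('a \<Rightarrow> real) \<Rightarrow> 'a set \<Rightarrow> 'a \<Rightarrow> 'a segment set" where
  "diagram \<Phi> S c X = (let A = almost_positive_roots \<Phi> (simples S) in
     (THE D. (\<forall>b. b \<notin> A \<longrightarrow> D b = {}) \<and>
        (\<forall>a\<in>simples S. D (- a) = neg_simple_diagram S c X a) \<and>
        (\<forall>\<epsilon>. \<forall>b\<in>A. D (tau S \<epsilon> b) = tau_segment S \<epsilon> ` D b)))"

section \<open>Rings, active segments, crossings\<close>

text \<open>Rings are identified by their radii.\<close>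

definition ring_radii ::
  "(sign \<Rightarrow> 'a::euclidean_space set) \<Rightarrow> ('a \<Rightarrow> real) \<Rightarrow> 'a set \<Rightarrow> real set" where
  "ring_radii S c X = {r. r > 0 \<and> (\<exists>x\<in>X. cmod (plane_proj S c x) = r)}"

definition regular_polygon :: "nat \<Rightarrow> real \<Rightarrow> complex set \<Rightarrow> bool" where
  "regular_polygon n r V \<longleftrightarrow>
     (\<exists>u. cmod u = r \<and> V = (\<lambda>j. u * cis (2 * pi * real j / real n)) ` {..<n})"

definition ring_vertices ::
  "(sign \<Rightarrow> 'a::euclidean_space set) \<Rightarrow> ('a \<Rightarrow> real) \<Rightarrow> 'a set \<Rightarrow> real \<Rightarrow> complex set" where
  "ring_vertices S c X r =
     (THE V. regular_polygon (coxeter_number S + 2) r V \<and>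
        {z. Vertex z \<in> hat S c ` X \<and> cmod z = r} \<subseteq> V)"

definition next_larger :: "real set \<Rightarrow> real \<Rightarrow> real \<Rightarrow> bool" where
  "next_larger A R r \<longleftrightarrow> R \<in> A \<and> r \<in> A \<and> r < R \<and> (\<forall>q\<in>A. \<not> (r < q \<and> q < R))"

text \<open>For the innermost ring the union is empty.\<close>

definition annulus ::
  "(sign \<Rightarrow> 'a::euclidean_space set) \<Rightarrow> ('a \<Rightarrow> real) \<Rightarrow> 'a set \<Rightarrow> real \<Rightarrow> complex set" where
  "annulus S c X R = convex hull (ring_vertices S c X R) -
     (\<Union>r\<in>{r. next_larger (ring_radii S c X) R r}. convex hull (ring_vertices S c X r))"

definition outer_radius :: "'a segment \<Rightarrow> real" where
  "outer_radius T = Max ((\<lambda>p. cmod (loc p)) ` T)"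

inductive_set active :: "real set \<Rightarrow> 'a segment set \<Rightarrow> 'a segment set"
  for A :: "real set" and C :: "'a segment set" where
  outermost: "T \<in> C \<Longrightarrow> outer_radius T = Max A \<Longrightarrow> T \<in> active A C"
| inner: "T \<in> C \<Longrightarrow> T' \<in> active A C \<Longrightarrow> T \<inter> T' \<noteq> {} \<Longrightarrow>
    next_larger A (outer_radius T') (outer_radius T) \<Longrightarrow> T \<in> active A C"

definition cross_within :: "complex set \<Rightarrow> 'a segment \<Rightarrow> 'a segment \<Rightarrow> bool" where
  "cross_within Y T T' \<longleftrightarrow> loc ` T \<noteq> loc ` T' \<and>
     rel_interior (convex hull (loc ` T)) \<inter> rel_interior (convex hull (loc ` T')) \<inter> Y \<noteq> {}"

section \<open>The gray zone\<close>

text \<open>The lines perpendicular to \<open>L'\<^sub>+\<close> and \<open>L'\<^sub>-\<close> cut the plane into four wedges. As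
  \<open>L'\<^sub>+\<close> and \<open>L'\<^sub>-\<close> meet at the acute angle \<open>\<pi>/n\<close>, the two closed obtuse wedges are those where
  the inner products with both axes have the same weak sign.\<close>

definition obtuse_wedge :: "nat \<Rightarrow> sign \<Rightarrow> complex set" where
  "obtuse_wedge n \<sigma> = {z. \<forall>\<epsilon>. (case \<sigma> of Plus \<Rightarrow> z \<bullet> mirror_dir n \<epsilon> \<ge> 0 | Minus \<Rightarrow> z \<bullet> mirror_dir n \<epsilon> \<le> 0)}"

text \<open>For the union of the segments from the origin to \<open>y\<close> and to \<open>z\<close>.\<close>

definition crosses_gray_zone :: "nat \<Rightarrow> complex \<Rightarrow> complex \<Rightarrow> bool" where
  "crosses_gray_zone n y z \<longleftrightarrow>
     (\<exists>\<sigma>. y \<in> obtuse_wedge n \<sigma> \<and> z \<in> obtuse_wedge n (opp \<sigma>))"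

section \<open>The two conditions\<close>

definition no_crossing_condition ::
  "(sign \<Rightarrow> 'a::euclidean_space set) \<Rightarrow> ('a \<Rightarrow> real) \<Rightarrow> 'a set \<Rightarrow>
   'a segment set \<Rightarrow> 'a segment set \<Rightarrow> bool" where
  "no_crossing_condition S c X C1 C2 \<longleftrightarrow>
     (\<forall>T \<in> active (ring_radii S c X) (C1 \<union> C2). \<forall>T' \<in> active (ring_radii S c X) (C1 \<union> C2).
        \<not> cross_within (annulus S c X (max (outer_radius T) (outer_radius T'))) T T')"

definition gray_zone_condition ::
  "(sign \<Rightarrow> 'a::euclidean_space set) \<Rightarrow> ('a \<Rightarrow> real) \<Rightarrow> 'a set \<Rightarrow>
   'a segment set \<Rightarrow> 'a segment set \<Rightarrow> bool" where
  "gray_zone_condition S c X C1 C2 \<longleftrightarrow>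
     (\<forall>x y z. let T = {Origin x, Vertex y}; T' = {Origin x, Vertex z} in
        T \<in> C1 \<and> T' \<in> C2 \<and>
        T \<in> active (ring_radii S c X) (C1 \<union> C2) \<and> T' \<in> active (ring_radii S c X) (C1 \<union> C2) \<and>
        cmod y = Min (ring_radii S c X) \<and> cmod z = Min (ring_radii S c X)
        \<longrightarrow> collinear {0, y, z} \<or> \<not> crosses_gray_zone (coxeter_number S + 2) y z)"

end

(* In coordinates with respect to the simple roots everything is finite.  The orbit is, up to the
   diagram automorphism, a multiple of the orbit of a minuscule weight, and the Coxeter plane of E6
   is found from the eigenvector explicitly: the projected orbit lies on two 12-gons whose radii have
   the ratio kappa = (sqrt 6 + sqrt 2) / 2.  Hence each of the 42 diagrams is a list of six segments
   between coded points, and the two involutions and compatibility become tables of numbers.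
   For a compatible pair every pair of active segments that are relevant in the same region is
   disjoint, or meets only inside the inner polygon, or is radial; for an incompatible pair one pair
   of active segments that crosses is exhibited.  These statements concern signs of 3x3 determinants
   of trigonometric numbers, which an integer approximation with a safety margin decides. *)

theory Submission
  imports Defs
begin

section \<open>Reflections\<close>

text \<open>The hypotheses leave open which half of the bipartition is S_+, the length of the roots,
  and which of two orbits of size 27 is given. The halves are therefore named by Booleans,
  \<open>True\<close> for the one with nodes 1, 4 and 6 of the diagram; exchanging the signs only
  reflects the plane, and the two orbits are exchanged by renumbering the simple roots. To exclude
  every other orbit: a dominant vector determines the set of those weights with which it has the
  largest products, so its orbit is at least as large as that of their sum, of which 28 elements are
  listed. \<open>compatible\<close> and \<open>diagram\<close> are definite descriptions; each table
  is shown to satisfy the description and, by induction along the involutions from the negative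
  simple roots, to be its only solution. Sines of multiples of pi / 12 lie in a quartic field, where
  equality is exact, but the enlarged polygons bring in pi / 14, so sides of lines are decided from
  rounded coordinates. Incidences, where a determinant vanishes, are read off from the codes, since
  no approximation certifies a zero.\<close>

lemma reflect_isometry: "reflect a x \<bullet> reflect a y = x \<bullet> y"
proof (cases "a = 0")
  case False
  then have "a \<bullet> a \<noteq> 0" by simp
  then show ?thesis
    by (simp add: reflect_def inner_diff_left inner_diff_right inner_commute field_simps)
qed (simp add: reflect_def)

lemma linear_reflect: "linear (reflect a)"
  by (rule linearI) (simp_all add: reflect_def inner_add_left scaleR_add_left
      add_divide_distrib distrib_left scaleR_diff_right mult.left_commute)

lemma reflect_reflect: "reflect a (reflect a x) = x"
proof (cases "a = 0")
  case False
  then have "a \<bullet> a \<noteq> 0" by simp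
  then have "2 * (x \<bullet> a - 2 * (x \<bullet> a) / (a \<bullet> a) * (a \<bullet> a)) / (a \<bullet> a) = - (2 * (x \<bullet> a) / (a \<bullet> a))"
    by (simp add: field_simps)
  then show ?thesis
    by (simp add: reflect_def inner_diff_left)
qed (simp add: reflect_def)

lemma reflect_self: "a \<noteq> 0 \<Longrightarrow> reflect a a = - a"
  by (simp add: reflect_def scaleR_2)

section \<open>From orders of products of reflections to inner products\<close>

lemma map_order_pow:
  assumes "map_order f = n" "n > 0"
  shows "f ^^ n = id"
proof -
  have ex: "\<exists>n>0. f ^^ n = id"
    using assms unfolding map_order_def by (auto split: if_splits)
  have "(LEAST n. n > 0 \<and> f ^^ n = id) = n"
    using assms ex unfolding map_order_def by simp
  then show ?thesis using LeastI_ex[OF ex[unfolded Bex_def]] by auto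
qed

lemma independent_pair_coeffs:
  fixes a b :: "'a::real_vector"
  assumes "independent \<Delta>" "a \<in> \<Delta>" "b \<in> \<Delta>" "a \<noteq> b" "x *\<^sub>R a + y *\<^sub>R b = u *\<^sub>R a + v *\<^sub>R b"
  shows "x = u \<and> y = v"
proof -
  have "representation \<Delta> (x *\<^sub>R a + y *\<^sub>R b) = representation \<Delta> (u *\<^sub>R a + v *\<^sub>R b)"
    using assms(5) by simp
  moreover have "representation \<Delta> (x *\<^sub>R a + y *\<^sub>R b) =
      (\<lambda>c. x * (if c = a then 1 else 0) + y * (if c = b then 1 else 0))" for x y
    using assms(1-3)
    by (simp add: real_vector.representation_add real_vector.representation_scale
        real_vector.span_base real_vector.span_scale real_vector.representation_basis
        real_vector.span_add fun_eq_iff)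
  ultimately have e: "x * (if c = a then 1 else 0) + y * (if c = b then 1 else 0) =
      u * (if c = a then 1 else 0) + v * (if c = b then 1 else 0)" for c
    by (metis (no_types, lifting))
  show ?thesis using e[of a] e[of b] assms(4) by simp
qed

context
  fixes \<Phi> \<Delta> :: "'a::euclidean_space set"
  assumes rs: "root_system \<Phi>" and ss: "simple_system \<Phi> \<Delta>"
begin

lemma simple_roots_nonzero: "a \<in> \<Delta> \<Longrightarrow> a \<noteq> 0"
  using rs ss unfolding root_system_def simple_system_def by auto

text \<open>The root \<open>reflect a b\<close> has coefficient 1 at b and, at a, a negative
  multiple of the inner product. Coefficients of a root never have opposite signs, so the one at a
  cannot be negative.\<close>

lemma simple_roots_obtuse:
  assumes "a \<in> \<Delta>" "b \<in> \<Delta>" "a \<noteq> b"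
  shows "a \<bullet> b \<le> 0"
proof -
  have ind: "independent \<Delta>" using ss by (simp add: simple_system_def)
  have "a \<in> \<Phi>" "b \<in> \<Phi>" using ss assms by (auto simp: simple_system_def)
  then have in\<Phi>: "reflect a b \<in> \<Phi>" using rs by (auto simp: root_system_def)
  define x where "x = 2 * (b \<bullet> a) / (a \<bullet> a)"
  have rep: "representation \<Delta> (reflect a b) =
      (\<lambda>c. (if c = b then 1 else 0) - x * (if c = a then 1 else 0))"
    using ind assms unfolding reflect_def x_def[symmetric]
    by (simp add: real_vector.representation_diff real_vector.representation_scale
        real_vector.span_base real_vector.span_scale real_vector.representation_basis fun_eq_iff)
  have "(\<forall>c\<in>\<Delta>. representation \<Delta> (reflect a b) c \<ge> 0) \<or> (\<forall>c\<in>\<Delta>. representation \<Delta> (reflect a b) c \<le> 0)"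
    using ss in\<Phi> unfolding simple_system_def by blast
  then have "- x \<ge> 0" using assms unfolding rep by (auto dest: bspec[of _ _ a] bspec[of _ _ b])
  moreover have "a \<bullet> a > 0" using simple_roots_nonzero[OF assms(1)] by simp
  ultimately show ?thesis by (simp add: x_def divide_le_0_iff inner_commute)
qed

text \<open>Order 2 makes the reflections commute, so \<open>reflect a\<close> negates
  \<open>reflect b a\<close>. Its coefficient at b is kept by \<open>reflect a\<close>, hence equals
  its own negative and vanishes.\<close>

lemma coxeter_matrix_2_inner:
  assumes "a \<in> \<Delta>" "b \<in> \<Delta>" "a \<noteq> b" "coxeter_matrix a b = 2"
  shows "a \<bullet> b = 0"
proof -
  define x where "x = 2 * (b \<bullet> a) / (a \<bullet> a)"
  define y where "y = 2 * (a \<bullet> b) / (b \<bullet> b)"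
  have nz: "a \<noteq> 0" "b \<noteq> 0" using simple_roots_nonzero assms by auto
  have "(reflect a \<circ> reflect b) ^^ 2 = id"
    using map_order_pow[OF assms(4)[unfolded coxeter_matrix_def]] by simp
  then have "reflect a (reflect b (reflect a (reflect b z))) = z" for z
    by (simp add: numeral_2_eq_2 fun_eq_iff)
  from this[of "reflect b a"] have "reflect a (reflect b (reflect a a)) = reflect b a"
    by (simp add: reflect_reflect)
  then have "- reflect a (reflect b a) = reflect b a"
    by (simp add: reflect_self nz linear_neg[OF linear_reflect])
  moreover have rba: "reflect b a = a - y *\<^sub>R b" by (simp add: reflect_def y_def)
  moreover have "reflect a (a - y *\<^sub>R b) = - a - y *\<^sub>R (b - x *\<^sub>R a)"
    by (simp add: linear_diff[OF linear_reflect] linear_scale[OF linear_reflect] reflect_self nz)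
      (simp add: reflect_def x_def)
  ultimately have "(1 - x * y) *\<^sub>R a + y *\<^sub>R b = 1 *\<^sub>R a + (- y) *\<^sub>R b"
    by (simp add: algebra_simps)
  then have "y = - y" using independent_pair_coeffs assms ss simple_system_def by metis
  then show ?thesis using nz by (simp add: y_def)
qed

text \<open>The braid relation evaluated at b, compared at the coefficient of b, gives x y = 1,
  which fixes only the angle. Equal lengths need the root system: now
  \<open>reflect b (reflect a b)\<close> is the root - x a, and the only roots on the line of a are
  a and - a; \<open>simple_roots_obtuse\<close> leaves x = - 1.\<close>

lemma coxeter_matrix_3_inner:
  assumes "a \<in> \<Delta>" "b \<in> \<Delta>" "a \<noteq> b" "coxeter_matrix a b = 3"
  shows "2 * (a \<bullet> b) = - (a \<bullet> a) \<and> a \<bullet> a = b \<bullet> b"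
proof -
  define x where "x = 2 * (b \<bullet> a) / (a \<bullet> a)"
  define y where "y = 2 * (a \<bullet> b) / (b \<bullet> b)"
  have nz: "a \<noteq> 0" "b \<noteq> 0" using simple_roots_nonzero assms by auto
  have "(reflect a \<circ> reflect b) ^^ 3 = id"
    using map_order_pow[OF assms(4)[unfolded coxeter_matrix_def]] by simp
  then have p3: "reflect a (reflect b (reflect a (reflect b (reflect a (reflect b z))))) = z" for z
    by (simp add: numeral_3_eq_3 fun_eq_iff)
  from p3[of "reflect b (reflect a (reflect b b))"]
  have "reflect a (reflect b (reflect a b)) = reflect b (reflect a (reflect b b))"
    by (simp add: reflect_reflect)
  then have e: "reflect a (reflect b (reflect a b)) = - reflect b (reflect a b)"
    by (simp add: reflect_self nz linear_neg[OF linear_reflect])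
  have rab: "reflect a b = b - x *\<^sub>R a" and rba: "reflect b a = a - y *\<^sub>R b"
    by (simp_all add: reflect_def y_def x_def)
  have f: "reflect b (reflect a b) = (x * y - 1) *\<^sub>R b - x *\<^sub>R a"
    by (simp add: rab rba linear_diff[OF linear_reflect] linear_scale[OF linear_reflect] reflect_self nz
       algebra_simps)
  have g: "reflect a ((x * y - 1) *\<^sub>R b - x *\<^sub>R a) = (x * y - 1) *\<^sub>R b + (x * (2 - x * y)) *\<^sub>R a"
    by (simp add: rab rba linear_diff[OF linear_reflect] linear_scale[OF linear_reflect] reflect_self nz)
      (simp add: algebra_simps, metis mult_2_right scaleR_add_left)
  have "(x * (2 - x * y)) *\<^sub>R a + (x * y - 1) *\<^sub>R b = x *\<^sub>R a + (1 - x * y) *\<^sub>R b"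
    using e unfolding f g by (simp add: algebra_simps)
  then have xy: "x * y = 1" using independent_pair_coeffs assms ss simple_system_def
    by (smt (verit, ccfv_threshold))
  have \<Phi>: "a \<in> \<Phi>" "b \<in> \<Phi>" using ss assms by (auto simp: simple_system_def)
  have "\<And>x y. x \<in> \<Phi> \<Longrightarrow> y \<in> \<Phi> \<Longrightarrow> reflect x y \<in> \<Phi>" using rs unfolding root_system_def by blast
  then have "reflect b (reflect a b) \<in> \<Phi>" using \<Phi> by simp
  then have "- x *\<^sub>R a \<in> \<Phi> \<inter> span {a}"
    unfolding f xy by (simp add: span_base span_mul span_neg)
  then have "- x *\<^sub>R a = a \<or> - x *\<^sub>R a = - a"
    using rs \<Phi> unfolding root_system_def by blast
  then have "x = - 1 \<or> x = 1"
  proof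
    assume "- x *\<^sub>R a = a"
    then have "(- x) *\<^sub>R a = 1 *\<^sub>R a" by simp
    then have "- x = 1" using nz(1) scaleR_cancel_right by blast
    then show ?thesis by simp
  next
    assume "- x *\<^sub>R a = - a"
    then have "x *\<^sub>R a = 1 *\<^sub>R a" by simp
    then have "x = 1" using nz(1) scaleR_cancel_right by blast
    then show ?thesis by simp
  qed
  moreover have "a \<bullet> b \<le> 0" using simple_roots_obtuse assms by simp
  moreover have "a \<bullet> a > 0" "b \<bullet> b > 0" using nz by auto
  ultimately have "x = - 1"
    by (smt (verit, best) divide_le_0_iff inner_commute mult_nonneg_nonpos x_def)
  moreover from this xy have "y = - 1" by simp
  ultimately show ?thesis using nz
    by (auto simp: x_def y_def divide_eq_eq inner_commute)
qed

end

section \<open>Roots of type E6 in coordinates\<close>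

text \<open>Index i is node i + 1 of \<open>E6_edges\<close>: the path is 0-2-3-4-5, and 1 is
  attached to 3.\<close>

definition cartan :: "int list list" where
  "cartan = [[2,0,-1,0,0,0],[0,2,0,-1,0,0],[-1,0,2,-1,0,0],[0,-1,-1,2,-1,0],[0,0,0,-1,2,-1],[0,0,0,0,-1,2]]"

text \<open>The value of the coroot of index j on the vector with coordinates \<open>ms\<close>; it
  is an integer, so reflections stay within integer lists.\<close>

fun pairing :: "nat \<Rightarrow> int list \<Rightarrow> int" where
  "pairing j ms = sum_list (map2 (*) (cartan ! j) ms)"

fun refl_coords :: "nat \<Rightarrow> int list \<Rightarrow> int list" where
  "refl_coords j ms = ms[j := ms ! j - pairing j ms]"

lemma length_refl_coords [simp]: "length (refl_coords j ms) = length ms"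
  by simp

lemma less6_cases:
  assumes "(i::nat) < 6"
  obtains "i = 0" | "i = 1" | "i = 2" | "i = 3" | "i = 4" | "i = 5"
  using assms by linarith

lemma length6_cases:
  assumes "length ms = 6"
  obtains m0 m1 m2 m3 m4 m5 where "ms = [m0,m1,m2,m3,m4,m5]"
  using assms by (auto simp: eval_nat_numeral length_Suc_conv)

lemma lessThan6: "{..<6::nat} = {0,1,2,3,4,5}"
  by auto

lemma sum_lessThan6:
  fixes f :: "nat \<Rightarrow> 'b::comm_monoid_add"
  shows "(\<Sum>k<6. f k) = f 0 + f 1 + f 2 + f 3 + f 4 + f 5"
  unfolding lessThan6 by (simp add: add.assoc)

definition unit_coords :: "nat \<Rightarrow> int list" where
  "unit_coords i = (replicate 6 0)[i := 1]"

text \<open>N is the common squared length of the simple roots. The last assumption says that they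
  span the space, which comes from the origin being the only fixed point.\<close>

locale E6_roots =
  fixes a :: "nat \<Rightarrow> 'a::euclidean_space" and N :: real
  assumes N_pos: "N > 0"
    and gram: "\<And>i j. i < 6 \<Longrightarrow> j < 6 \<Longrightarrow> a i \<bullet> a j = N / 2 * real_of_int (cartan ! i ! j)"
    and orthogonal_zero: "\<And>x. (\<And>i. i < 6 \<Longrightarrow> x \<bullet> a i = 0) \<Longrightarrow> x = 0"
begin

definition lin :: "(nat \<Rightarrow> real) \<Rightarrow> 'a" where
  "lin m = (\<Sum>k<6. m k *\<^sub>R a k)"

definition vec :: "int list \<Rightarrow> 'a" where
  "vec ms = lin (\<lambda>k. real_of_int (ms ! k))"

lemma lin_inner:
  assumes "j < 6"
  shows "lin m \<bullet> a j = N / 2 * (\<Sum>k<6. real_of_int (cartan ! j ! k) * m k)"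
  using assms
  by (rule less6_cases) (simp_all add: lin_def sum_lessThan6 inner_add_left gram cartan_def field_simps)

lemma cartan_inverse:
  assumes "\<And>j. j < 6 \<Longrightarrow> (\<Sum>k<6. real_of_int (cartan ! j ! k) * m k) = 0" and "k < 6"
  shows "m k = 0"
proof -
  have "2 * m 0 - m 2 = 0" "2 * m 1 - m 3 = 0" "- m 0 + 2 * m 2 - m 3 = 0"
    "- m 1 - m 2 + 2 * m 3 - m 4 = 0" "- m 3 + 2 * m 4 - m 5 = 0" "- m 4 + 2 * m 5 = 0"
    using assms(1)[of 0] assms(1)[of 1] assms(1)[of 2] assms(1)[of 3] assms(1)[of 4] assms(1)[of 5]
    by (simp_all add: sum_lessThan6 cartan_def)
  then have "m 0 = 0 \<and> m 1 = 0 \<and> m 2 = 0 \<and> m 3 = 0 \<and> m 4 = 0 \<and> m 5 = 0"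
    by linarith
  then show ?thesis using assms(2) by (auto elim!: less6_cases)
qed

lemma lin_diff: "lin m - lin m' = lin (\<lambda>k. m k - m' k)"
  by (simp add: lin_def sum_subtractf scaleR_diff_left)

lemma lin_zero_iff: "lin m = 0 \<longleftrightarrow> (\<forall>k<6. m k = 0)"
proof
  assume "lin m = 0"
  then have "(\<Sum>k<6. real_of_int (cartan ! j ! k) * m k) = 0" if "j < 6" for j
    using lin_inner[OF that, of m] N_pos by simp
  then show "\<forall>k<6. m k = 0" using cartan_inverse by blast
qed (simp add: lin_def)

lemma lin_eq_iff: "lin m = lin m' \<longleftrightarrow> (\<forall>k<6. m k = m' k)"
  using lin_zero_iff[of "\<lambda>k. m k - m' k"] by (simp flip: lin_diff)

lemma vec_eq_iff:
  assumes "length ms = 6" "length ns = 6"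
  shows "vec ms = vec ns \<longleftrightarrow> ms = ns"
  using assms by (auto simp: vec_def lin_eq_iff intro: nth_equalityI)

lemma norm_root: "i < 6 \<Longrightarrow> a i \<bullet> a i = N"
  using gram[of i i] by (auto elim!: less6_cases simp: cartan_def)

lemma root_nonzero: "i < 6 \<Longrightarrow> a i \<noteq> 0"
  using norm_root N_pos by fastforce

lemma inj_a: "inj_on a {..<6}"
proof (rule inj_onI, rule ccontr)
  fix i j assume ij: "i \<in> {..<6}" "j \<in> {..<6}" "a i = a j" "i \<noteq> j"
  have "a i \<bullet> a j \<noteq> N"
    using gram[of i j] ij N_pos by (auto elim!: less6_cases simp: cartan_def)
  then show False using ij norm_root by simp
qed

lemma lin_delta: "i < 6 \<Longrightarrow> lin (\<lambda>k. if k = i then r else 0) = r *\<^sub>R a i"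
  by (simp add: lin_def if_distrib[of "\<lambda>x. x *\<^sub>R _"] cong: if_cong)

lemma independent_roots: "independent (a ` {..<6})"
proof (rule independent_if_scalars_zero)
  fix u v assume "(\<Sum>v\<in>a ` {..<6}. u v *\<^sub>R v) = 0" "v \<in> a ` {..<6}"
  then have "lin (\<lambda>k. u (a k)) = 0"
    by (simp add: lin_def sum.reindex[OF inj_a] o_def)
  then show "u v = 0" using \<open>v \<in> _\<close> by (auto simp: lin_zero_iff)
qed simp

lemma span_roots: "span (a ` {..<6}) = UNIV"
proof (rule ccontr)
  assume "span (a ` {..<6}) \<noteq> UNIV"
  then have "span (a ` {..<6}) \<subset> UNIV" by blast
  then have "\<exists>x. x \<noteq> 0 \<and> (\<forall>y\<in>span (a ` {..<6}). orthogonal x y)"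
    by (metis orthogonal_to_subspace_exists_gen span_UNIV UNIV_I)
  then obtain x where "x \<noteq> 0" "\<forall>y\<in>span (a ` {..<6}). orthogonal x y" by blast
  then show False using orthogonal_zero[of x] span_base[of _ "a ` {..<6}"]
    by (auto simp: orthogonal_def)
qed

lemma ex_lin: "\<exists>m. x = lin m"
proof -
  have "x \<in> span (a ` {..<6})" by (simp add: span_roots)
  then obtain u where "x = (\<Sum>v\<in>a ` {..<6}. u v *\<^sub>R v)"
    by (subst (asm) span_finite) auto
  then have "x = lin (\<lambda>k. u (a k))" by (simp add: lin_def sum.reindex[OF inj_a])
  then show ?thesis by blast
qed

lemma eq_by_inner: "(\<And>i. i < 6 \<Longrightarrow> x \<bullet> a i = y \<bullet> a i) \<Longrightarrow> x = y"
  using orthogonal_zero[of "x - y"] by (simp add: inner_diff_left)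

lemma representation_lin:
  assumes "k < 6"
  shows "representation (a ` {..<6}) (lin m) (a k) = m k"
proof -
  let ?B = "a ` {..<6}"
  have "representation ?B (lin m) = (\<lambda>b. \<Sum>i<6. representation ?B (m i *\<^sub>R a i) b)"
    unfolding lin_def using independent_roots
    by (intro real_vector.representation_sum) (auto simp: span_roots)
  also have "\<dots> = (\<lambda>b. \<Sum>i<6. m i * representation ?B (a i) b)"
    using independent_roots by (simp add: real_vector.representation_scale span_roots)
  also have "\<dots> = (\<lambda>b. \<Sum>i<6. m i * (if b = a i then 1 else 0))"
    using independent_roots by (intro ext sum.cong) (auto simp: real_vector.representation_basis)
  finally have "representation ?B (lin m) (a k) = (\<Sum>i<6. m i * (if a k = a i then 1 else 0))"
    by simp
  also have "\<dots> = (\<Sum>i<6. if i = k then m i else 0)"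
    using inj_a assms by (intro sum.cong) (auto simp: inj_on_def)
  finally show ?thesis using assms by simp
qed

lemma reflect_root: "i < 6 \<Longrightarrow> reflect (a i) x = x - (2 * (x \<bullet> a i) / N) *\<^sub>R a i"
  by (simp add: reflect_def norm_root)

lemma reflect_lin:
  assumes "i < 6"
  shows "reflect (a i) (lin m) = lin (\<lambda>k. m k - (if k = i then \<Sum>l<6. real_of_int (cartan ! i ! l) * m l else 0))"
  using assms N_pos by (simp add: reflect_root lin_inner lin_diff flip: lin_delta)

lemma vec_inner:
  assumes "j < 6" "length ms = 6"
  shows "vec ms \<bullet> a j = N / 2 * real_of_int (pairing j ms)"
  using assms(2)
proof (rule length6_cases)
  fix m0 m1 m2 m3 m4 m5 assume "ms = [m0,m1,m2,m3,m4,m5]"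
  then show ?thesis using assms(1)
    by (auto simp: vec_def lin_inner sum_lessThan6 cartan_def elim!: less6_cases)
qed

lemma reflect_vec:
  assumes "i < 6" "length ms = 6"
  shows "reflect (a i) (vec ms) = vec (refl_coords i ms)"
proof -
  have "(\<Sum>l<6. real_of_int (cartan ! i ! l) * real_of_int (ms ! l)) = real_of_int (pairing i ms)"
    using vec_inner[OF assms] lin_inner[OF assms(1), of "\<lambda>k. real_of_int (ms ! k)"] N_pos
    by (simp add: vec_def)
  then show ?thesis
    unfolding vec_def reflect_lin[OF assms(1)] lin_eq_iff using assms
    by (auto simp: nth_list_update simp del: pairing.simps)
qed

lemma vec_uminus: "length ms = 6 \<Longrightarrow> vec (map uminus ms) = - vec ms"
  by (auto simp: vec_def lin_def sum_negf[symmetric] intro: sum.cong)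

lemma vec_unit: "i < 6 \<Longrightarrow> vec (unit_coords i) = a i"
proof -
  assume i: "i < 6"
  have "vec (unit_coords i) = lin (\<lambda>k. if k = i then 1 else 0)"
    unfolding vec_def lin_eq_iff unit_coords_def by (auto simp: nth_list_update)
  then show ?thesis using lin_delta[OF i, of 1] by simp
qed

end

lemma refl_group_fixes:
  assumes "w \<in> refl_group B" "\<And>b. b \<in> B \<Longrightarrow> reflect b x = x"
  shows "w x = x"
  using assms(1) by induction (simp_all add: assms(2))

text \<open>The passage from the abstract hypotheses to coordinates: the Coxeter matrix yields the
  Gram matrix up to the scale N, since equality of lengths propagates along the edges of the
  connected diagram.\<close>

lemma E6_roots_exist:
  assumes rs: "root_system \<Phi>" and ss: "simple_system \<Phi> (simples S)" and e6: "type_E6 (simples S)"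
    and fixo: "fixes_only_origin (simples S)" and bip: "bipartition S"
  shows "\<exists>a N \<epsilon>. E6_roots a N \<and> S \<epsilon> = a ` {0,3,5} \<and> S (opp \<epsilon>) = a ` {1,2,4}"
proof -
  obtain f where f: "bij_betw f {1..6::nat} (simples S)"
    and cm: "\<And>i j. i \<in> {1..6} \<Longrightarrow> j \<in> {1..6} \<Longrightarrow> i \<noteq> j \<Longrightarrow>
        coxeter_matrix (f i) (f j) = (if {i, j} \<in> E6_edges then 3 else 2)"
    using e6 unfolding type_E6_def by blast
  define a where "a i = f (Suc i)" for i
  have inj: "a i \<noteq> a j" if "i < 6" "j < 6" "i \<noteq> j" for i j
    using f that unfolding a_def bij_betw_def by (auto dest: inj_onD)
  have "simples S = f ` Suc ` {..<6}"
  proof -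
    have "Suc ` {..<6} = {1..6}" by (auto simp: image_Suc_lessThan)
    then show ?thesis using f by (simp add: bij_betw_def)
  qed
  then have \<Delta>: "simples S = a ` {..<6}" by (simp add: a_def image_image)
  then have in\<Delta>: "a i \<in> simples S" if "i < 6" for i using that by simp
  have cma: "coxeter_matrix (a i) (a j) = (if {Suc i, Suc j} \<in> E6_edges then 3 else 2)"
    if "i < 6" "j < 6" "i \<noteq> j" for i j
    using cm[of "Suc i" "Suc j"] that unfolding a_def by auto
  have adj: "2 * (a i \<bullet> a j) = - (a i \<bullet> a i) \<and> a i \<bullet> a i = a j \<bullet> a j"
    if "i < 6" "j < 6" "i \<noteq> j" "{Suc i, Suc j} \<in> E6_edges" for i j
    using coxeter_matrix_3_inner[OF rs ss in\<Delta> in\<Delta> inj] cma that by simp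
  have nonadj: "a i \<bullet> a j = 0"
    if "i < 6" "j < 6" "i \<noteq> j" "{Suc i, Suc j} \<notin> E6_edges" for i j
    using coxeter_matrix_2_inner[OF rs ss in\<Delta> in\<Delta> inj] cma that by simp
  define N where "N = a 0 \<bullet> a 0"
  have n: "a 2 \<bullet> a 2 = N" "a 3 \<bullet> a 3 = N" "a 4 \<bullet> a 4 = N" "a 5 \<bullet> a 5 = N" "a 1 \<bullet> a 1 = N"
    using adj[of 0 2] adj[of 2 3] adj[of 3 4] adj[of 4 5] adj[of 1 3]
    by (simp_all add: E6_edges_def N_def doubleton_eq_iff)
  have N: "N > 0" using simple_roots_nonzero[OF rs ss in\<Delta>, of 0] by (simp add: N_def)
  have I01: "a 0 \<bullet> a (Suc 0) = 0" "a (Suc 0) \<bullet> a 0 = 0"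
    using nonadj[of 0 1] n by (simp_all add: E6_edges_def doubleton_eq_iff N_def inner_commute)
  have I02: "a 0 \<bullet> a 2 = - (N / 2)" "a 2 \<bullet> a 0 = - (N / 2)"
    using adj[of 0 2] n by (simp_all add: E6_edges_def doubleton_eq_iff N_def inner_commute)
  have I03: "a 0 \<bullet> a 3 = 0" "a 3 \<bullet> a 0 = 0"
    using nonadj[of 0 3] n by (simp_all add: E6_edges_def doubleton_eq_iff N_def inner_commute)
  have I04: "a 0 \<bullet> a 4 = 0" "a 4 \<bullet> a 0 = 0"
    using nonadj[of 0 4] n by (simp_all add: E6_edges_def doubleton_eq_iff N_def inner_commute)
  have I05: "a 0 \<bullet> a 5 = 0" "a 5 \<bullet> a 0 = 0"
    using nonadj[of 0 5] n by (simp_all add: E6_edges_def doubleton_eq_iff N_def inner_commute)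
  have I12: "a (Suc 0) \<bullet> a 2 = 0" "a 2 \<bullet> a (Suc 0) = 0"
    using nonadj[of 1 2] n by (simp_all add: E6_edges_def doubleton_eq_iff N_def inner_commute)
  have I13: "a (Suc 0) \<bullet> a 3 = - (N / 2)" "a 3 \<bullet> a (Suc 0) = - (N / 2)"
    using adj[of 1 3] n by (simp_all add: E6_edges_def doubleton_eq_iff N_def inner_commute)
  have I14: "a (Suc 0) \<bullet> a 4 = 0" "a 4 \<bullet> a (Suc 0) = 0"
    using nonadj[of 1 4] n by (simp_all add: E6_edges_def doubleton_eq_iff N_def inner_commute)
  have I15: "a (Suc 0) \<bullet> a 5 = 0" "a 5 \<bullet> a (Suc 0) = 0"
    using nonadj[of 1 5] n by (simp_all add: E6_edges_def doubleton_eq_iff N_def inner_commute)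
  have I23: "a 2 \<bullet> a 3 = - (N / 2)" "a 3 \<bullet> a 2 = - (N / 2)"
    using adj[of 2 3] n by (simp_all add: E6_edges_def doubleton_eq_iff N_def inner_commute)
  have I24: "a 2 \<bullet> a 4 = 0" "a 4 \<bullet> a 2 = 0"
    using nonadj[of 2 4] n by (simp_all add: E6_edges_def doubleton_eq_iff N_def inner_commute)
  have I25: "a 2 \<bullet> a 5 = 0" "a 5 \<bullet> a 2 = 0"
    using nonadj[of 2 5] n by (simp_all add: E6_edges_def doubleton_eq_iff N_def inner_commute)
  have I34: "a 3 \<bullet> a 4 = - (N / 2)" "a 4 \<bullet> a 3 = - (N / 2)"
    using adj[of 3 4] n by (simp_all add: E6_edges_def doubleton_eq_iff N_def inner_commute)
  have I35: "a 3 \<bullet> a 5 = 0" "a 5 \<bullet> a 3 = 0"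
    using nonadj[of 3 5] n by (simp_all add: E6_edges_def doubleton_eq_iff N_def inner_commute)
  have I45: "a 4 \<bullet> a 5 = - (N / 2)" "a 5 \<bullet> a 4 = - (N / 2)"
    using adj[of 4 5] n by (simp_all add: E6_edges_def doubleton_eq_iff N_def inner_commute)
  have n': "a 0 \<bullet> a 0 = N" "a (Suc 0) \<bullet> a (Suc 0) = N" using n N_def by simp_all
  have gram: "a i \<bullet> a j = N / 2 * real_of_int (cartan ! i ! j)" if "i < 6" "j < 6" for i j
    by (rule less6_cases[OF that(1)]; rule less6_cases[OF that(2)]; hypsubst)
      (simp_all add: cartan_def n n' I01 I02 I03 I04 I05 I12 I13 I14 I15 I23 I24 I25 I34 I35 I45)
  \<comment> \<open>A vector orthogonal to all simple roots is fixed by every generator, hence by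
    the whole group.\<close>
  have oz: "x = 0" if "\<And>i. i < 6 \<Longrightarrow> x \<bullet> a i = 0" for x
  proof -
    have "reflect b x = x" if "b \<in> simples S" for b
      using that \<open>\<And>i. i < 6 \<Longrightarrow> x \<bullet> a i = 0\<close> unfolding \<Delta> by (auto simp: reflect_def)
    then have "w x = x" if "w \<in> refl_group (simples S)" for w
      using refl_group_fixes[OF that] by blast
    then show ?thesis using fixo unfolding fixes_only_origin_def by blast
  qed
  have "E6_roots a N" using N gram oz by unfold_locales auto
  moreover have "\<exists>\<epsilon>. S \<epsilon> = a ` {0,3,5} \<and> S (opp \<epsilon>) = a ` {1,2,4}"
  proof -
    \<comment> \<open>Adjacent nodes lie in different halves. So the half containing node 0
      determines all the others, along the path and then the edge 1-3; only the sign of that half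
      remains free.\<close>
    obtain \<epsilon> where \<epsilon>: "a 0 \<in> S \<epsilon>" using in\<Delta>[of 0] by (auto simp: simples_def)
    have "S \<epsilon> \<union> S (opp \<epsilon>) = simples S" by (cases \<epsilon>) (simp_all add: simples_def Un_commute)
    moreover have "S Plus \<inter> S Minus = {}" using bip unfolding bipartition_def by blast
    then have "S \<epsilon> \<inter> S (opp \<epsilon>) = {}" by (cases \<epsilon>) (simp_all add: Int_commute)
    ultimately have un: "S \<epsilon> \<union> S (opp \<epsilon>) = a ` {..<6}" "S \<epsilon> \<inter> S (opp \<epsilon>) = {}"
      using \<Delta> by simp_all
    have sep: "\<not> (a i \<in> S \<delta> \<and> a j \<in> S \<delta>)"
      if "i < 6" "j < 6" "i \<noteq> j" "{Suc i, Suc j} \<in> E6_edges" for i j \<delta>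
    proof
      assume "a i \<in> S \<delta> \<and> a j \<in> S \<delta>"
      then have "\<not> coxeter_matrix (a i) (a j) \<ge> 3"
        using bip inj[OF that(1-3)] unfolding bipartition_def by blast
      then show False using cma[OF that(1-3)] that(4) by simp
    qed
    have or: "a i \<in> S \<epsilon> \<or> a i \<in> S (opp \<epsilon>)" if "i < 6" for i using un that by blast
    have e: "{Suc 0, Suc 2} \<in> E6_edges" "{Suc 2, Suc 3} \<in> E6_edges" "{Suc 3, Suc 4} \<in> E6_edges"
      "{Suc 4, Suc 5} \<in> E6_edges" "{Suc 1, Suc 3} \<in> E6_edges"
      by (simp_all add: E6_edges_def doubleton_eq_iff)
    have p: "a 2 \<in> S (opp \<epsilon>)" "a 3 \<in> S \<epsilon>" "a 4 \<in> S (opp \<epsilon>)" "a 1 \<in> S (opp \<epsilon>)" "a 5 \<in> S \<epsilon>"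
    proof -
      show 2: "a 2 \<in> S (opp \<epsilon>)" using sep[OF _ _ _ e(1), of \<epsilon>] or[of 2] \<epsilon> by auto
      show 3: "a 3 \<in> S \<epsilon>" using sep[OF _ _ _ e(2), of "opp \<epsilon>"] or[of 3] 2 by auto
      show 4: "a 4 \<in> S (opp \<epsilon>)" using sep[OF _ _ _ e(3), of \<epsilon>] or[of 4] 3 by auto
      show "a 1 \<in> S (opp \<epsilon>)" using sep[OF _ _ _ e(5), of \<epsilon>] or[of 1] 3 by auto
      show "a 5 \<in> S \<epsilon>" using sep[OF _ _ _ e(4), of "opp \<epsilon>"] or[of 5] 4 by auto
    qed
    have "a ` {..<6} = {a 0, a 1, a 2, a 3, a 4, a 5}" unfolding lessThan6 by simp
    then have U: "S \<epsilon> \<union> S (opp \<epsilon>) = {a 0, a 1, a 2, a 3, a 4, a 5}" using un(1) by simp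
    have "y \<in> {a 0, a 3, a 5}" if "y \<in> S \<epsilon>" for y
    proof -
      have "y \<in> {a 0, a 1, a 2, a 3, a 4, a 5}" using that U by blast
      moreover have "y \<notin> S (opp \<epsilon>)" using that un(2) by blast
      then have "y \<noteq> a 1" "y \<noteq> a 2" "y \<noteq> a 4" using p by metis+
      ultimately show ?thesis by blast
    qed
    moreover have "y \<in> {a 1, a 2, a 4}" if "y \<in> S (opp \<epsilon>)" for y
    proof -
      have "y \<in> {a 0, a 1, a 2, a 3, a 4, a 5}" using that U by blast
      moreover have "y \<notin> S \<epsilon>" using that un(2) by blast
      then have "y \<noteq> a 0" "y \<noteq> a 3" "y \<noteq> a 5" using p \<epsilon> by metis+
      ultimately show ?thesis by blast
    qed
    ultimately have "S \<epsilon> = {a 0, a 3, a 5}" "S (opp \<epsilon>) = {a 1, a 2, a 4}"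
      using p \<epsilon> by (intro subset_antisym subsetI; force)+
    then show ?thesis by (intro exI[of _ \<epsilon>]) simp
  qed
  ultimately show ?thesis by blast
qed

section \<open>The almost positive roots, the involutions and compatibility as tables\<close>

definition apr :: "int list list" where
  "apr = [
    [-1,0,0,0,0,0], [0,-1,0,0,0,0], [0,0,-1,0,0,0], [0,0,0,-1,0,0], [0,0,0,0,-1,0],
    [0,0,0,0,0,-1], [1,0,0,0,0,0], [0,1,0,0,0,0], [0,0,1,0,0,0], [0,0,0,1,0,0],
    [0,0,0,0,1,0], [0,0,0,0,0,1], [1,0,1,0,0,0], [0,1,0,1,0,0], [1,0,1,1,0,0],
    [0,1,1,1,1,0], [0,0,0,1,1,1], [0,0,0,0,1,1], [0,0,1,1,0,0], [0,0,1,1,1,0],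
    [1,1,1,1,1,0], [1,1,1,2,1,1], [0,1,1,1,1,1], [0,0,0,1,1,0], [0,1,0,1,1,0],
    [1,0,1,1,1,1], [0,1,1,2,1,1], [1,1,2,2,2,1], [1,1,1,2,1,0], [0,1,1,1,0,0],
    [0,1,0,1,1,1], [1,1,1,1,1,1], [0,1,1,2,2,1], [1,1,2,3,2,1], [1,1,2,2,1,0],
    [1,1,1,1,0,0], [0,0,1,1,1,1], [0,1,1,2,1,0], [1,1,1,2,2,1], [1,2,2,3,2,1],
    [1,1,2,2,1,1], [1,0,1,1,1,0]]"

text \<open>Entry j is the index in \<open>apr\<close> of the image of root j. Indices below 6 are
  the negative simple roots, so index k < 6 stands for the negative of simple root k.\<close>

definition tau_table :: "bool \<Rightarrow> nat list" where
  "tau_table b = (if b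
    then [6,1,2,9,4,11,0,13,14,3,16,5,18,7,8,21,10,23,12,25,26,15,28,17,30,19,20,33,22,35,24,37,38,27,40,29,41,31,32,39,34,36]
    else [0,7,8,3,10,5,12,1,2,15,4,17,6,19,20,9,22,11,24,13,14,27,16,29,18,31,32,21,34,23,36,25,26,39,28,41,30,37,40,33,38,35])"

text \<open>Row i lists, in ascending order, the indices of the roots compatible with root
  i.\<close>

definition compat_table :: "nat list list" where
  "compat_table = [
    [1,2,3,4,5,7,8,9,10,11,13,15,16,17,18,19,22,23,24,26,29,30,32,36,37], [0,2,3,4,5,6,8,9,10,11,12,14,16,17,18,19,23,25,36,41],
    [0,1,3,4,5,6,7,9,10,11,13,16,17,23,24,30], [0,1,2,4,5,6,7,8,10,11,12,17],
    [0,1,2,3,5,6,7,8,9,11,12,13,14,18,29,35], [0,1,2,3,4,6,7,8,9,10,12,13,14,15,18,19,20,23,24,28,29,34,35,37,41],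
    [1,2,3,4,5,7,9,10,11,12,13,14,16,17,20,21,23,24,25,28,30,31,35,38,41], [0,2,3,4,5,6,8,10,11,12,13,15,17,20,22,24,29,30,31,35],
    [0,1,3,4,5,7,10,11,12,15,17,18,19,22,29,36], [0,1,2,4,5,6,11,13,14,16,18,23],
    [0,1,2,3,5,6,7,8,12,15,17,19,20,23,24,41], [0,1,2,3,4,6,7,8,9,12,13,14,16,17,18,21,22,25,26,29,30,31,35,36,40],
    [1,3,4,5,6,7,8,10,11,14,15,17,18,19,20,22,25,27,29,31,34,35,36,40,41], [0,2,4,5,6,7,9,11,14,16,18,21,23,24,26,28,29,30,35,37],
    [1,4,5,6,9,11,12,13,16,18,21,23,25,28,35,41], [0,5,7,8,10,12,17,19,20,22,24,29],
    [0,1,2,6,9,11,13,14,17,18,21,23,25,26,30,36], [0,1,2,3,6,7,8,10,11,12,15,16,19,20,22,23,24,25,27,30,31,32,36,38,41],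
    [0,1,4,5,8,9,11,12,13,14,16,19,21,23,25,26,28,29,33,34,35,36,37,40,41], [0,1,5,8,10,12,15,17,18,20,22,23,24,27,29,32,34,36,37,41],
    [5,6,7,10,12,15,17,19,22,24,27,29,31,34,35,41], [6,11,13,14,16,18,23,25,26,28,30,35],
    [0,7,8,11,12,15,17,19,20,24,27,29,30,31,32,36], [0,1,2,5,6,9,10,13,14,16,17,18,19,21,24,25,26,28,30,32,33,36,37,38,41],
    [0,2,5,6,7,10,13,15,17,19,20,22,23,27,28,29,30,31,32,34,35,37,38,39,41], [1,6,11,12,14,16,17,18,21,23,26,28,30,31,33,35,36,38,40,41],
    [0,11,13,16,18,21,23,25,28,29,30,33,35,36,37,40], [12,17,19,20,22,24,29,31,32,34,36,41],
    [5,6,13,14,18,21,23,24,25,26,30,33,35,37,38,41], [0,4,5,7,8,11,12,13,15,18,19,20,22,24,26,27,30,31,32,34,35,36,37,39,40],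
    [0,2,6,7,11,13,16,17,21,22,23,24,25,26,28,29,31,32,33,35,36,37,38,39,40], [6,7,11,12,17,20,22,24,25,27,29,30,32,34,35,36,38,39,40,41],
    [0,17,19,22,23,24,27,29,30,31,34,36,37,38,39,41], [18,23,25,26,28,30,35,36,37,38,40,41],
    [5,12,18,19,20,24,27,29,31,32,35,36,37,39,40,41], [4,5,6,7,11,12,13,14,18,20,21,24,25,26,28,29,30,31,33,34,37,38,39,40,41],
    [0,1,8,11,12,16,17,18,19,22,23,25,26,27,29,30,31,32,33,34,37,38,39,40,41], [0,5,13,18,19,23,24,26,28,29,30,32,33,34,35,36,38,39,40,41],
    [6,17,23,24,25,28,30,31,32,33,35,36,37,39,40,41], [24,29,30,31,32,34,35,36,37,38,40,41],
    [11,12,18,25,26,29,30,31,33,34,35,36,37,38,39,41], [1,5,6,10,12,14,17,18,19,20,23,24,25,27,28,31,32,33,34,35,36,37,38,39,40]]"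

definition pos :: "int list list" where
  "pos = drop 6 apr"

definition cls :: "bool \<Rightarrow> nat list" where
  "cls b = (if b then [0,3,5] else [1,2,4])"

text \<open>The case distinction keeps the simplifier from unfolding the recursion on a symbolic list.\<close>

fun apply_word :: "nat list \<Rightarrow> int list \<Rightarrow> int list" where
  "apply_word [] ms = ms"
| "apply_word (i # is) ms = (if ms = [] then [] else apply_word is (refl_coords i ms))"

definition half :: "bool \<Rightarrow> int list \<Rightarrow> int list" where
  "half b ms = apply_word (cls b) ms"

definition tau_coords :: "bool \<Rightarrow> int list \<Rightarrow> int list" where
  "tau_coords b ms = (if ms \<in> set (map (\<lambda>i. map uminus (unit_coords i)) (cls (\<not> b))) then ms else half b ms)"

lemma list_all6: "list_all P [0,1,2,3,4,5] \<Longrightarrow> i < 6 \<Longrightarrow> P (i::nat)"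
  by (erule less6_cases) simp_all

lemma length_apply_word [simp]: "length (apply_word is ms) = length ms"
  by (induction "is" ms rule: apply_word.induct) simp_all

lemma length_half [simp]: "length (half b ms) = length ms"
  by (simp add: half_def)

lemma length_apr: "length apr = 42"
  by (simp add: apr_def)

lemma apr_length6: "ms \<in> set apr \<Longrightarrow> length ms = 6"
proof -
  have "list_all (\<lambda>ms. length ms = 6) apr" by (simp add: apr_def)
  then show "ms \<in> set apr \<Longrightarrow> length ms = 6" by (simp add: list_all_iff)
qed

lemma distinct_apr: "distinct apr"
  by code_simp

lemma pos_subset_apr: "set pos \<subseteq> set apr"
  by (simp add: pos_def set_drop_subset)

lemma apr_neg: "i < 6 \<Longrightarrow> apr ! i = map uminus (unit_coords i)"
  by (erule less6_cases) (simp_all add: apr_def unit_coords_def numeral_eq_Suc)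

lemma pos_nonneg: "ms \<in> set pos \<Longrightarrow> k < 6 \<Longrightarrow> ms ! k \<ge> 0"
proof -
  have "list_all (list_all (\<lambda>x. x \<ge> 0)) pos" by code_simp
  moreover assume "ms \<in> set pos" "k < 6"
  moreover from this have "length ms = 6" using apr_length6 pos_subset_apr by blast
  ultimately show ?thesis by (auto simp: list_all_iff)
qed

text \<open>A simple reflection permutes the positive roots other than its own root. This closure is
  what rules out a positive root missing from the list.\<close>

lemma pos_closed:
  assumes "ms \<in> set pos" "i < 6"
  shows "ms = unit_coords i \<or> refl_coords i ms \<in> set pos"
proof -
  have "list_all (\<lambda>ms. list_all (\<lambda>i. ms = unit_coords i \<or> refl_coords i ms \<in> set pos) [0,1,2,3,4,5]) pos"
    by code_simp
  then have "list_all (\<lambda>i. ms = unit_coords i \<or> refl_coords i ms \<in> set pos) [0,1,2,3,4,5]"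
    using assms(1) unfolding list_all_iff by blast
  from list_all6[OF this assms(2)] show ?thesis .
qed

text \<open>Descent by reflections that lower the height. Read upwards, it builds every listed
  vector from a simple root, so each of them is a root.\<close>

lemma pos_descend:
  "ms \<in> set pos \<Longrightarrow> (\<exists>i<6. ms = unit_coords i) \<or>
     (\<exists>i<6. refl_coords i ms \<in> set pos \<and> sum_list (refl_coords i ms) < sum_list ms)"
proof -
  have "list_all (\<lambda>ms. ms \<in> set (map unit_coords [0,1,2,3,4,5]) \<or>
     list_ex (\<lambda>i. refl_coords i ms \<in> set pos \<and> sum_list (refl_coords i ms) < sum_list ms) [0,1,2,3,4,5]) pos"
    by code_simp
  moreover assume "ms \<in> set pos"
  ultimately have "ms \<in> set (map unit_coords [0,1,2,3,4,5]) \<or>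
     list_ex (\<lambda>i. refl_coords i ms \<in> set pos \<and> sum_list (refl_coords i ms) < sum_list ms) [0,1,2,3,4,5]"
    unfolding list_all_iff by blast
  then show ?thesis
  proof
    assume "ms \<in> set (map unit_coords [0,1,2,3,4,5])"
    then have "\<exists>i<6. ms = unit_coords i" by force
    then show ?thesis ..
  next
    assume "list_ex (\<lambda>i. refl_coords i ms \<in> set pos \<and> sum_list (refl_coords i ms) < sum_list ms) [0,1,2,3,4,5]"
    then obtain i where "i \<in> set [0,1,2,3,4,5]" "refl_coords i ms \<in> set pos"
      "sum_list (refl_coords i ms) < sum_list ms" unfolding list_ex_iff by blast
    moreover from this have "i < 6" by auto
    ultimately show ?thesis by blast
  qed
qed

lemma unit_in_pos: "i < 6 \<Longrightarrow> unit_coords i \<in> set pos"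
proof -
  have "list_all (\<lambda>i. unit_coords i \<in> set pos) [0,1,2,3,4,5]" by code_simp
  then show "i < 6 \<Longrightarrow> ?thesis" by (rule list_all6)
qed

lemma tau_table_bound: "j < 42 \<Longrightarrow> tau_table b ! j < 42"
proof -
  have "list_all (\<lambda>b. length (tau_table b) = 42 \<and> list_all (\<lambda>j. j < 42) (tau_table b)) [True, False]"
    by code_simp
  then show "j < 42 \<Longrightarrow> ?thesis" by (cases b) (auto simp: list_all_length)
qed

lemma tau_coords_apr: "j < 42 \<Longrightarrow> tau_coords b (apr ! j) = apr ! (tau_table b ! j)"
proof -
  have "list_all (\<lambda>b. map (tau_coords b) apr = map (nth apr) (tau_table b)) [True, False]"
    by code_simp
  then have "map (tau_coords b) apr = map (nth apr) (tau_table b)" by (cases b) auto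
  moreover assume "j < 42"
  moreover have "length (tau_table b) = 42" by (simp add: tau_table_def)
  ultimately show ?thesis by (metis length_apr nth_map)
qed

text \<open>The list is in breadth-first order under the two involutions, starting from the
  negative simple roots.\<close>

lemma tau_table_pred: "j < 42 \<Longrightarrow> \<not> j < 6 \<Longrightarrow> \<exists>b. \<exists>i<j. j = tau_table b ! i"
proof -
  define ps :: "(bool \<times> nat) list" where "ps = [
    (True,0), (False,1), (False,2), (True,3), (False,4), (True,5), (False,6), (True,7), (True,8), (False,9), (True,10), (False,11),
    (True,12), (False,13), (False,14), (True,15), (False,16), (True,17), (False,18), (True,19), (True,20), (False,21), (True,22), (False,23),
    (True,24), (False,25), (False,26), (True,27), (False,28), (True,29), (False,30), (True,31), (True,32), (False,33), (True,34), (False,35)]"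
  have l: "length ps = 36" by (simp add: ps_def)
  have m: "list_all2 (\<lambda>j (b, i). i < j \<and> j = tau_table b ! i) [6..<42] ps"
    unfolding ps_def by code_simp
  assume "j < 42" "\<not> j < 6"
  then have k: "j - 6 < length [6..<42]" "6 + (j - 6) < 42" "6 + (j - 6) = j"
    unfolding length_upt by linarith+
  have "[6..<42] ! (j - 6) = j" using nth_upt[OF k(2)] k(3) by simp
  then have "(\<lambda>(b, i). i < j \<and> j = tau_table b ! i) (ps ! (j - 6))"
    using list_all2_nthD[OF m k(1)] by metis
  then show ?thesis by (cases "ps ! (j - 6)") auto
qed

text \<open>That every orbit of the involutions meets the negative simple roots, in the form of an
  induction rule. It yields uniqueness both of the compatibility relation and of the family of
  diagrams.\<close>

lemma apr_index_induct [consumes 1, case_names neg tau]: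
  assumes "j < 42" "\<And>j. j < 6 \<Longrightarrow> P j" "\<And>b i. i < 42 \<Longrightarrow> P i \<Longrightarrow> P (tau_table b ! i)"
  shows "P j"
  using assms(1)
proof (induction j rule: less_induct)
  case (less j)
  show ?case
  proof (cases "j < 6")
    case False
    then obtain b i where "i < j" "j = tau_table b ! i" using tau_table_pred less.prems by blast
    then show ?thesis using assms(3) less by force
  qed (rule assms(2))
qed

lemma compat_table_lengths: "length compat_table = 42" "list_all (list_all (\<lambda>j. j < 42)) compat_table"
  by (simp_all add: compat_table_def)

lemma length_tau_table: "length (tau_table b) = 42"
  by (simp add: tau_table_def)

lemma tau_table_involution: "j < 42 \<Longrightarrow> tau_table b ! (tau_table b ! j) = j"
proof -
  have "map (nth (tau_table b)) (tau_table b) = [0..<42]"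
    by (cases b) (simp_all add: tau_table_def upt_rec)
  then show "j < 42 \<Longrightarrow> ?thesis" by (metis add_0 length_tau_table nth_map nth_upt)
qed

lemma compat_table_tau_subset_True:
  "list_all (\<lambda>i. list_all (\<lambda>j. tau_table True ! j \<in> set (compat_table ! (tau_table True ! i))) (compat_table ! i)) [0..<42]"
  by code_simp

lemma compat_table_tau_subset_False:
  "list_all (\<lambda>i. list_all (\<lambda>j. tau_table False ! j \<in> set (compat_table ! (tau_table False ! i))) (compat_table ! i)) [0..<42]"
  by code_simp

text \<open>Only inclusions are evaluated; they become equivalences because both involutions are
  their own inverses.\<close>

lemma compat_table_tau:
  assumes "i < 42" "j < 42"
  shows "tau_table b ! j \<in> set (compat_table ! (tau_table b ! i)) \<longleftrightarrow> j \<in> set (compat_table ! i)"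
proof -
  have *: "tau_table b ! j \<in> set (compat_table ! (tau_table b ! i))"
    if "i < 42" "j \<in> set (compat_table ! i)" for i j
    using compat_table_tau_subset_True compat_table_tau_subset_False that
    unfolding list_all_iff by (cases b) auto
  show ?thesis
    using *[of i j] *[of "tau_table b ! i" "tau_table b ! j"] tau_table_involution tau_table_bound assms
    by metis
qed

lemma compat_table_neg:
  assumes "i < 42" "k < 6"
  shows "k \<in> set (compat_table ! i) \<longleftrightarrow> apr ! i ! k = 0"
proof -
  have "list_all2 (\<lambda>row m. list_all (\<lambda>k. (k \<in> set row) = (m ! k = 0)) [0,1,2,3,4,5]) compat_table apr"
    by (simp add: compat_table_def apr_def)
  then have "list_all (\<lambda>k. (k \<in> set (compat_table ! i)) = (apr ! i ! k = 0)) [0,1,2,3,4,5]"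
    using assms(1) by (simp only: list_all2_conv_all_nth compat_table_lengths length_apr)
  from list_all6[OF this assms(2)] show ?thesis .
qed

section \<open>Compatibility as a finite table\<close>

lemma reflect_commute:
  assumes "a \<bullet> b = 0"
  shows "reflect a (reflect b x) = reflect b (reflect a x)"
  using assms by (simp add: reflect_def inner_diff_left inner_commute algebra_simps)

text \<open>The fold over a set can be unfolded only if the factors commute, which orthogonality of
  the three roots provides.\<close>

lemma c_half_triple:
  assumes S: "S \<epsilon> = {x, y, z}" and d: "x \<noteq> y" "x \<noteq> z" "y \<noteq> z"
    and o: "x \<bullet> y = 0" "x \<bullet> z = 0" "y \<bullet> z = 0"
  shows "c_half S \<epsilon> = reflect x \<circ> (reflect y \<circ> reflect z)"
proof -
  interpret comp_fun_commute_on "{x, y, z}" "\<lambda>a w. reflect a \<circ> w"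
  proof
    fix u v assume "u \<in> {x, y, z}" "v \<in> {x, y, z}"
    then have "u = v \<or> u \<bullet> v = 0" using o by (auto simp: inner_commute)
    then show "(\<lambda>w. reflect v \<circ> w) \<circ> (\<lambda>w. reflect u \<circ> w) = (\<lambda>w. reflect u \<circ> w) \<circ> (\<lambda>w. reflect v \<circ> w)"
    proof
      assume h: "u \<bullet> v = 0"
      show ?thesis by (intro ext) (simp add: reflect_commute[OF h])
    qed simp
  qed
  show ?thesis unfolding c_half_def S using d by (simp add: fun_eq_iff)
qed

locale E6_setting = E6_roots a N for a :: "nat \<Rightarrow> 'a::euclidean_space" and N +
  fixes \<Phi> :: "'a set" and S :: "sign \<Rightarrow> 'a set" and \<epsilon>\<^sub>0 :: sign
  assumes rs: "root_system \<Phi>" and ss: "simple_system \<Phi> (simples S)"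
    and S_pos: "S \<epsilon>\<^sub>0 = a ` {0,3,5}" and S_neg: "S (opp \<epsilon>\<^sub>0) = a ` {1,2,4}"
begin

text \<open>Translates the Boolean name of a half into the sign that it carries in S.\<close>

definition sg :: "bool \<Rightarrow> sign" where
  "sg b = (if b then \<epsilon>\<^sub>0 else opp \<epsilon>\<^sub>0)"

lemma opp_sg: "opp (sg b) = sg (\<not> b)"
proof -
  have "opp (opp \<epsilon>\<^sub>0) = \<epsilon>\<^sub>0" by (cases \<epsilon>\<^sub>0) simp_all
  then show ?thesis by (simp add: sg_def)
qed

lemma ex_sg: "\<exists>b. \<epsilon> = sg b"
proof -
  have "\<epsilon> = \<epsilon>\<^sub>0 \<or> \<epsilon> = opp \<epsilon>\<^sub>0" by (cases \<epsilon>; cases \<epsilon>\<^sub>0) simp_all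
  then show ?thesis unfolding sg_def by metis
qed

lemma S_sg: "S (sg b) = a ` set (cls b)"
  using S_pos S_neg by (simp add: sg_def cls_def)

lemma simples_S: "simples S = a ` {..<6}"
proof -
  have "simples S = S \<epsilon>\<^sub>0 \<union> S (opp \<epsilon>\<^sub>0)" by (cases \<epsilon>\<^sub>0) (auto simp: simples_def)
  also have "\<dots> = a ` {..<6}" unfolding S_pos S_neg lessThan6 by auto
  finally show ?thesis .
qed

lemma reflect_root_in: "i < 6 \<Longrightarrow> x \<in> \<Phi> \<Longrightarrow> reflect (a i) x \<in> \<Phi>"
  using rs ss unfolding root_system_def simple_system_def simples_S by blast

lemma vec_pos_in: "ms \<in> set pos \<Longrightarrow> vec ms \<in> \<Phi>"
proof (induction "nat (sum_list ms)" arbitrary: ms rule: less_induct)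
  case less
  have len: "length ms = 6" using less.prems pos_subset_apr apr_length6 by blast
  consider i where "i < 6" "ms = unit_coords i"
    | i where "i < 6" "refl_coords i ms \<in> set pos" "sum_list (refl_coords i ms) < sum_list ms"
    using pos_descend[OF less.prems] by blast
  then show ?case
  proof cases
    case 1
    then show ?thesis using ss by (auto simp: vec_unit simple_system_def simples_S)
  next
    case 2
    have "length (refl_coords i ms) = 6" using len by simp
    then have "sum_list (refl_coords i ms) \<ge> 0"
      using pos_nonneg[OF 2(2)] by (auto intro!: sum_list_nonneg simp: in_set_conv_nth simp del: refl_coords.simps)
    then have "vec (refl_coords i ms) \<in> \<Phi>" using less.hyps[OF _ 2(2)] 2(3) by linarith
    then have "reflect (a i) (vec ms) \<in> \<Phi>" using reflect_vec[OF 2(1) len] by simp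
    then have "reflect (a i) (reflect (a i) (vec ms)) \<in> \<Phi>" by (rule reflect_root_in[OF 2(1)])
    then show ?thesis by (simp add: reflect_reflect)
  qed
qed

text \<open>A positive root of least height outside the list is reflected in a simple root with
  which it has positive product. If the image is positive, it is lower, hence listed, and
  \<open>pos_closed\<close> lists the original; otherwise the original is simple. Heights are real
  numbers here, and a least one exists because there are finitely many roots.\<close>

lemma positive_root_in_pos:
  assumes "\<beta> \<in> positive_roots \<Phi> (simples S)"
  shows "\<beta> \<in> vec ` set pos"
proof (rule ccontr)
  define P where "P = positive_roots \<Phi> (simples S)"
  define ht where "ht \<beta> = (\<Sum>k<6. representation (simples S) \<beta> (a k))" for \<beta>
  assume "\<beta> \<notin> vec ` set pos"
  then have "P - vec ` set pos \<noteq> {}" using assms P_def by blast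
  moreover have "finite (P - vec ` set pos)"
    using rs unfolding P_def positive_roots_def root_system_def by auto
  ultimately obtain \<gamma> where \<gamma>: "\<gamma> \<in> P" "\<gamma> \<notin> vec ` set pos"
    and least: "\<And>\<delta>. \<delta> \<in> P \<Longrightarrow> \<delta> \<notin> vec ` set pos \<Longrightarrow> ht \<gamma> \<le> ht \<delta>"
    using ex_min_if_finite[of "ht ` (P - vec ` set pos)"]
    by (metis (no_types, lifting) DiffD1 DiffD2 DiffI arg_min_least arg_min_if_finite(1))
  obtain m where m: "\<gamma> = lin m" using ex_lin by blast
  have rep: "representation (simples S) (lin m) (a k) = m k" if "k < 6" for k m
    using representation_lin[OF that] by (simp add: simples_S)
  have m0: "m k \<ge> 0" if "k < 6" for k
  proof -
    have "\<forall>x\<in>simples S. representation (simples S) (lin m) x \<ge> 0"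
      using \<gamma>(1) unfolding P_def positive_roots_def m by blast
    moreover have "a k \<in> simples S" using that by (simp add: simples_S)
    ultimately show ?thesis using rep[OF that, of m] by metis
  qed
  have \<gamma>\<Phi>: "\<gamma> \<in> \<Phi>" using \<gamma>(1) unfolding P_def positive_roots_def by blast
  \<comment> \<open>Otherwise the squared length of \<gamma>, expanded with its nonnegative
    coordinates, would be at most 0.\<close>
  have "\<exists>i<6. \<gamma> \<bullet> a i > 0"
  proof (rule ccontr)
    assume "\<not> (\<exists>i<6. \<gamma> \<bullet> a i > 0)"
    then have n: "m i * (\<gamma> \<bullet> a i) \<le> 0" if "i < 6" for i
      using m0[OF that] that by (meson mult_nonneg_nonpos not_less)
    have "\<gamma> \<bullet> \<gamma> = (\<Sum>k<6. m k * (\<gamma> \<bullet> a k))"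
      by (subst (2) m) (simp add: lin_def inner_sum_right)
    also have "\<dots> \<le> 0" using n by (intro sum_nonpos) auto
    finally have "\<gamma> = 0" by (meson inner_gt_zero_iff not_less)
    then show False using \<gamma>\<Phi> rs by (simp add: root_system_def)
  qed
  then obtain i where i: "i < 6" "\<gamma> \<bullet> a i > 0" by blast
  define t where "t = 2 * (\<gamma> \<bullet> a i) / N"
  have t: "t > 0" using i N_pos by (simp add: t_def)
  define m' where "m' k = m k - (if k = i then t else 0)" for k
  have "reflect (a i) \<gamma> = \<gamma> - t *\<^sub>R a i" using i by (simp add: reflect_root t_def)
  then have \<gamma>': "reflect (a i) \<gamma> = lin m'"
    by (simp add: m m'_def[abs_def] lin_diff flip: lin_delta[OF i(1)])
  have \<gamma>'\<Phi>: "lin m' \<in> \<Phi>" using reflect_root_in[OF i(1) \<gamma>\<Phi>] \<gamma>' by simp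
  then consider "\<forall>k<6. m' k \<ge> 0" | "\<forall>k<6. m' k \<le> 0"
    using ss rep unfolding simple_system_def simples_S by fastforce
  then show False
  proof cases
    case 1
    then have P': "lin m' \<in> P"
      using \<gamma>'\<Phi> rep unfolding P_def positive_roots_def simples_S by auto
    have h: "ht (lin m) = (\<Sum>k<6. m k)" for m by (simp add: ht_def rep)
    have "ht (lin m') < ht \<gamma>"
      using i t by (simp add: h m m'_def sum_subtractf)
    then have "lin m' \<in> vec ` set pos" using least P' by force
    then obtain ns where ns: "ns \<in> set pos" "lin m' = vec ns" by blast
    then have len: "length ns = 6" using pos_subset_apr apr_length6 by blast
    have \<gamma>ns: "\<gamma> = reflect (a i) (vec ns)" using \<gamma>' ns reflect_reflect by metis
    show False
    proof (cases "ns = unit_coords i")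
      case True
      then have "\<gamma> = (-1) *\<^sub>R a i" using \<gamma>ns vec_unit[OF i(1)] reflect_self[OF root_nonzero[OF i(1)]] by simp
      also have "\<dots> = lin (\<lambda>k. if k = i then -1 else 0)" using lin_delta[OF i(1), of "-1"] by simp
      finally have "m i = -1" using i(1) by (simp add: m lin_eq_iff)
      then show False using m0[OF i(1)] by simp
    next
      case False
      then have "refl_coords i ns \<in> set pos" using pos_closed ns(1) i(1) by blast
      moreover have "\<gamma> = vec (refl_coords i ns)" using \<gamma>ns reflect_vec[OF i(1) len] by simp
      ultimately show False using \<gamma>(2) by blast
    qed
  next
    case 2
    \<comment> \<open>The reflection changes coordinate i only, so every other coordinate is both
      nonnegative and nonpositive, and \<gamma> is a multiple of \<open>a i\<close>.\<close>
    have "m k = (if k = i then m i else 0)" if "k < 6" for k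
      using 2 m0[OF that] that by (cases "k = i") (force simp: m'_def)+
    then have "lin m = lin (\<lambda>k. if k = i then m i else 0)" unfolding lin_eq_iff by blast
    then have "\<gamma> = m i *\<^sub>R a i" using m lin_delta[OF i(1), of "m i"] by simp
    then have "\<gamma> \<in> \<Phi> \<inter> span {a i}" using \<gamma>\<Phi> by (simp add: span_base span_mul)
    moreover have "a i \<in> \<Phi>" using ss i(1) unfolding simple_system_def simples_S by blast
    ultimately have "\<gamma> = a i \<or> \<gamma> = - a i" using rs unfolding root_system_def by blast
    moreover have "\<gamma> \<noteq> - a i" using i root_nonzero[OF i(1)] by (metis inner_gt_zero_iff inner_minus_left less_asym neg_less_0_iff_less)
    ultimately have "\<gamma> = vec (unit_coords i)" using vec_unit[OF i(1)] by simp
    then show False using \<gamma>(2) unit_in_pos[OF i(1)] by blast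
  qed
qed

lemma vec_apr_neg: "i < 6 \<Longrightarrow> vec (apr ! i) = - a i"
  using vec_unit[of i] vec_uminus[of "unit_coords i"] apr_neg[of i] by (simp add: unit_coords_def)

lemma almost_positive_roots_eq: "almost_positive_roots \<Phi> (simples S) = (\<lambda>i. vec (apr ! i)) ` {..<42}"
proof -
  have len: "ms \<in> set pos \<Longrightarrow> length ms = 6" for ms using pos_subset_apr apr_length6 by blast
  have "positive_roots \<Phi> (simples S) = vec ` set pos"
  proof
    show "positive_roots \<Phi> (simples S) \<subseteq> vec ` set pos" using positive_root_in_pos by blast
    have "representation (simples S) (vec ms) (a k) \<ge> 0" if "ms \<in> set pos" "k < 6" for ms k
      unfolding simples_S vec_def using representation_lin[OF that(2)] pos_nonneg[OF that] by simp
    then show "vec ` set pos \<subseteq> positive_roots \<Phi> (simples S)"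
      using vec_pos_in unfolding positive_roots_def by (auto simp: simples_S)
  qed
  moreover have "uminus ` simples S = vec ` set (take 6 apr)"
  proof -
    have "uminus ` simples S = (\<lambda>i. vec (apr ! i)) ` {..<6}"
      unfolding simples_S image_image by (intro image_cong) (auto simp: vec_apr_neg)
    also have "\<dots> = vec ` set (take 6 apr)"
      using nth_image[of 6 apr] by (simp add: length_apr lessThan_atLeast0 image_image[symmetric])
    finally show ?thesis .
  qed
  moreover have "set (take 6 apr) \<union> set pos = set apr"
    unfolding pos_def by (metis append_take_drop_id set_append)
  moreover have "set apr = nth apr ` {..<42}"
    using nth_image[of 42 apr] by (simp add: length_apr lessThan_atLeast0)
  ultimately have "almost_positive_roots \<Phi> (simples S) = vec ` nth apr ` {..<42}"
    unfolding almost_positive_roots_def by (metis (no_types) Un_commute image_Un)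
  then show ?thesis by (simp only: image_image)
qed

lemma length_apr_nth: "i < 42 \<Longrightarrow> length (apr ! i) = 6"
  using apr_length6 length_apr by simp

lemma vec_apr_inj: "i < 42 \<Longrightarrow> j < 42 \<Longrightarrow> vec (apr ! i) = vec (apr ! j) \<longleftrightarrow> i = j"
  using vec_eq_iff length_apr_nth distinct_apr nth_eq_iff_index_eq length_apr by metis

lemma c_half_sg:
  "c_half S (sg b) x = fold (\<lambda>i. reflect (a i)) (cls b) x"
proof -
  have o: "a i \<bullet> a j = 0" if "i \<in> set (cls b)" "j \<in> set (cls b)" "i \<noteq> j" for i j
    using that gram[of i j] by (auto simp: cls_def cartan_def split: if_splits)
  have d: "a i \<noteq> a j" if "i \<in> set (cls b)" "j \<in> set (cls b)" "i \<noteq> j" for i j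
  proof -
    have "i < 6 \<and> j < 6" using that(1,2) by (auto simp: cls_def split: if_splits)
    then show ?thesis using inj_onD[OF inj_a, of i j] that(3) by auto
  qed
  show ?thesis
  proof (cases b)
    case True
    \<comment> \<open>\<open>fold\<close> on a list applies the head first, so the triple is
      composed in reverse order.\<close>
    then have "c_half S (sg b) = reflect (a 5) \<circ> (reflect (a 3) \<circ> reflect (a 0))"
      using S_sg[of b] o d by (intro c_half_triple) (auto simp: cls_def)
    then show ?thesis using True by (simp add: cls_def)
  next
    case False
    then have "c_half S (sg b) = reflect (a 4) \<circ> (reflect (a 2) \<circ> reflect (a 1))"
      using S_sg[of b] o d by (intro c_half_triple) (auto simp: cls_def)
    then show ?thesis using False by (simp add: cls_def)
  qed
qed

lemma linear_c_half: "linear (c_half S (sg b))"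
proof -
  have "linear (fold (\<lambda>i. reflect (a i)) is)" for "is"
  proof (induction "is")
    case (Cons x xs)
    then show ?case using linear_compose[OF linear_reflect[of "a x"] Cons] by (simp add: o_def)
  qed (simp add: linear_ident)
  moreover have "c_half S (sg b) = fold (\<lambda>i. reflect (a i)) (cls b)" using c_half_sg by blast
  ultimately show ?thesis by simp
qed

lemma fold_reflect_vec:
  "set is \<subseteq> {..<6} \<Longrightarrow> length ms = 6 \<Longrightarrow>
    fold (\<lambda>i. reflect (a i)) is (vec ms) = vec (apply_word is ms)"
proof (induction "is" ms rule: apply_word.induct)
  case (2 i "is" ms)
  then have "ms \<noteq> []" by auto
  then show ?case using 2 by (simp add: reflect_vec del: refl_coords.simps)
qed simp

lemma c_half_vec: "length ms = 6 \<Longrightarrow> c_half S (sg b) (vec ms) = vec (half b ms)"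
  using fold_reflect_vec[of "cls b" ms] by (simp add: c_half_sg half_def cls_def)

lemma tau_vec:
  assumes "length ms = 6"
  shows "tau S (sg b) (vec ms) = vec (tau_coords b ms)"
proof -
  have "vec ms \<in> uminus ` S (opp (sg b)) \<longleftrightarrow> (\<exists>i\<in>set (cls (\<not> b)). vec ms = vec (map uminus (unit_coords i)))"
    unfolding opp_sg S_sg image_image
    using vec_unit vec_uminus[of "unit_coords _"] by (auto simp: cls_def unit_coords_def split: if_splits)
  also have "\<dots> \<longleftrightarrow> ms \<in> set (map (\<lambda>i. map uminus (unit_coords i)) (cls (\<not> b)))"
    using assms vec_eq_iff[of ms "map uminus (unit_coords _)"] by (auto simp: unit_coords_def)
  finally show ?thesis
    using c_half_vec[OF assms] by (simp add: tau_def tau_coords_def)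
qed

lemma tau_apr: "i < 42 \<Longrightarrow> tau S (sg b) (vec (apr ! i)) = vec (apr ! (tau_table b ! i))"
  by (simp add: tau_vec length_apr_nth tau_coords_apr)

text \<open>Evaluates the definite description: the relation R0 read off from the table satisfies
  it, and every relation that does so is R0.\<close>

theorem compatible_iff:
  assumes "i < 42" "j < 42"
  shows "(vec (apr ! i), vec (apr ! j)) \<in> compatible \<Phi> S \<longleftrightarrow> j \<in> set (compat_table ! i)"
proof -
  define A where "A = almost_positive_roots \<Phi> (simples S)"
  define v where "v i = vec (apr ! i)" for i
  have A: "A = v ` {..<42}" by (simp add: A_def v_def almost_positive_roots_eq)
  define Q where "Q R \<longleftrightarrow> R \<subseteq> A \<times> A \<and>
        (\<forall>\<epsilon>. \<forall>b\<in>A. \<forall>b'\<in>A. (tau S \<epsilon> b, tau S \<epsilon> b') \<in> R \<longleftrightarrow> (b, b') \<in> R) \<and>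
        (\<forall>a\<in>simples S. \<forall>b\<in>A. (b, - a) \<in> R \<longleftrightarrow> representation (simples S) b a = 0)" for R
  define R0 where "R0 = {(v i, v j) | i j. i < 42 \<and> j < 42 \<and> j \<in> set (compat_table ! i)}"
  have vinj: "v i = v j \<longleftrightarrow> i = j" if "i < 42" "j < 42" for i j
    using that by (simp add: v_def vec_apr_inj)
  have R0: "(v i, v j) \<in> R0 \<longleftrightarrow> j \<in> set (compat_table ! i)" if "i < 42" "j < 42" for i j
    unfolding R0_def using that vinj by auto
  have tv: "tau S (sg b) (v i) = v (tau_table b ! i)" if "i < 42" for b i
    using that by (simp add: v_def tau_apr)
  have rep: "representation (simples S) (v i) (a k) = real_of_int (apr ! i ! k)" if "k < 6" for i k
    unfolding simples_S v_def vec_def using representation_lin[OF that] by simp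
  have vneg: "- a k = v k" if "k < 6" for k using vec_apr_neg[OF that] by (simp add: v_def)
  have "Q R0"
    unfolding Q_def
  proof (intro conjI allI ballI)
    show "R0 \<subseteq> A \<times> A" by (auto simp: R0_def A)
    fix \<epsilon> b b' assume "b \<in> A" "b' \<in> A"
    then obtain i j where ij: "i < 42" "j < 42" "b = v i" "b' = v j" by (auto simp: A)
    obtain e where "\<epsilon> = sg e" using ex_sg by blast
    then show "(tau S \<epsilon> b, tau S \<epsilon> b') \<in> R0 \<longleftrightarrow> (b, b') \<in> R0"
      using ij by (simp add: tv R0 tau_table_bound compat_table_tau)
  next
    fix x b assume "x \<in> simples S" "b \<in> A"
    then obtain k i where "k < 6" "x = a k" "i < 42" "b = v i" by (auto simp: A simples_S)
    then show "(b, - x) \<in> R0 \<longleftrightarrow> representation (simples S) b x = 0"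
      by (simp add: vneg R0 rep compat_table_neg)
  qed
  moreover have "R = R0" if "Q R" for R
  proof -
    \<comment> \<open>Induction on the second argument. The step moves the involution over to the
      first argument, so the claim has to be made for all i at once.\<close>
    have "\<forall>i<42. (v i, v j) \<in> R \<longleftrightarrow> (v i, v j) \<in> R0" if "j < 42" for j
      using that
    proof (induction j rule: apr_index_induct)
      case (neg k)
      have "a k \<in> simples S" using neg by (simp add: simples_S)
      then show ?case using \<open>Q R\<close> \<open>Q R0\<close> unfolding Q_def vneg[OF neg, symmetric] by (simp add: A)
    next
      case (tau b j)
      show ?case
      proof (intro allI impI)
        fix i :: nat assume i: "i < 42"
        have t: "tau S (sg b) (v (tau_table b ! i)) = v i" "tau_table b ! i < 42"
          using i tv[of "tau_table b ! i" b] by (simp_all add: tau_table_bound tau_table_involution)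
        have "(v i, v (tau_table b ! j)) \<in> R \<longleftrightarrow> (v (tau_table b ! i), v j) \<in> R"
          if "Q R" for R
        proof -
          have "v (tau_table b ! i) \<in> A" "v j \<in> A" using tau t by (auto simp: A)
          then have "(tau S (sg b) (v (tau_table b ! i)), tau S (sg b) (v j)) \<in> R \<longleftrightarrow> (v (tau_table b ! i), v j) \<in> R"
            using that unfolding Q_def by blast
          then show ?thesis using t tau tv by simp
        qed
        then show "(v i, v (tau_table b ! j)) \<in> R \<longleftrightarrow> (v i, v (tau_table b ! j)) \<in> R0"
          using tau t \<open>Q R\<close> \<open>Q R0\<close> by simp
      qed
    qed
    then show ?thesis using \<open>Q R\<close> \<open>Q R0\<close> unfolding Q_def A by (auto 4 4)
  qed
  ultimately have "(THE R. Q R) = R0" by (intro the_equality)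
  then have "compatible \<Phi> S = R0"
    unfolding compatible_def Let_def A_def[symmetric] Q_def by simp
  then show ?thesis using R0 assms by (simp add: v_def)
qed

end

section \<open>The Coxeter number and the smallest orbit\<close>

definition W27 :: "int list list" where
  "W27 = [
    [4,3,5,6,4,2], [1,3,5,6,4,2], [1,3,2,6,4,2], [1,3,2,3,4,2], [1,0,2,3,4,2],
    [1,3,2,3,1,2], [1,0,2,3,1,2], [1,3,2,3,1,-1], [1,0,2,0,1,2], [1,0,2,3,1,-1],
    [1,0,-1,0,1,2], [1,0,2,0,1,-1], [-2,0,-1,0,1,2], [1,0,-1,0,1,-1], [1,0,2,0,-2,-1],
    [-2,0,-1,0,1,-1], [1,0,-1,0,-2,-1], [-2,0,-1,0,-2,-1], [1,0,-1,-3,-2,-1], [-2,0,-1,-3,-2,-1],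
    [1,-3,-1,-3,-2,-1], [-2,-3,-1,-3,-2,-1], [-2,0,-4,-3,-2,-1], [-2,-3,-4,-3,-2,-1], [-2,-3,-4,-6,-2,-1],
    [-2,-3,-4,-6,-5,-1], [-2,-3,-4,-6,-5,-4]]"

text \<open>Words in the simple reflections, applied from left to right, that carry one vector to 28
  different vectors, one more than the size to be beaten. There is one list for each fundamental
  weight that is not minuscule, and \<open>words_k05\<close> for the sum of the two minuscule
  ones.\<close>

definition words_k1 :: "nat list list" where
  "words_k1 = [[], [1], [1,3], [1,3,2], [1,3,4], [1,3,2,0], [1,3,2,4], [1,3,4,5], [1,3,2,0,4], [1,3,2,4,3], [1,3,2,4,5], [1,3,2,0,4,3], [1,3,2,0,4,5], [1,3,2,4,3,1], [1,3,2,4,3,5], [1,3,2,0,4,3,1], [1,3,2,0,4,3,2], [1,3,2,0,4,3,5], [1,3,2,4,3,1,5], [1,3,2,4,3,5,4], [1,3,2,0,4,3,1,2], [1,3,2,0,4,3,1,5], [1,3,2,0,4,3,2,5], [1,3,2,0,4,3,5,4], [1,3,2,4,3,1,5,4], [1,3,2,0,4,3,1,2,3], [1,3,2,0,4,3,1,2,5], [1,3,2,0,4,3,1,5,4]]"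

definition words_k2 :: "nat list list" where
  "words_k2 = [[], [2], [2,0], [2,3], [2,0,3], [2,3,1], [2,3,4], [2,0,3,1], [2,0,3,2], [2,0,3,4], [2,3,1,4], [2,3,4,5], [2,0,3,1,2], [2,0,3,1,4], [2,0,3,2,4], [2,0,3,4,5], [2,3,1,4,3], [2,3,1,4,5], [2,0,3,1,2,3], [2,0,3,1,2,4], [2,0,3,1,4,3], [2,0,3,1,4,5], [2,0,3,2,4,3], [2,0,3,2,4,5], [2,3,1,4,3,2], [2,3,1,4,3,5], [2,0,3,1,2,3,4], [2,0,3,1,2,4,3]]"

definition words_k3 :: "nat list list" where
  "words_k3 = [[], [3], [3,1], [3,2], [3,4], [3,1,2], [3,1,4], [3,2,0], [3,2,4], [3,4,5], [3,1,2,0], [3,1,2,3], [3,1,2,4], [3,1,4,3], [3,1,4,5], [3,2,0,4], [3,2,4,3], [3,2,4,5], [3,1,2,0,3], [3,1,2,0,4], [3,1,2,3,4], [3,1,2,4,3], [3,1,2,4,5], [3,1,4,3,2], [3,1,4,3,5], [3,2,0,4,3], [3,2,0,4,5], [3,2,4,3,1]]"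

definition words_k4 :: "nat list list" where
  "words_k4 = [[], [4], [4,3], [4,5], [4,3,1], [4,3,2], [4,3,5], [4,3,1,2], [4,3,1,5], [4,3,2,0], [4,3,2,5], [4,3,5,4], [4,3,1,2,0], [4,3,1,2,3], [4,3,1,2,5], [4,3,1,5,4], [4,3,2,0,5], [4,3,2,5,4], [4,3,1,2,0,3], [4,3,1,2,0,5], [4,3,1,2,3,4], [4,3,1,2,3,5], [4,3,1,2,5,4], [4,3,1,5,4,3], [4,3,2,0,5,4], [4,3,2,5,4,3], [4,3,1,2,0,3,2], [4,3,1,2,0,3,4]]"

definition words_k05 :: "nat list list" where
  "words_k05 = [[], [0], [5], [0,2], [0,5], [5,4], [0,2,3], [0,2,5], [0,5,4], [5,4,3], [0,2,3,1], [0,2,3,4], [0,2,3,5], [0,2,5,4], [0,5,4,3], [5,4,3,1], [5,4,3,2], [0,2,3,1,4], [0,2,3,1,5], [0,2,3,4,5], [0,2,3,5,4], [0,2,5,4,3], [0,5,4,3,1], [0,5,4,3,2], [5,4,3,1,2], [5,4,3,2,0], [0,2,3,1,4,3], [0,2,3,1,4,5]]"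

text \<open>Coordinates with respect to the simple roots, multiplied by \<open>3\<close>, of the weights of the
  27-dimensional representation; the other one is obtained by the diagram automorphism.\<close>

definition flip_coords :: "int list \<Rightarrow> int list" where
  "flip_coords ms = [ms ! 5, ms ! 1, ms ! 4, ms ! 3, ms ! 2, ms ! 0]"

definition reflection_closed :: "int list list \<Rightarrow> bool" where
  "reflection_closed F \<longleftrightarrow> list_all (\<lambda>m. length m = 6 \<and>
     (if m = [] then False else list_all (\<lambda>i. refl_coords i m \<in> set F) [0,1,2,3,4,5])) F"

text \<open>For k in K and l in F outside K, the difference k - l is a nonnegative combination of
  simple roots with positive coefficient at j. So a dominant vector with positive product with root
  j pairs strictly more with k than with l.\<close>

definition separates :: "nat \<Rightarrow> int list list \<Rightarrow> int list list \<Rightarrow> bool" where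
  "separates j F K \<longleftrightarrow> list_all (\<lambda>k. k \<in> set F) K \<and> list_all (\<lambda>k. list_all (\<lambda>l. l \<in> set K \<or>
     list_all (\<lambda>i. k ! i \<ge> l ! i) [0,1,2,3,4,5] \<and> k ! j > l ! j) F) K"

definition roots72 :: "int list list" where
  "roots72 = pos @ map (map uminus) pos"

lemma closed_lists: "reflection_closed W27" "reflection_closed (map flip_coords W27)" "reflection_closed roots72"
  by code_simp+

text \<open>K is chosen so that its sum is a positive multiple of the fundamental weight of index j:
  the highest root for j = 1, otherwise the top one, two or three weights of \<open>W27\<close> or
  of its mirror image.\<close>

lemma separations:
  "separates 1 roots72 [[1,2,2,3,2,1]]"
  "separates 2 W27 [[4,3,5,6,4,2],[1,3,5,6,4,2]]"
  "separates 3 W27 [[4,3,5,6,4,2],[1,3,5,6,4,2],[1,3,2,6,4,2]]"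
  "separates 4 (map flip_coords W27) [[2,3,4,6,5,4],[2,3,4,6,5,1]]"
  "separates 0 W27 [[4,3,5,6,4,2]]"
  "separates 5 (map flip_coords W27) [[2,3,4,6,5,4]]"
  by code_simp+

definition good_words :: "int list \<Rightarrow> nat list list \<Rightarrow> bool" where
  "good_words m ws \<longleftrightarrow> length ws = 28 \<and> list_all (list_all (\<lambda>i. i < 6)) ws \<and>
     distinct (map (\<lambda>w. apply_word w m) ws)"

lemma words_good:
  "good_words [1,2,2,3,2,1] words_k1" "good_words [5,6,10,12,8,4] words_k2"
  "good_words [6,9,12,18,12,6] words_k3" "good_words [4,6,8,12,10,5] words_k4"
  "good_words [6,6,9,12,9,6] words_k05"
  by (simp_all add: good_words_def words_k1_def words_k2_def words_k3_def words_k4_def words_k05_def cartan_def)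

text \<open>Evaluated downwards: some simple reflection takes entry j to an earlier entry, and being
  an involution it leads back.\<close>

lemma W27_reachable: "j < 27 \<Longrightarrow> j \<noteq> 0 \<Longrightarrow> \<exists>i<6. \<exists>k<j. W27 ! j = refl_coords i (W27 ! k)"
proof -
  have *: "list_all (\<lambda>j. if j = 0 then False else
      list_ex (\<lambda>i. refl_coords i (W27 ! j) \<in> set (take j W27)) [0,1,2,3,4,5]) [1..<27]"
    by code_simp
  have inv: "list_all (\<lambda>m. if m = [] then False else
      list_all (\<lambda>i. refl_coords i (refl_coords i m) = m) [0,1,2,3,4,5]) W27"
    by code_simp
  have l: "length W27 = 27" by (simp add: W27_def)
  assume j: "j < 27" "j \<noteq> 0"
  then have "j \<in> set [1..<27]" by simp
  then have "list_ex (\<lambda>i. refl_coords i (W27 ! j) \<in> set (take j W27)) [0,1,2,3,4,5]"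
    using * j(2) unfolding list_all_iff by (metis (no_types, lifting))
  then obtain i where i: "i \<in> set [0,1,2,3,4,5]" "refl_coords i (W27 ! j) \<in> set (take j W27)"
    unfolding list_ex_iff by blast
  then obtain k where k: "k < j" "refl_coords i (W27 ! j) = W27 ! k"
    unfolding in_set_conv_nth by (auto simp del: refl_coords.simps)
  have "W27 ! j \<in> set W27" using j l by simp
  then have "list_all (\<lambda>i. refl_coords i (refl_coords i (W27 ! j)) = W27 ! j) [0,1,2,3,4,5]"
    using inv unfolding list_all_iff by (metis (no_types, lifting))
  then have "refl_coords i (W27 ! k) = W27 ! j"
    using i(1) k(2) unfolding list_all_iff by (metis (no_types, lifting))
  moreover have "i < 6" using i(1) by auto
  ultimately show ?thesis using k(1) by metis
qed

text \<open>A Coxeter element. Both orders of the factors are needed, because the sign of each half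
  is open.\<close>

definition step :: "bool \<Rightarrow> int list \<Rightarrow> int list" where
  "step b ms = half b (half (\<not> b) ms)"

fun apply_halves :: "bool list \<Rightarrow> int list \<Rightarrow> int list" where
  "apply_halves [] ms = ms"
| "apply_halves (b # bs) ms = (if ms = [] then [] else apply_halves bs (half b ms))"

lemma half_eq_Nil_iff [simp]: "half b ms = [] \<longleftrightarrow> ms = []"
  using length_half[of b ms] by (metis length_0_conv)

lemma apply_halves_funpow: "ms \<noteq> [] \<Longrightarrow> apply_halves (concat (replicate n [\<not> b, b])) ms = (step b ^^ n) ms"
  by (induction n arbitrary: ms) (simp_all add: step_def funpow_swap1)

lemma unit_coords_nonempty: "unit_coords i \<noteq> []"
  by (simp add: unit_coords_def)

lemma list_all_bool: "list_all P [True, False] \<Longrightarrow> P b"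
  by (cases b) simp_all

lemma step_order:
  "i < 6 \<Longrightarrow> (step b ^^ 12) (unit_coords i) = unit_coords i"
  "0 < n \<Longrightarrow> n < 12 \<Longrightarrow> (step b ^^ n) (unit_coords 0) \<noteq> unit_coords 0"
proof -
  have "list_all (\<lambda>b. list_all (\<lambda>u. apply_halves (concat (replicate 12 [\<not> b, b])) u = u)
      (map unit_coords [0,1,2,3,4,5])) [True,False]"
    by code_simp
  then have "list_all (\<lambda>b. list_all (\<lambda>i. apply_halves (concat (replicate 12 [\<not> b, b])) (unit_coords i) = unit_coords i)
      [0,1,2,3,4,5]) [True,False]"
    by (simp only: list.pred_inject list.map)
  then have "list_all (\<lambda>i. (step b ^^ 12) (unit_coords i) = unit_coords i) [0,1,2,3,4,5]"
    unfolding apply_halves_funpow[OF unit_coords_nonempty] by (rule list_all_bool)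
  then show "i < 6 \<Longrightarrow> (step b ^^ 12) (unit_coords i) = unit_coords i" by (rule list_all6)
  have "list_all (\<lambda>b. list_all (\<lambda>n. apply_halves (concat (replicate n [\<not> b, b])) (unit_coords 0) \<noteq> unit_coords 0)
      [1,2,3,4,5,6,7,8,9,10,11]) [True,False]"
    by code_simp
  then have *: "list_all (\<lambda>n. (step b ^^ n) (unit_coords 0) \<noteq> unit_coords 0) [1,2,3,4,5,6,7,8,9,10,11]"
    unfolding apply_halves_funpow[OF unit_coords_nonempty] by (rule list_all_bool)
  assume "0 < n" "n < 12"
  then have "n = 1 \<or> n = 2 \<or> n = 3 \<or> n = 4 \<or> n = 5 \<or> n = 6 \<or> n = 7 \<or> n = 8 \<or> n = 9 \<or> n = 10 \<or> n = 11"
    by arith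
  then have "n \<in> set [1,2,3,4,5,6,7,8,9,10,11]" by simp
  then show "(step b ^^ n) (unit_coords 0) \<noteq> unit_coords 0"
    using * unfolding list_all_iff by blast
qed

section \<open>The generated group and its orbits\<close>

lemma refl_group_comp: "w \<in> refl_group B \<Longrightarrow> w' \<in> refl_group B \<Longrightarrow> w \<circ> w' \<in> refl_group B"
  by (induction rule: refl_group.induct) (auto simp: comp_assoc intro: refl_group.intros)

lemma refl_group_linear: "w \<in> refl_group B \<Longrightarrow> linear w"
proof (induction rule: refl_group.induct)
  case one
  show ?case by (rule linear_id)
next
  case (step a w)
  show ?case by (rule linear_compose[OF step.IH linear_reflect])
qed

lemma refl_group_isometry: "w \<in> refl_group B \<Longrightarrow> w x \<bullet> w y = x \<bullet> y"
  by (induction rule: refl_group.induct) (simp_all add: reflect_isometry)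

lemma orbit_refl: "x \<in> orbit B x"
  unfolding orbit_def using refl_group.one by (metis id_apply image_eqI)

lemma orbit_reflect: "b \<in> B \<Longrightarrow> y \<in> orbit B x \<Longrightarrow> reflect b y \<in> orbit B x"
  unfolding orbit_def by (auto intro!: image_eqI[of _ _ "reflect b \<circ> _"] refl_group.step)

lemma orbit_trans:
  assumes "y \<in> orbit B x" "z \<in> orbit B y"
  shows "z \<in> orbit B x"
proof -
  obtain w w' where "w \<in> refl_group B" "y = w x" "w' \<in> refl_group B" "z = w' y"
    using assms by (auto simp: orbit_def)
  then show ?thesis
    unfolding orbit_def by (intro image_eqI[of _ _ "w' \<circ> w"]) (auto intro: refl_group_comp)
qed

lemma orbit_induct [consumes 1, case_names base step]:
  assumes "y \<in> orbit B x" "P x" "\<And>b y. b \<in> B \<Longrightarrow> y \<in> orbit B x \<Longrightarrow> P y \<Longrightarrow> P (reflect b y)"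
  shows "P y"
proof -
  have "P (w x)" if "w \<in> refl_group B" for w
    using that by induction (auto simp: assms(2) orbit_def intro!: assms(3))
  then show ?thesis using assms(1) by (auto simp: orbit_def)
qed

lemma orbit_sym: "y \<in> orbit B x \<Longrightarrow> x \<in> orbit B y"
proof (induction rule: orbit_induct)
  case (step b y)
  have "y \<in> orbit B (reflect b y)"
    using orbit_reflect[OF step(1) orbit_refl] reflect_reflect by metis
  then show ?case using step orbit_trans by blast
qed (rule orbit_refl)

lemma orbit_eq: "y \<in> orbit B x \<Longrightarrow> orbit B y = orbit B x"
  using orbit_trans orbit_sym by blast

lemma refl_group_word: "list_all (\<lambda>i. i < n) w \<Longrightarrow> fold (\<lambda>i. reflect (f i)) w \<in> refl_group (f ` {..<n})"
proof (induction w)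
  case Nil
  show ?case unfolding fold_Nil by (rule refl_group.one)
next
  case (Cons i w)
  have r: "reflect (f i) \<circ> id \<in> refl_group (f ` {..<n})"
    using Cons.prems by (intro refl_group.step refl_group.one) auto
  have "fold (\<lambda>i. reflect (f i)) w \<in> refl_group (f ` {..<n})" using Cons by simp
  from refl_group_comp[OF this r[unfolded comp_id]] show ?case unfolding fold_Cons .
qed

text \<open>A finite invariant set \<open>F\<close> and \<open>K \<subseteq> F\<close> such that \<open>v\<close> pairs more with \<open>K\<close> than with the
  rest of \<open>F\<close>: then \<open>w v\<close> determines \<open>w K\<close>, which bounds the orbit of \<open>v\<close> from below.\<close>

lemma separated_image_eq:
  fixes v :: "'a::euclidean_space"
  assumes F: "finite F" "\<And>w. w \<in> refl_group B \<Longrightarrow> w ` F = F" and K: "K \<subseteq> F"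
    and sep: "\<And>k l. k \<in> K \<Longrightarrow> l \<in> F - K \<Longrightarrow> v \<bullet> k > v \<bullet> l"
    and w: "w \<in> refl_group B" "w' \<in> refl_group B" "w v = w' v"
  shows "w ` K = w' ` K"
proof (rule ccontr)
  have inj: "inj_on u F" if "u \<in> refl_group B" for u
    using F that by (intro eq_card_imp_inj_on) simp_all
  have card: "card (u ` K) = card K" if "u \<in> refl_group B" for u
    using inj[OF that] K by (intro card_image) (rule inj_on_subset)
  have sepu: "u v \<bullet> k > u v \<bullet> l" if h: "u \<in> refl_group B" "k \<in> u ` K" "l \<in> F" "l \<notin> u ` K" for u k l
  proof -
    obtain k' where k': "k' \<in> K" "k = u k'" using h by blast
    obtain l' where "l' \<in> F" "l = u l'" using F(2)[OF h(1)] h(3) by blast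
    then have "l' \<in> F - K" "l = u l'" using h(4) by auto
    then show ?thesis using sep k' refl_group_isometry[OF h(1)] by simp
  qed
  assume ne: "w ` K \<noteq> w' ` K"
  have fin: "finite (w ` K)" "finite (w' ` K)" using finite_subset[OF K F(1)] by simp_all
  have "\<not> w ` K \<subseteq> w' ` K" "\<not> w' ` K \<subseteq> w ` K"
    using ne card_subset_eq[OF fin(1)] card_subset_eq[OF fin(2)] card[OF w(1)] card[OF w(2)] by metis+
  \<comment> \<open>Distinct sets of equal size: each has an element missing from the other, and the
    common image of v would have to pair strictly more with k than with l and with l than with
    k.\<close>
  then obtain k l where "k \<in> w ` K" "k \<notin> w' ` K" "l \<in> w' ` K" "l \<notin> w ` K" by blast
  moreover have "k \<in> F" "l \<in> F" using calculation F(2) w K by blast+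
  ultimately show False using sepu[OF w(1), of k l] sepu[OF w(2), of l k] w(3) by simp
qed

context E6_setting
begin

lemma coxeter_number_eq: "coxeter_number S = 12"
proof -
  obtain b where b: "Minus = sg b" using ex_sg by blast
  then have "Plus = sg (\<not> b)" using opp_sg[of b] by (metis opp.simps(2))
  define f where "f = c_half S (sg b) \<circ> c_half S (sg (\<not> b))"
  have cn: "coxeter_number S = map_order f"
    unfolding coxeter_number_def f_def b[symmetric] \<open>Plus = _\<close>[symmetric] ..
  have fv: "(f ^^ n) (vec ms) = vec ((step b ^^ n) ms) \<and> length ((step b ^^ n) ms) = 6"
    if "length ms = 6" for n ms
    using that by (induction n) (simp_all add: f_def c_half_vec step_def)
  have lin: "linear (f ^^ n)" for n
  proof (induction n)
    case 0
    show ?case by (simp only: funpow.simps linear_id)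
  next
    case (Suc n)
    have "linear f" unfolding f_def by (rule linear_compose[OF linear_c_half linear_c_half])
    then show ?case using linear_compose[OF Suc] by (simp only: funpow.simps)
  qed
  have len: "length (unit_coords i) = 6" for i by (simp add: unit_coords_def)
  have "(f ^^ 12) x = id x" for x
  proof (rule linear_eq_on[of "f ^^ 12" id x "a ` {..<6}"])
    show "linear (f ^^ 12)" by (rule lin)
    show "linear (id :: 'a \<Rightarrow> 'a)" by (rule linear_id)
    show "x \<in> span (a ` {..<6})" by (simp add: span_roots)
    fix y assume "y \<in> a ` {..<6}"
    then obtain i where "i < 6" "y = vec (unit_coords i)" by (auto simp: vec_unit)
    then show "(f ^^ 12) y = id y" using fv[OF len] step_order(1) by simp
  qed
  then have "f ^^ 12 = id" by blast
  moreover have "f ^^ n \<noteq> id" if "0 < n" "n < 12" for n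
  proof
    assume "f ^^ n = id"
    then have "vec ((step b ^^ n) (unit_coords 0)) = vec (unit_coords 0)"
      using fv[OF len, of n 0] by simp
    then show False using vec_eq_iff fv[OF len] len step_order(2)[OF that] by metis
  qed
  ultimately have "(LEAST n. n > 0 \<and> f ^^ n = id) = 12"
    by (intro Least_equality) (auto simp: not_less[symmetric])
  then show ?thesis unfolding cn map_order_def using \<open>f ^^ 12 = id\<close> zero_less_numeral by metis
qed

abbreviation "G \<equiv> refl_group (simples S)"

lemma reflection_closed_image:
  assumes F: "reflection_closed F" and w: "w \<in> G"
  shows "w ` vec ` set F = vec ` set F"
proof -
  have len: "length m = 6" "i < 6 \<Longrightarrow> refl_coords i m \<in> set F" if "m \<in> set F" for m i
    using F that list_all6[of "\<lambda>i. refl_coords i m \<in> set F" i] unfolding reflection_closed_def list_all_iff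
    by (metis (no_types, lifting))+
  have "w ` vec ` set F \<subseteq> vec ` set F"
    using w
  proof induction
    case (step x w)
    then obtain i where i: "i < 6" "x = a i" by (auto simp: simples_S)
    have "reflect x ` vec ` set F \<subseteq> vec ` set F"
      using len i by (auto simp: reflect_vec simp del: refl_coords.simps)
    moreover have "(reflect x \<circ> w) ` vec ` set F = reflect x ` (w ` vec ` set F)"
      by (simp add: image_comp)
    ultimately show ?case using image_mono[OF step.IH, of "reflect x"] by auto
  qed simp
  moreover have "inj w"
    using refl_group_linear[OF w] refl_group_isometry[OF w]
    by (metis inner_eq_zero_iff linear_injective_0)
  ultimately show ?thesis
    by (intro card_subset_eq) (auto simp: card_image inj_on_subset)
qed

text \<open>A group element is determined by its restriction to the roots, which are finitely many
  and span.\<close>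

lemma finite_G: "finite G"
proof -
  have inv: "w ` \<Phi> \<subseteq> \<Phi>" if "w \<in> G" for w
    using that by induction (auto simp: simples_S reflect_root_in image_subset_iff)
  have fin: "finite \<Phi>" using rs by (simp add: root_system_def)
  have "inj_on (\<lambda>w. restrict w \<Phi>) G"
  proof (rule inj_onI)
    fix w w' assume w: "w \<in> G" "w' \<in> G" "restrict w \<Phi> = restrict w' \<Phi>"
    show "w = w'"
    proof
      fix x
      show "w x = w' x"
      proof (rule linear_eq_on[OF refl_group_linear[OF w(1)] refl_group_linear[OF w(2)]])
        show "x \<in> span (a ` {..<6})" by (simp add: span_roots)
        fix y assume "y \<in> a ` {..<6}"
        then have "y \<in> \<Phi>" using ss unfolding simple_system_def simples_S by blast
        then show "w y = w' y" using w(3) by (metis restrict_apply')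
      qed
    qed
  qed
  moreover have "(\<lambda>w. restrict w \<Phi>) ` G \<subseteq> \<Phi> \<rightarrow>\<^sub>E \<Phi>" using inv by fastforce
  ultimately show ?thesis using fin finite_PiE[of \<Phi> "\<lambda>_. \<Phi>"] by (meson finite_subset inj_on_finite)
qed

section \<open>Lower bounds for the orbits of dominant vectors\<close>

lemma word_vec:
  assumes "list_all (\<lambda>i. i < 6) is" "length ms = 6"
  shows "fold (\<lambda>i. reflect (a i)) is (vec ms) = vec (apply_word is ms)"
    "length (apply_word is ms) = 6"
  using fold_reflect_vec[of "is" ms] assms by (auto simp: list_all_iff)

text \<open>By \<open>det\<close>, sending w v to w (vec m) is well defined, so the orbit of v is at
  least as large as that of \<open>vec m\<close>, of which the words list 28 elements.\<close>

lemma orbit_large: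
  assumes ws: "good_words m ws" and m: "length m = 6"
    and det: "\<And>w w'. w \<in> G \<Longrightarrow> w' \<in> G \<Longrightarrow> w v = w' v \<Longrightarrow> w (vec m) = w' (vec m)"
  shows "card (orbit (simples S) v) > 27"
proof -
  let ?f = "\<lambda>w. fold (\<lambda>i. reflect (a i)) w"
  have wG: "?f w \<in> G" if "w \<in> set ws" for w
    using ws that refl_group_word[of 6 w a] unfolding good_words_def list_all_iff simples_S by blast
  have inj: "inj_on (\<lambda>w. ?f w v) (set ws)"
  proof (rule inj_onI)
    fix w w' assume w: "w \<in> set ws" "w' \<in> set ws" "?f w v = ?f w' v"
    then have "?f w (vec m) = ?f w' (vec m)" using det wG by blast
    then have "apply_word w m = apply_word w' m"
      using word_vec[OF _ m] vec_eq_iff ws w(1,2) unfolding good_words_def list_all_iff by metis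
    then show "w = w'" using ws w(1,2) unfolding good_words_def distinct_map inj_on_def by blast
  qed
  have "distinct ws" "length ws = 28" using ws unfolding good_words_def distinct_map by blast+
  then have "card ((\<lambda>w. ?f w v) ` set ws) = 28"
    using card_image[OF inj] distinct_card by metis
  moreover have "(\<lambda>w. ?f w v) ` set ws \<subseteq> orbit (simples S) v"
    using wG unfolding orbit_def by blast
  moreover have "finite (orbit (simples S) v)" unfolding orbit_def using finite_G by simp
  ultimately have "28 \<le> card (orbit (simples S) v)" by (metis card_mono)
  then show ?thesis by simp
qed

lemma vec_list_inner_diff:
  assumes "length k = 6" "length l = 6"
  shows "v \<bullet> vec k - v \<bullet> vec l = (\<Sum>i<6. real_of_int (k ! i - l ! i) * (v \<bullet> a i))"
  by (simp add: vec_def lin_def inner_sum_right sum_subtractf left_diff_distrib)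

text \<open>\<open>separated_image_eq\<close>, summed over K: the set is replaced by a single
  vector, to which \<open>orbit_large\<close> applies.\<close>

lemma dominant_separated:
  assumes d: "\<And>i. i < 6 \<Longrightarrow> v \<bullet> a i \<ge> 0" "j < 6" "v \<bullet> a j > 0"
    and F: "reflection_closed F" and s: "separates j F K"
    and w: "w \<in> G" "w' \<in> G" "w v = w' v"
  shows "w (\<Sum>x\<in>vec ` set K. x) = w' (\<Sum>x\<in>vec ` set K. x)"
proof -
  have len: "length m = 6" if "m \<in> set F" for m
    using F that unfolding reflection_closed_def list_all_iff by blast
  have K: "set K \<subseteq> set F" using s unfolding separates_def list_all_iff by blast
  have "w ` vec ` set K = w' ` vec ` set K"
  proof (rule separated_image_eq[of "vec ` set F" "simples S" _ v])
    fix x y assume "x \<in> vec ` set K" "y \<in> vec ` set F - vec ` set K"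
    then obtain k l where kl: "k \<in> set K" "x = vec k" "l \<in> set F" "y = vec l" "l \<notin> set K" by blast
    then have "list_all (\<lambda>i. k ! i \<ge> l ! i) [0,1,2,3,4,5]" "k ! j > l ! j"
      using s unfolding separates_def list_all_iff by blast+
    then have ge: "k ! i \<ge> l ! i" if "i < 6" for i using list_all6 that by blast
    have "0 < (\<Sum>i<6. real_of_int (k ! i - l ! i) * (v \<bullet> a i))"
      using ge d \<open>k ! j > l ! j\<close> by (intro sum_pos2[of _ j]) auto
    then have "0 < v \<bullet> vec k - v \<bullet> vec l"
      using vec_list_inner_diff[of k l v] len kl K by auto
    then show "v \<bullet> y < v \<bullet> x" using kl by simp
  qed (use K w reflection_closed_image[OF F] in auto)
  moreover have "u (\<Sum>x\<in>vec ` set K. x) = (\<Sum>x\<in>u ` vec ` set K. x)" if "u \<in> G" for u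
  proof -
    have "inj u" using refl_group_linear[OF that] refl_group_isometry[OF that]
      by (metis inner_eq_zero_iff linear_injective_0)
    then show ?thesis using linear_sum[OF refl_group_linear[OF that]]
      by (subst sum.reindex) (auto intro: inj_on_subset)
  qed
  ultimately show ?thesis using w by metis
qed

lemma vec_add: "length k = 6 \<Longrightarrow> length l = 6 \<Longrightarrow> vec k + vec l = vec (map2 (+) k l)"
  by (auto simp: vec_def lin_def sum.distrib[symmetric] scaleR_add_left[symmetric] intro!: sum.cong)

lemma sum_vec_set:
  assumes "distinct K" "list_all (\<lambda>k. length k = 6) K"
  shows "(\<Sum>x\<in>vec ` set K. x) = (\<Sum>k\<leftarrow>K. vec k)"
proof -
  have "inj_on vec (set K)" using assms(2) vec_eq_iff by (auto simp: inj_on_def list_all_iff)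
  then show ?thesis using assms(1) by (simp add: sum.reindex sum_list_distinct_conv_sum_set)
qed

text \<open>Of the nonzero dominant vectors this leaves out exactly the positive multiples of the
  two minuscule weights, those of index 0 and 5.\<close>

lemma dominant_orbit_large:
  assumes d: "\<And>i. i < 6 \<Longrightarrow> v \<bullet> a i \<ge> 0"
    and j: "j < 6" "v \<bullet> a j > 0" "j \<notin> {0, 5} \<or> v \<bullet> a 0 > 0 \<and> v \<bullet> a 5 > 0"
  shows "card (orbit (simples S) v) > 27"
proof -
  have D: "w (\<Sum>x\<in>vec ` set K. x) = w' (\<Sum>x\<in>vec ` set K. x)"
    if "j < 6" "v \<bullet> a j > 0" "reflection_closed F" "separates j F K" "w \<in> G" "w' \<in> G" "w v = w' v"
    for j F K w w'
    using dominant_separated[of v j F K w w'] d that by blast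
  have s1: "(\<Sum>x\<in>vec ` set [[1,2,2,3,2,1]]. x) = vec [1,2,2,3,2,1]"
    by (subst sum_vec_set) (simp_all add: vec_add)
  have s2: "(\<Sum>x\<in>vec ` set [[4,3,5,6,4,2],[1,3,5,6,4,2]]. x) = vec [5,6,10,12,8,4]"
    by (subst sum_vec_set) (simp_all add: vec_add)
  have s3: "(\<Sum>x\<in>vec ` set [[4,3,5,6,4,2],[1,3,5,6,4,2],[1,3,2,6,4,2]]. x) = vec [6,9,12,18,12,6]"
    by (subst sum_vec_set) (simp_all add: vec_add)
  have s4: "(\<Sum>x\<in>vec ` set [[2,3,4,6,5,4],[2,3,4,6,5,1]]. x) = vec [4,6,8,12,10,5]"
    by (subst sum_vec_set) (simp_all add: vec_add)
  have s5: "(\<Sum>x\<in>vec ` set [[4,3,5,6,4,2]]. x) = vec [4,3,5,6,4,2]"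
    by (subst sum_vec_set) (simp_all add: vec_add)
  have s6: "(\<Sum>x\<in>vec ` set [[2,3,4,6,5,4]]. x) = vec [2,3,4,6,5,4]"
    by (subst sum_vec_set) (simp_all add: vec_add)
  have "j = 0 \<or> j = 1 \<or> j = 2 \<or> j = 3 \<or> j = 4 \<or> j = 5" using j(1) by linarith
  then consider "j = 1" | "j = 2" | "j = 3" | "j = 4" | "v \<bullet> a 0 > 0" "v \<bullet> a 5 > 0" using j(3) by blast
  then show ?thesis
  proof cases
    case 1
    show ?thesis
    proof (rule orbit_large[OF words_good(1)])
      fix w w' assume "w \<in> G" "w' \<in> G" "w v = w' v"
      then show "w (vec [1,2,2,3,2,1]) = w' (vec [1,2,2,3,2,1])"
        using D[OF _ _ closed_lists(3) separations(1)] j 1 unfolding s1 by blast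
    qed simp
  next
    case 2
    show ?thesis
    proof (rule orbit_large[OF words_good(2)])
      fix w w' assume "w \<in> G" "w' \<in> G" "w v = w' v"
      then show "w (vec [5,6,10,12,8,4]) = w' (vec [5,6,10,12,8,4])"
        using D[OF _ _ closed_lists(1) separations(2)] j 2 unfolding s2 by blast
    qed simp
  next
    case 3
    show ?thesis
    proof (rule orbit_large[OF words_good(3)])
      fix w w' assume "w \<in> G" "w' \<in> G" "w v = w' v"
      then show "w (vec [6,9,12,18,12,6]) = w' (vec [6,9,12,18,12,6])"
        using D[OF _ _ closed_lists(1) separations(3)] j 3 unfolding s3 by blast
    qed simp
  next
    case 4
    show ?thesis
    proof (rule orbit_large[OF words_good(4)])
      fix w w' assume "w \<in> G" "w' \<in> G" "w v = w' v"
      then show "w (vec [4,6,8,12,10,5]) = w' (vec [4,6,8,12,10,5])"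
        using D[OF _ _ closed_lists(2) separations(4)] j 4 unfolding s4 by blast
    qed simp
  next
    case 5
    have e: "vec [6,6,9,12,9,6] = vec [4,3,5,6,4,2] + vec [2,3,4,6,5,4]" by (simp add: vec_add)
    have "w (vec [6,6,9,12,9,6]) = w' (vec [6,6,9,12,9,6])" if w: "w \<in> G" "w' \<in> G" "w v = w' v" for w w'
    proof -
      have "w (vec [4,3,5,6,4,2]) = w' (vec [4,3,5,6,4,2])"
        using D[OF _ 5(1) closed_lists(1) separations(5) w] unfolding s5 by simp
      moreover have "w (vec [2,3,4,6,5,4]) = w' (vec [2,3,4,6,5,4])"
        using D[OF _ 5(2) closed_lists(2) separations(6) w] unfolding s6 by simp
      ultimately show ?thesis unfolding e
        using linear_add[OF refl_group_linear[OF w(1)]] linear_add[OF refl_group_linear[OF w(2)]] by simp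
    qed
    then show ?thesis by (intro orbit_large[OF words_good(5)]) simp_all
  qed
qed

lemma orbit_minuscule: "orbit (simples S) (s *\<^sub>R vec (W27 ! 0)) = (\<lambda>m. s *\<^sub>R vec m) ` set W27"
proof
  have c: "length m = 6" "i < 6 \<Longrightarrow> refl_coords i m \<in> set W27" if "m \<in> set W27" for m i
    using closed_lists(1) that list_all6[of "\<lambda>i. refl_coords i m \<in> set W27" i]
    unfolding reflection_closed_def list_all_iff by (metis (no_types, lifting))+
  have l: "length W27 = 27" by (simp add: W27_def)
  have ref: "reflect (a i) (s *\<^sub>R vec m) = s *\<^sub>R vec (refl_coords i m)" if "i < 6" "m \<in> set W27" for i m
    using that c by (simp add: linear_scale[OF linear_reflect] reflect_vec del: refl_coords.simps)
  show "orbit (simples S) (s *\<^sub>R vec (W27 ! 0)) \<subseteq> (\<lambda>m. s *\<^sub>R vec m) ` set W27"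
  proof
    fix y assume "y \<in> orbit (simples S) (s *\<^sub>R vec (W27 ! 0))"
    then show "y \<in> (\<lambda>m. s *\<^sub>R vec m) ` set W27"
    proof (induction rule: orbit_induct)
      case base
      show ?case using l by (intro imageI nth_mem) simp
    next
      case (step b y)
      then show ?case using ref c by (auto simp: simples_S simp del: refl_coords.simps)
    qed
  qed
  have "s *\<^sub>R vec (W27 ! j) \<in> orbit (simples S) (s *\<^sub>R vec (W27 ! 0))" if "j < 27" for j
    using that
  proof (induction j rule: less_induct)
    case (less j)
    show ?case
    proof (cases "j = 0")
      case False
      then obtain i k where ik: "i < 6" "k < j" "W27 ! j = refl_coords i (W27 ! k)"
        using W27_reachable less.prems by blast
      then have "s *\<^sub>R vec (W27 ! j) = reflect (a i) (s *\<^sub>R vec (W27 ! k))"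
        using ref[of i "W27 ! k"] less.prems l by simp
      then show ?thesis using less.IH[OF ik(2)] ik less.prems orbit_reflect[of "a i" "simples S"]
        by (simp add: simples_S)
    qed (simp add: orbit_refl)
  qed
  then show "(\<lambda>m. s *\<^sub>R vec m) ` set W27 \<subseteq> orbit (simples S) (s *\<^sub>R vec (W27 ! 0))"
    using l by (auto simp: in_set_conv_nth)
qed

lemma smallest_orbit:
  assumes "smallest_nonzero_orbit (simples S) X"
  obtains s where "s > 0" "X = orbit (simples S) (s *\<^sub>R vec (W27 ! 0)) \<or>
     X = orbit (simples S) (s *\<^sub>R vec (flip_coords (W27 ! 0)))"
proof -
  obtain v0 where v0: "v0 \<noteq> 0" "X = orbit (simples S) v0"
    and small: "\<And>w. w \<noteq> 0 \<Longrightarrow> card X \<le> card (orbit (simples S) w)"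
    using assms unfolding smallest_nonzero_orbit_def by blast
  have W0: "W27 ! 0 = [4,3,5,6,4,2]" by (simp add: W27_def)
  have top: "vec (W27 ! 0) \<bullet> a i = N / 2 * (if i = 0 then 3 else 0)"
    "vec (flip_coords (W27 ! 0)) \<bullet> a i = N / 2 * (if i = 5 then 3 else 0)" if "i < 6" for i
    using that by (auto simp: W0 flip_coords_def vec_inner cartan_def elim!: less6_cases)
  have "card (orbit (simples S) (1 *\<^sub>R vec (W27 ! 0))) \<le> card (set W27)"
    unfolding orbit_minuscule by (rule card_image_le) simp
  also have "\<dots> \<le> 27" using card_length[of W27] by (simp add: W27_def)
  finally have c27: "card X \<le> 27"
    using small[of "1 *\<^sub>R vec (W27 ! 0)"] top(1)[of 0] N_pos by fastforce
  \<comment> \<open>The sum of all positive roots, whose product with every simple root is N.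
    Maximizing the product with it picks a dominant element of the orbit.\<close>
  define \<rho> where "\<rho> = vec [16,22,30,42,30,16]"
  have \<rho>: "a i \<bullet> \<rho> = N" if "i < 6" for i
    using that by (subst inner_commute) (auto simp: \<rho>_def vec_inner cartan_def elim!: less6_cases)
  have "finite X" unfolding v0 orbit_def using finite_G by simp
  moreover have "X \<noteq> {}" unfolding v0 using orbit_refl by blast
  ultimately obtain v where v: "v \<in> X" "\<And>x. x \<in> X \<Longrightarrow> x \<bullet> \<rho> \<le> v \<bullet> \<rho>"
  proof -
    assume "finite X" "X \<noteq> {}"
      and *: "\<And>v. v \<in> X \<Longrightarrow> (\<And>x. x \<in> X \<Longrightarrow> x \<bullet> \<rho> \<le> v \<bullet> \<rho>) \<Longrightarrow> thesis"
    then have "Max ((\<lambda>x. x \<bullet> \<rho>) ` X) \<in> (\<lambda>x. x \<bullet> \<rho>) ` X" by (intro Max_in) auto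
    then obtain v where "v \<in> X" "v \<bullet> \<rho> = Max ((\<lambda>x. x \<bullet> \<rho>) ` X)" by auto
    then show thesis using \<open>finite X\<close> by (intro *[of v]) auto
  qed
  have X: "X = orbit (simples S) v" using v(1) v0(2) orbit_eq by blast
  have "v \<noteq> 0"
  proof
    assume "v = 0"
    then have "v0 \<in> orbit (simples S) 0" using v v0 orbit_sym by blast
    then show False using v0(1) linear_0[OF refl_group_linear] unfolding orbit_def by auto
  qed
  \<comment> \<open>Reflecting in a simple root with negative product would increase the product
    with \<rho>.\<close>
  have d: "v \<bullet> a i \<ge> 0" if "i < 6" for i
  proof -
    have "reflect (a i) v \<in> X" unfolding v0(2)
      using that v v0 orbit_reflect[of "a i"] by (simp add: simples_S)
    then have "(v - (2 * (v \<bullet> a i) / N) *\<^sub>R a i) \<bullet> \<rho> \<le> v \<bullet> \<rho>"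
      using v(2) reflect_root[OF that] by simp
    then have "2 * (v \<bullet> a i) / N * N \<ge> 0" using \<rho>[OF that] by (simp add: inner_diff_left)
    then show ?thesis using N_pos by simp
  qed
  have nl: "\<not> (j \<notin> {0, 5} \<or> v \<bullet> a 0 > 0 \<and> v \<bullet> a 5 > 0)" if "j < 6" "v \<bullet> a j > 0" for j
  proof
    assume "j \<notin> {0, 5} \<or> v \<bullet> a 0 > 0 \<and> v \<bullet> a 5 > 0"
    then have "card (orbit (simples S) v) > 27"
      using dominant_orbit_large[of v j] d that by blast
    then show False using c27 X by simp
  qed
  obtain j where j: "j < 6" "v \<bullet> a j > 0"
    using \<open>v \<noteq> 0\<close> orthogonal_zero[of v] d by (metis less_eq_real_def)
  then have j05: "j = 0 \<or> j = 5" using nl[OF j] by blast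
  have z: "v \<bullet> a i = 0" if "i < 6" "i \<noteq> j" for i
  proof (rule ccontr)
    assume "v \<bullet> a i \<noteq> 0"
    then have "v \<bullet> a i > 0" using d[OF that(1)] by simp
    then show False using nl[OF that(1)] nl[OF j] j j05 that(2) by auto
  qed
  \<comment> \<open>The coordinates in \<open>W27\<close> carry a factor 3, so the top weight has
    product 3 N / 2 with its root.\<close>
  define s where "s = 2 * (v \<bullet> a j) / (3 * N)"
  have s: "s > 0" using j N_pos by (simp add: s_def)
  have "v = s *\<^sub>R vec (W27 ! 0) \<or> v = s *\<^sub>R vec (flip_coords (W27 ! 0))"
    using j05
  proof
    assume "j = 0"
    then have "v = s *\<^sub>R vec (W27 ! 0)"
      using z N_pos by (intro eq_by_inner) (auto simp: top s_def)
    then show ?thesis ..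
  next
    assume "j = 5"
    then have "v = s *\<^sub>R vec (flip_coords (W27 ! 0))"
      using z N_pos by (intro eq_by_inner) (auto simp: top s_def)
    then show ?thesis ..
  qed
  then show thesis using that s X by blast
qed

end

text \<open>The diagram automorphism preserves both classes of the bipartition.\<close>

lemma E6_setting_flip:
  assumes "E6_setting a N \<Phi> S \<epsilon>"
  shows "E6_setting (\<lambda>i. a ([5,1,4,3,2,0] ! i)) N \<Phi> S \<epsilon>"
    "length m = 6 \<Longrightarrow> E6_roots.vec (\<lambda>i. a ([5,1,4,3,2,0] ! i)) m = E6_roots.vec a (flip_coords m)"
proof -
  interpret E6_setting a N \<Phi> S \<epsilon> by (rule assms)
  let ?a = "\<lambda>i. a ([5,1,4,3,2,0] ! i)"
  have f: "[5,1,4,3,2,0] ! i < (6::nat)" if "i < 6" for i :: nat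
    using that by (auto elim!: less6_cases)
  have c: "cartan ! ([5,1,4,3,2,0] ! i) ! ([5,1,4,3,2,0] ! j) = cartan ! i ! j" if "i < 6" "j < 6" for i j
    using that by (auto simp: cartan_def elim!: less6_cases)
  have r: "\<exists>j<6. i = [5,1,4,3,2,0] ! j" if "i < 6" for i :: nat
    using that by (intro exI[of _ "[5,1,4,3,2,0] ! i"]) (auto elim!: less6_cases)
  interpret F: E6_roots ?a N
  proof
    show "?a i \<bullet> ?a j = N / 2 * real_of_int (cartan ! i ! j)" if "i < 6" "j < 6" for i j
      using gram[OF f[OF that(1)] f[OF that(2)]] c[OF that] by simp
    show "x = 0" if "\<And>i. i < 6 \<Longrightarrow> x \<bullet> ?a i = 0" for x
      using that r orthogonal_zero by metis
  qed (rule N_pos)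
  show "E6_setting ?a N \<Phi> S \<epsilon>"
    using rs ss S_pos S_neg by unfold_locales auto
  show "F.vec m = vec (flip_coords m)" if "length m = 6"
    unfolding F.vec_def vec_def F.lin_def lin_def sum_lessThan6 flip_coords_def
    by (rule length6_cases[OF that]) simp
qed

section \<open>The Coxeter plane\<close>

text \<open>2 cos (pi / h): the eigenvalue of the adjacency matrix of the diagram that belongs to
  its positive eigenvector.\<close>

definition kappa :: real where
  "kappa = 2 * cos (pi / 12)"

lemma kappa_sq: "kappa^2 = 2 + sqrt 3"
proof -
  have "cos (pi / 6) = 2 * (cos (pi / 12))^2 - 1"
    using cos_double_cos[of "pi / 12"] by simp
  then show ?thesis by (simp add: kappa_def cos_30 power2_eq_square)
qed

lemma kappa_power4: "kappa^4 = 4 * kappa^2 - 1"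
proof -
  have "kappa^4 = (kappa^2)^2" by simp
  also have "\<dots> = 7 + 4 * sqrt 3" unfolding kappa_sq by (simp add: power2_eq_square algebra_simps)
  finally show ?thesis by (simp add: kappa_sq)
qed

lemma kappa_bounds: "1931 / 1000 < kappa" "kappa < 1932 / 1000"
proof -
  have s3: "1732 / 1000 < sqrt 3" "sqrt 3 < 17321 / 10000"
    by (rule real_less_rsqrt real_less_lsqrt; simp add: power2_eq_square)+
  have pos: "kappa > 0" unfolding kappa_def by (simp add: cos_gt_zero_pi)
  show "1931 / 1000 < kappa"
    by (rule power2_less_imp_less) (use s3 pos in \<open>simp_all add: kappa_sq power2_eq_square[of "_ / _"]\<close>)
  show "kappa < 1932 / 1000"
    by (rule power2_less_imp_less) (use s3 pos in \<open>simp_all add: kappa_sq power2_eq_square[of "_ / _"]\<close>)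
qed

lemma kappa_pos: "kappa > 0"
  using kappa_bounds by linarith

lemma sin_theta: "2 * kappa * sin (pi / 12) = 1"
  using sin_double[of "pi / 12"] by (simp add: kappa_def sin_30 mult_ac)

text \<open>Exact arithmetic in Z[kappa]: a list holds the coefficients of the powers 0 to 3, and
  \<open>kshift\<close> is multiplication by kappa, reduced by \<open>kappa_power4\<close>. Equality
  of lists then proves equality of reals.\<close>

fun kpoly :: "int list \<Rightarrow> real" where
  "kpoly p = real_of_int (p ! 0) + real_of_int (p ! 1) * kappa + real_of_int (p ! 2) * kappa^2 + real_of_int (p ! 3) * kappa^3"

fun kshift :: "int list \<Rightarrow> int list" where
  "kshift p = [- (p ! 3), p ! 0, p ! 1 + 4 * p ! 3, p ! 2]"

fun klin :: "int \<Rightarrow> int list \<Rightarrow> int \<Rightarrow> int list \<Rightarrow> int list" where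
  "klin x p y q = [x * p ! 0 + y * q ! 0, x * p ! 1 + y * q ! 1, x * p ! 2 + y * q ! 2, x * p ! 3 + y * q ! 3]"

lemma kpoly_shift: "kpoly (kshift p) = kappa * kpoly p"
proof -
  have e: "kappa * kappa^3 = 4 * kappa^2 - 1" using kappa_power4 by (simp add: power4_eq_xxxx power3_eq_cube mult_ac)
  have "kappa * kpoly p = real_of_int (p ! 0) * kappa + real_of_int (p ! 1) * kappa^2 + real_of_int (p ! 2) * kappa^3
      + real_of_int (p ! 3) * (kappa * kappa^3)"
    by (simp add: algebra_simps power2_eq_square power3_eq_cube)
  then show ?thesis unfolding e by (simp add: algebra_simps numeral_3_eq_3)
qed

lemma kpoly_lin: "kpoly (klin x p y q) = real_of_int x * kpoly p + real_of_int y * kpoly q"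
  by (simp add: algebra_simps numeral_3_eq_3)

text \<open>Entry \<open>j\<close> represents \<open>2 sin (j \<pi> / 12)\<close>.\<close>

definition sin_table :: "int list list" where
  "sin_table = [
    [0,0,0,0], [0,4,0,-1], [1,0,0,0], [0,-3,0,1], [-2,0,1,0], [0,1,0,0], [2,0,0,0], [0,1,0,0],
    [-2,0,1,0], [0,-3,0,1], [1,0,0,0], [0,4,0,-1], [0,0,0,0], [0,-4,0,1], [-1,0,0,0], [0,3,0,-1],
    [2,0,-1,0], [0,-1,0,0], [-2,0,0,0], [0,-1,0,0], [2,0,-1,0], [0,3,0,-1], [-1,0,0,0], [0,-4,0,1],
    [0,0,0,0]]"

text \<open>The sum of the sines at angles y - pi / 12 and y + pi / 12 is kappa sin y, which gives
  the recurrence. It starts from the inverse of kappa, which the quartic equation writes as 4 kappa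
  - kappa^3.\<close>

lemma sin_table: "j < 25 \<Longrightarrow> kpoly (sin_table ! j) = 2 * sin (real j * pi / 12)"
proof (induction j rule: less_induct)
  case (less j)
  have rec: "list_all (\<lambda>j. sin_table ! Suc (Suc j) = klin 1 (kshift (sin_table ! Suc j)) (-1) (sin_table ! j))
     [0,1,2,3,4,5,6,7,8,9,10,11,12,13,14,15,16,17,18,19,20,21,22]"
    by (simp add: sin_table_def)
  consider "j = 0" | "j = 1" | i where "j = Suc (Suc i)" by (metis One_nat_def not0_implies_Suc)
  then show ?case
  proof cases
    case 1
    then show ?thesis by (simp add: sin_table_def)
  next
    case 2
    have "kappa * (4 * kappa - kappa^3) = 1" using kappa_power4
      by (simp add: algebra_simps power2_eq_square power3_eq_cube power4_eq_xxxx)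
    then have "kappa * (4 * kappa - kappa^3) = kappa * (2 * sin (pi / 12))" using sin_theta by simp
    then have "4 * kappa - kappa^3 = 2 * sin (pi / 12)" using kappa_pos by simp
    then show ?thesis using 2 by (simp add: sin_table_def numeral_3_eq_3)
  next
    case 3
    have "i \<in> set [0,1,2,3,4,5,6,7,8,9,10,11,12,13,14,15,16,17,18,19,20,21,22]"
      using less.prems 3 by (simp; presburger)
    then have "sin_table ! j = klin 1 (kshift (sin_table ! Suc i)) (-1) (sin_table ! i)"
      using rec 3 unfolding list_all_iff by blast
    then have "kpoly (sin_table ! j) = kappa * kpoly (sin_table ! Suc i) - kpoly (sin_table ! i)"
      by (simp only: kpoly_lin kpoly_shift of_int_1 of_int_minus mult_1 mult_minus1 add_uminus_conv_diff)
    also have "\<dots> = kappa * (2 * sin (real (Suc i) * pi / 12)) - 2 * sin (real i * pi / 12)"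
      using less 3 by simp
    also have "\<dots> = 2 * sin (real j * pi / 12)"
    proof -
      define y where "y = real (Suc i) * pi / 12"
      have e: "real i * pi / 12 = y - pi / 12" "real j * pi / 12 = y + pi / 12"
        using 3 by (simp_all add: y_def field_simps)
      have "sin (real i * pi / 12) + sin (real j * pi / 12) = kappa * sin y"
        unfolding e by (simp add: sin_add sin_diff kappa_def)
      then have "sin (real i * pi / 12) + sin (real j * pi / 12) = kappa * sin (real (Suc i) * pi / 12)"
        unfolding y_def .
      then show ?thesis by simp
    qed
    finally show ?thesis .
  qed
qed

text \<open>For a weight with code \<open>(t, k)\<close>, \<open>t = 1\<close> and \<open>t = 2\<close> mean that it projects to the inner and
  outer circle, at angle \<open>k \<pi> / 12\<close>; \<open>t = 0\<close> means that it projects to the origin, and then \<open>k\<close>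
  is a label.\<close>

definition weight_codes :: "(int list \<times> nat \<times> nat) list" where
  "weight_codes = [
    ([4,3,5,6,4,2],(2,24)), ([1,3,5,6,4,2],(2,2)), ([1,3,2,6,4,2],(2,22)), ([1,3,2,3,4,2],(2,4)),
    ([1,0,2,3,4,2],(1,1)), ([1,3,2,3,1,2],(1,23)), ([1,0,2,3,1,2],(2,20)), ([1,3,2,3,1,-1],(1,3)),
    ([1,0,2,0,1,2],(1,5)), ([1,0,2,3,1,-1],(1,21)), ([1,0,-1,0,1,2],(1,19)), ([1,0,2,0,1,-1],(2,6)),
    ([-2,0,-1,0,1,2],(0,0)), ([1,0,-1,0,1,-1],(0,1)), ([1,0,2,0,-2,-1],(0,2)), ([-2,0,-1,0,1,-1],(1,7)),
    ([1,0,-1,0,-2,-1],(2,18)), ([-2,0,-1,0,-2,-1],(1,17)), ([1,0,-1,-3,-2,-1],(1,9)), ([-2,0,-1,-3,-2,-1],(2,8)),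
    ([1,-3,-1,-3,-2,-1],(1,15)), ([-2,-3,-1,-3,-2,-1],(1,11)), ([-2,0,-4,-3,-2,-1],(1,13)), ([-2,-3,-4,-3,-2,-1],(2,16)),
    ([-2,-3,-4,-6,-2,-1],(2,10)), ([-2,-3,-4,-6,-5,-1],(2,14)), ([-2,-3,-4,-6,-5,-4],(2,12))]"

text \<open>The positive eigenvector of the adjacency matrix, normalized to 1 at node 0.\<close>

definition eig_poly :: "int list list" where
  "eig_poly = [[1,0,0,0],[0,-3,0,1],[0,1,0,0],[-1,0,1,0],[0,1,0,0],[1,0,0,0]]"

text \<open>Up to a constant, the inner product with the part of the eigenvector combination
  supported on one half. The two halves span the Coxeter plane, so these two numbers determine the
  projection.\<close>

definition half_pairing :: "bool \<Rightarrow> int list \<Rightarrow> int list" where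
  "half_pairing b m = (if m = [] then [] else
     foldl (\<lambda>p i. klin 1 p (pairing i m) (eig_poly ! i)) [0,0,0,0] (cls b))"

text \<open>The factor 3 is the one carried by the coordinates in \<open>W27\<close>.\<close>

definition ring_poly :: "nat \<Rightarrow> int list \<Rightarrow> int list" where
  "ring_poly t p = (if t = 0 then [0,0,0,0] else if t = 1 then klin 3 p 0 p else klin 3 (kshift p) 0 p)"

lemma weight_codes_W27: "map fst weight_codes = W27"
  by (simp add: weight_codes_def W27_def)

lemma weight_codes_range:
  "(m, t, k) \<in> set weight_codes \<Longrightarrow> length m = 6 \<and> t < 3 \<and> (t = 0 \<longrightarrow> k < 3) \<and> (t \<noteq> 0 \<longrightarrow> 1 \<le> k \<and> k \<le> 24)"
proof -
  have "list_all (\<lambda>(m, t, k). length m = 6 \<and> t < 3 \<and> (t = 0 \<longrightarrow> k < 3) \<and> (t \<noteq> 0 \<longrightarrow> 1 \<le> k \<and> k \<le> 24)) weight_codes"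
    by (simp add: weight_codes_def)
  then show "(m, t, k) \<in> set weight_codes \<Longrightarrow> ?thesis" unfolding list_all_iff by blast
qed

text \<open>The exact verification of the codes. In the plane of the codes the two half-vectors are
  normal to the lines at angles 0 and pi / 12, so their products with a projected weight are sines
  of k and of 1 - k steps.\<close>

lemma half_pairing_codes:
  "list_all (\<lambda>(m, t, k). if m = [] then False else
     half_pairing False m = ring_poly t (sin_table ! k) \<and>
     half_pairing True m = ring_poly t (klin (-1) (sin_table ! (if t = 0 then 0 else k - 1)) 0 [0,0,0,0])) weight_codes"
  by code_simp

definition ring_radius :: "nat \<Rightarrow> real" where
  "ring_radius t = (if t = 0 then 0 else if t = 1 then 1 else kappa)"

lemma kpoly_ring_poly: "kpoly (ring_poly t p) = 3 * ring_radius t * kpoly p"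
proof -
  consider "t = 0" | "t = 1" | "t \<noteq> 0" "t \<noteq> 1" by blast
  then show ?thesis
  proof cases
    case 3
    then show ?thesis unfolding ring_poly_def ring_radius_def
      by (simp only: kpoly_lin kpoly_shift if_False of_int_numeral of_int_0 mult_zero_left add_0_right mult.assoc)
  next
    case 2
    then show ?thesis unfolding ring_poly_def ring_radius_def
      by (simp del: kpoly.simps klin.simps add: kpoly_lin)
  qed (simp add: ring_poly_def ring_radius_def)
qed

lemma half_pairing_sin:
  assumes "(m, t, k) \<in> set weight_codes"
  shows "kpoly (half_pairing False m) = 6 * ring_radius t * sin (real k * pi / 12)"
    "kpoly (half_pairing True m) = 6 * ring_radius t * sin ((1 - real k) * pi / 12)"
proof -
  have *: "half_pairing False m = ring_poly t (sin_table ! k)"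
     "half_pairing True m = ring_poly t (klin (-1) (sin_table ! (if t = 0 then 0 else k - 1)) 0 [0,0,0,0])"
    using half_pairing_codes assms unfolding list_all_iff by (fastforce split: if_splits)+
  show "kpoly (half_pairing False m) = 6 * ring_radius t * sin (real k * pi / 12)"
    using weight_codes_range[OF assms] unfolding *
    by (simp only: kpoly_ring_poly) (cases "t = 0"; simp add: sin_table ring_radius_def del: kpoly.simps)
  show "kpoly (half_pairing True m) = 6 * ring_radius t * sin ((1 - real k) * pi / 12)"
  proof (cases "t = 0")
    case False
    then have k: "1 \<le> k" "k \<le> 24" using weight_codes_range[OF assms] by auto
    have "sin ((1 - real k) * pi / 12) = - sin (real (k - 1) * pi / 12)"
      using k by (simp add: of_nat_diff sin_minus[symmetric] minus_divide_left[symmetric] algebra_simps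
          diff_divide_distrib)
    then show ?thesis using k False unfolding *
      by (simp only: kpoly_ring_poly kpoly_lin if_False) (simp add: sin_table del: kpoly.simps)
  qed (simp only: * kpoly_ring_poly, simp add: ring_radius_def)
qed

text \<open>Three times the inverse of the Cartan matrix; its rows are multiples of the fundamental
  weights.\<close>

definition cartan_adj :: "int list list" where
  "cartan_adj = [[4,3,5,6,4,2],[3,6,6,9,6,3],[5,6,10,12,8,4],[6,9,12,18,12,6],[4,6,8,12,10,5],[2,3,4,6,5,4]]"

lemma cartan_adj: "i < 6 \<Longrightarrow> length (cartan_adj ! i) = 6"
  "i < 6 \<Longrightarrow> j < 6 \<Longrightarrow> pairing j (cartan_adj ! i) = (if j = i then 3 else 0)"
proof -
  have *: "list_all (\<lambda>i. length (cartan_adj ! i) = 6 \<and>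
      list_all (\<lambda>j. pairing j (cartan_adj ! i) = (if j = i then 3 else 0)) [0,1,2,3,4,5]) [0,1,2,3,4,5]"
    by code_simp
  show "i < 6 \<Longrightarrow> length (cartan_adj ! i) = 6" using list_all6[OF *] by blast
  show "i < 6 \<Longrightarrow> j < 6 \<Longrightarrow> pairing j (cartan_adj ! i) = (if j = i then 3 else 0)"
    using list_all6[OF *, of i] list_all6[of "\<lambda>j. pairing j (cartan_adj ! i) = (if j = i then 3 else 0)" j] by blast
qed

text \<open>Makes the index in the definite description inside \<open>hat\<close> unique: the range
  1 to 2 h covers one full turn.\<close>

lemma rcis_eq_iff_index:
  assumes "r > 0" "h > 0" "1 \<le> k" "k \<le> 2 * h" "1 \<le> l" "l \<le> 2 * h"
    "rcis r (real k * pi / real h) = rcis r (real l * pi / real h)"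
  shows "k = l"
proof -
  have "cis (real k * pi / real h) = cis (real l * pi / real h)"
    using assms(1,7) by (simp add: rcis_def)
  then obtain n :: int where n: "real k * pi / real h = real l * pi / real h + 2 * pi * n"
    using sin_cos_eq_iff by (metis cis.simps)
  then have "real k * pi = (real l + 2 * real h * n) * pi"
    using assms(2) by (simp add: field_simps)
  then have "real k = real l + 2 * real h * n" by (simp only: mult_cancel_right pi_neq_zero simp_thms)
  then have e: "int k = int l + 2 * int h * n"
    by (metis (no_types, lifting) of_int_add of_int_eq_iff of_int_mult of_int_numeral of_int_of_nat_eq)
  have "\<bar>int k - int l\<bar> < 2 * int h" using assms by linarith
  then have "\<bar>2 * int h * n\<bar> < 2 * int h" using e by simp
  then have "\<bar>n\<bar> < 1" using assms(2) by (simp add: abs_mult)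
  then show ?thesis using e by simp
qed

locale E6_diagram = E6_setting a N \<Phi> S \<epsilon>\<^sub>0
  for a :: "nat \<Rightarrow> 'a::euclidean_space" and N \<Phi> S \<epsilon>\<^sub>0 +
  fixes c :: "'a \<Rightarrow> real" and s :: real
  assumes eig: "coxeter_eigenvector (simples S) c" and s_pos: "s > 0"
begin

section \<open>The eigenvector, the half-vectors and the projection\<close>

definition cc :: "nat \<Rightarrow> real" where
  "cc i = c (a i)"

lemma sgn_root: "i < 6 \<Longrightarrow> sgn (a i) = (1 / sqrt N) *\<^sub>R a i"
  by (simp add: sgn_div_norm norm_eq_sqrt_inner norm_root divide_inverse)

lemma cc_pos: "i < 6 \<Longrightarrow> cc i > 0"
  using eig unfolding coxeter_eigenvector_def cc_def simples_S by auto

text \<open>With u = 2 - 2 e the equations make c an eigenvector of the adjacency matrix for u.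
  Elimination along the branches leaves u^4 - 4 u^2 + 1 = 0, and positivity of the entries gives u >
  0 and u^2 > 1, which singles out the root kappa.\<close>

lemma eigenvector_coords:
  "cc 5 = cc 0" "cc 2 = kappa * cc 0" "cc 4 = kappa * cc 0" "cc 3 = (kappa^2 - 1) * cc 0"
  "cc 1 = (kappa^3 - 3 * kappa) * cc 0"
proof -
  obtain e where e: "\<And>x. x \<in> simples S \<Longrightarrow> (\<Sum>y\<in>simples S. (sgn x \<bullet> sgn y) * c y) = e * c x"
    using eig unfolding coxeter_eigenvector_def gram_eigenvector_def by blast
  have sgn: "sgn (a i) \<bullet> sgn (a j) = real_of_int (cartan ! i ! j) / 2" if "i < 6" "j < 6" for i j
    using that N_pos by (simp add: sgn_root gram field_simps)
  have "(\<Sum>j<6. real_of_int (cartan ! i ! j) * cc j) = 2 * e * cc i" if "i < 6" for i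
  proof -
    have "(\<Sum>j<6. (sgn (a i) \<bullet> sgn (a j)) * cc j) = e * cc i"
      using e[of "a i"] that inj_a by (simp add: simples_S sum.reindex cc_def)
    then have "(\<Sum>j<6. real_of_int (cartan ! i ! j) / 2 * cc j) = e * cc i"
      using that by (simp add: sgn)
    then show ?thesis by (simp add: sum_lessThan6)
  qed
  from this[of 0] this[of 1] this[of 2] this[of 3] this[of 4] this[of 5]
  have E: "2 * cc 0 - cc 2 = 2 * e * cc 0" "2 * cc 1 - cc 3 = 2 * e * cc 1"
    "2 * cc 2 - cc 0 - cc 3 = 2 * e * cc 2" "2 * cc 3 - cc 1 - cc 2 - cc 4 = 2 * e * cc 3"
    "2 * cc 4 - cc 3 - cc 5 = 2 * e * cc 4" "2 * cc 5 - cc 4 = 2 * e * cc 5"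
    by (simp_all add: sum_lessThan6 cartan_def)
  define u where "u = 2 - 2 * e"
  have u_mult: "u * x = 2 * x - 2 * e * x" for x by (simp add: u_def left_diff_distrib)
  have q: "cc 2 = u * cc 0" "cc 3 = u * cc 1" "cc 0 + cc 3 = u * cc 2"
    "cc 1 + cc 2 + cc 4 = u * cc 3" "cc 3 + cc 5 = u * cc 4" "cc 4 = u * cc 5"
    unfolding u_mult using E by linarith+
  have pos: "cc 0 > 0" "cc 1 > 0" "cc 2 > 0" "cc 3 > 0" "cc 5 > 0" using cc_pos by simp_all
  have u: "u > 0" using q(1) pos by (simp add: zero_less_mult_iff)
  have c3: "cc 3 = (u^2 - 1) * cc 0" "cc 3 = (u^2 - 1) * cc 5"
    using q by (simp_all add: power2_eq_square algebra_simps)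
  have u1: "u^2 - 1 > 0" using c3(1) pos by (simp add: zero_less_mult_iff)
  show 5: "cc 5 = cc 0" using c3 u1 by simp
  have "u * (cc 1 + cc 2 + cc 4) = u * (u * cc 3)" using q(4) by simp
  then have "cc 3 + 2 * u^2 * cc 0 = u^2 * cc 3"
    using q 5 by (simp add: algebra_simps power2_eq_square)
  then have "cc 0 * (u^4 - 4 * u^2 + 1) = 0"
    unfolding c3(1) by (simp add: algebra_simps power2_eq_square power4_eq_xxxx)
  then have u4: "u^4 - 4 * u^2 + 1 = 0" using pos by simp
  \<comment> \<open>The difference of the quartic at u and at kappa, factored; the second factor is
    positive because u^2 > 1 and kappa^2 > 3.\<close>
  have "(u^2 - kappa^2) * (u^2 + kappa^2 - 4) = 0"
  proof -
    have "(u^2 - kappa^2) * (u^2 + kappa^2 - 4) = (u^4 - 4 * u^2 + 1) - (kappa^4 - 4 * kappa^2 + 1)"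
      by (simp add: algebra_simps power2_eq_square power4_eq_xxxx)
    then show ?thesis using u4 kappa_power4 by simp
  qed
  moreover have "u^2 + kappa^2 - 4 > 0"
  proof -
    have "kappa^2 > 3" unfolding kappa_sq using real_less_rsqrt[of 1 3] by simp
    then show ?thesis using u1 by simp
  qed
  ultimately have "u^2 = kappa^2" by simp
  then have uk: "u = kappa" using u kappa_pos by (simp add: power2_eq_iff)
  show "cc 2 = kappa * cc 0" using q uk by simp
  show "cc 4 = kappa * cc 0" using q uk 5 by simp
  show c3': "cc 3 = (kappa^2 - 1) * cc 0" using c3 uk by simp
  have "kappa * ((kappa^3 - 3 * kappa) * cc 0) = (kappa^4 - 3 * kappa^2) * cc 0"
    by (simp add: algebra_simps power2_eq_square power3_eq_cube power4_eq_xxxx)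
  also have "\<dots> = kappa * cc 1" using c3' q(2) uk unfolding kappa_power4 by (simp add: algebra_simps)
  finally show "cc 1 = (kappa^3 - 3 * kappa) * cc 0" using kappa_pos by simp
qed

lemma cc_eig_poly: "i < 6 \<Longrightarrow> cc i = cc 0 * kpoly (eig_poly ! i)"
  using eigenvector_coords by (elim less6_cases) (simp_all add: eig_poly_def numeral_3_eq_3)

text \<open>The description is met by a rescaled row of \<open>cartan_adj\<close>, and it determines
  the vector because the simple roots span.\<close>

lemma dual_vec_inner:
  assumes "i < 6" "j < 6"
  shows "dual_vec (simples S) (a i) \<bullet> a j = sqrt N * (if j = i then 1 else 0)"
proof -
  define w where "w = (2 * sqrt N / (3 * N)) *\<^sub>R vec (cartan_adj ! i)"
  have w: "w \<bullet> a j = sqrt N * (if j = i then 1 else 0)" if "j < 6" for j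
    using that assms(1) N_pos by (simp add: w_def vec_inner cartan_adj del: pairing.simps)
  have eq: "a j = a i \<longleftrightarrow> j = i" if "j < 6" for j
    using inj_a assms(1) that by (auto simp: inj_on_def)
  have w': "w \<bullet> sgn (a j) = (if j = i then 1 else 0)" if "j < 6" for j
    using w[OF that] that N_pos by (simp add: sgn_root)
  have "dual_vec (simples S) (a i) = w"
    unfolding dual_vec_def
  proof (rule the_equality)
    show "\<forall>b\<in>simples S. w \<bullet> sgn b = (if b = a i then 1 else 0)"
      unfolding simples_S using w' eq by auto
    fix v assume v: "\<forall>b\<in>simples S. v \<bullet> sgn b = (if b = a i then 1 else 0)"
    show "v = w"
    proof (rule eq_by_inner)
      fix j :: nat assume j: "j < 6"
      have "v \<bullet> sgn (a j) = w \<bullet> sgn (a j)"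
        using v j w'[OF j] eq[OF j] by (auto simp: simples_S)
      then show "v \<bullet> a j = w \<bullet> a j" using N_pos j by (simp add: sgn_root)
    qed
  qed
  then show ?thesis using w assms by simp
qed

lemma plane_vec_inner:
  assumes "j < 6"
  shows "plane_vec S c (sg b) \<bullet> a j = sqrt N * (if j \<in> set (cls b) then cc j else 0)"
proof -
  have cls6: "set (cls b) \<subseteq> {..<6}" by (simp add: cls_def)
  have "inj_on a (set (cls b))" using inj_a cls6 by (rule inj_on_subset)
  then have "plane_vec S c (sg b) = (\<Sum>i\<in>set (cls b). cc i *\<^sub>R dual_vec (simples S) (a i))"
    unfolding plane_vec_def S_sg by (simp add: sum.reindex cc_def)
  then have "plane_vec S c (sg b) \<bullet> a j = (\<Sum>i\<in>set (cls b). cc i * (sqrt N * (if j = i then 1 else 0)))"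
    using cls6 assms by (auto simp: inner_sum_left dual_vec_inner intro!: sum.cong)
  also have "\<dots> = (\<Sum>i\<in>set (cls b). if j = i then sqrt N * cc i else 0)"
    by (intro sum.cong) auto
  finally show ?thesis by simp
qed

text \<open>The unit simple roots of one half, combined with the eigenvector entries. The two
  half-vectors span the Coxeter plane, and products with them need only pairings with simple roots
  instead of the dual basis.\<close>

definition half_vec :: "bool \<Rightarrow> 'a" where
  "half_vec b = (1 / sqrt N) *\<^sub>R lin (\<lambda>i. if i \<in> set (cls b) then cc i else 0)"

lemma sqrt_N: "sqrt N > 0" "N / sqrt N = sqrt N"
  using N_pos by (simp_all add: real_div_sqrt)

lemma inner_half_vec: "x \<bullet> half_vec b = (1 / sqrt N) * (\<Sum>i\<leftarrow>cls b. cc i * (x \<bullet> a i))"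
  by (simp add: half_vec_def lin_def inner_sum_right inner_add_right sum_lessThan6 cls_def)

lemma eigenvector_adj:
  "cc 2 = kappa * cc 0" "cc 3 = kappa * cc 1" "cc 0 + cc 3 = kappa * cc 2"
  "cc 1 + cc 2 + cc 4 = kappa * cc 3" "cc 3 + cc 5 = kappa * cc 4" "cc 4 = kappa * cc 5"
proof -
  have k: "kappa * (kappa^3 - 3 * kappa) = kappa^2 - 1"
    using kappa_power4 by (simp add: algebra_simps power2_eq_square power3_eq_cube power4_eq_xxxx)
  show "cc 3 = kappa * cc 1" unfolding eigenvector_coords k[symmetric] by (simp only: mult.assoc)
qed (simp_all only: eigenvector_coords, simp_all add: algebra_simps power2_eq_square power3_eq_cube)

text \<open>For a root outside the half, the product is minus half the sum over its neighbours, and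
  the eigenvector equation turns this sum into \<open>kappa * cc j\<close>.\<close>

lemma half_vec_inner_root:
  assumes "j < 6"
  shows "half_vec b \<bullet> a j = sqrt N * (if j \<in> set (cls b) then cc j else - (kappa / 2) * cc j)"
proof -
  have "(\<Sum>k<6. real_of_int (cartan ! j ! k) * (if k \<in> set (cls b) then cc k else 0)) =
      (if j \<in> set (cls b) then 2 * cc j else - (kappa * cc j))"
    by (rule less6_cases[OF assms]; hypsubst)
      (simp_all add: cls_def sum_lessThan6 cartan_def eigenvector_adj(3-6)[symmetric]
        eigenvector_adj(1,2)[unfolded One_nat_def, symmetric])
  then have "half_vec b \<bullet> a j = (N / sqrt N) * ((if j \<in> set (cls b) then 2 * cc j else - (kappa * cc j)) / 2)"
    using assms unfolding half_vec_def by (simp add: lin_inner)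
  then show ?thesis unfolding sqrt_N by (cases "j \<in> set (cls b)") simp_all
qed

text \<open>4 kappa^2 is the inverse of 1 - kappa^2 / 4, by the quartic equation of kappa.\<close>

lemma plane_vec_eq: "plane_vec S c (sg b) = (4 * kappa^2) *\<^sub>R (half_vec b + (kappa / 2) *\<^sub>R half_vec (\<not> b))"
proof (rule eq_by_inner)
  fix j :: nat assume j: "j < 6"
  have d: "j \<in> set (cls (\<not> b)) \<longleftrightarrow> j \<notin> set (cls b)" by (rule less6_cases[OF j]) (simp_all add: cls_def)
  have "4 * kappa^2 * (1 - kappa^2 / 4) = 1"
    using kappa_power4 by (simp add: algebra_simps power2_eq_square power4_eq_xxxx)
  then have k: "4 * kappa^2 * (x * (1 - kappa^2 / 4)) = x" for x :: real
    by (metis mult.commute mult.left_commute mult_1)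
  show "plane_vec S c (sg b) \<bullet> a j = ((4 * kappa^2) *\<^sub>R (half_vec b + (kappa / 2) *\<^sub>R half_vec (\<not> b))) \<bullet> a j"
  proof (cases "j \<in> set (cls b)")
    case True
    have "sqrt N * cc j = 4 * kappa^2 * (sqrt N * cc j * (1 - kappa^2 / 4))" using k by simp
    then show ?thesis using True d j
      by (simp add: plane_vec_inner half_vec_inner_root inner_add_left algebra_simps power2_eq_square)
  next
    case False
    then show ?thesis using d j
      by (simp add: plane_vec_inner half_vec_inner_root inner_add_left)
  qed
qed

text \<open>The common squared length of the two half-vectors.\<close>

definition nn :: real where
  "nn = (cc 0)^2 * (2 + 2 * kappa^2)"

lemma nn_pos: "nn > 0"
  using cc_pos[of 0] by (simp add: nn_def add_pos_nonneg)

lemma half_norm: "(\<Sum>i\<leftarrow>cls b. cc i * cc i) = nn"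
proof -
  have e1: "(kappa^2 - 1)^2 = 2 * kappa^2"
    using kappa_power4 by (simp add: power2_eq_square power4_eq_xxxx algebra_simps)
  have "(kappa^3 - 3 * kappa)^2 = kappa^2 * kappa^4 - 6 * kappa^4 + 9 * kappa^2"
    by (simp add: power2_eq_square power4_eq_xxxx power3_eq_cube algebra_simps)
  also have "\<dots> = 4 * kappa^4 - kappa^2 - 6 * kappa^4 + 9 * kappa^2"
    unfolding kappa_power4 using kappa_power4 by (simp add: algebra_simps power2_eq_square power4_eq_xxxx)
  also have "\<dots> = 2" unfolding kappa_power4 by simp
  finally have e2: "(kappa^3 - 3 * kappa)^2 = 2" .
  have sq: "(x * cc 0) * (x * cc 0) = x^2 * (cc 0)^2" for x by (simp add: power2_eq_square)
  show ?thesis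
    unfolding cls_def nn_def using eigenvector_coords e1 e2
    by (simp add: sq) (simp add: algebra_simps power2_eq_square)
qed

lemma half_vec_norm: "half_vec b \<bullet> half_vec b = nn"
proof -
  have "half_vec b \<bullet> half_vec b = (1 / sqrt N) * (\<Sum>i\<leftarrow>cls b. cc i * (sqrt N * cc i))"
    by (subst inner_half_vec) (simp add: half_vec_inner_root cls_def)
  also have "\<dots> = (\<Sum>i\<leftarrow>cls b. cc i * cc i)" using sqrt_N by (simp add: cls_def field_simps)
  finally show ?thesis by (simp add: half_norm)
qed

text \<open>The half-vectors enclose the angle pi - pi / 12, in accordance with \<lambda> and \<mu>
  enclosing pi / 12.\<close>

lemma half_vec_cross: "half_vec b \<bullet> half_vec (\<not> b) = - (kappa / 2) * nn"
proof -
  have "half_vec b \<bullet> half_vec (\<not> b) = (1 / sqrt N) * (\<Sum>i\<leftarrow>cls (\<not> b). cc i * (sqrt N * (- (kappa / 2) * cc i)))"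
    by (subst inner_half_vec) (simp add: half_vec_inner_root cls_def)
  also have "\<dots> = - (kappa / 2) * (\<Sum>i\<leftarrow>cls (\<not> b). cc i * cc i)"
    using sqrt_N by (simp add: cls_def field_simps)
  finally show ?thesis by (simp add: half_norm)
qed

text \<open>The geometric dependence on signs is confined to this flag: exchanging the signs
  exchanges \<lambda> and \<mu>, that is, reflects the plane.\<close>

definition plus :: bool where
  "plus \<longleftrightarrow> \<epsilon>\<^sub>0 = Plus"

lemma sg_plus: "sg plus = Plus" "sg (\<not> plus) = Minus"
proof -
  have "\<epsilon>\<^sub>0 = Plus \<or> \<epsilon>\<^sub>0 = Minus" by (cases \<epsilon>\<^sub>0) simp_all
  then show "sg plus = Plus" "sg (\<not> plus) = Minus" by (auto simp: sg_def plus_def)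
qed

text \<open>\<lambda> is orthogonal to the half-vector q of S_-, and Gram-Schmidt turns \<mu> into q
  itself. So the second coordinate is a product with q, and the first one a combination of both
  products.\<close>

lemma plane_proj_half:
  "plane_proj S c x = Complex (2 * kappa * (x \<bullet> half_vec plus + (kappa / 2) * (x \<bullet> half_vec (\<not> plus))) / sqrt nn)
     (x \<bullet> half_vec (\<not> plus) / sqrt nn)"
proof -
  define P where "P = plane_vec S c Plus"
  define M where "M = plane_vec S c Minus"
  define p where "p = half_vec plus"
  define q where "q = half_vec (\<not> plus)"
  have P: "P = (4 * kappa^2) *\<^sub>R (p + (kappa / 2) *\<^sub>R q)" and M: "M = (4 * kappa^2) *\<^sub>R (q + (kappa / 2) *\<^sub>R p)"
    using plane_vec_eq[of plus] plane_vec_eq[of "\<not> plus"] by (simp_all add: sg_plus P_def M_def p_def q_def)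
  have ip: "p \<bullet> p = nn" "q \<bullet> q = nn" "p \<bullet> q = - (kappa / 2) * nn" "q \<bullet> p = - (kappa / 2) * nn"
    using half_vec_norm half_vec_cross[of plus] half_vec_cross[of "\<not> plus"] by (simp_all add: p_def q_def)
  have k1: "4 * kappa^2 * (1 - kappa^2 / 4) = 1"
    using kappa_power4 by (simp add: algebra_simps power2_eq_square power4_eq_xxxx)
  have Pp: "P \<bullet> p = nn" "P \<bullet> q = 0" "M \<bullet> p = 0"
  proof -
    have "P \<bullet> p = 4 * kappa^2 * (1 - kappa^2 / 4) * nn"
      by (simp add: P inner_add_left ip) (simp add: algebra_simps power2_eq_square)
    then show "P \<bullet> p = nn" using k1 by simp
  qed (simp_all add: P M inner_add_left ip)
  have MQ: "M \<bullet> q = nn"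
  proof -
    have "M \<bullet> q = 4 * kappa^2 * (1 - kappa^2 / 4) * nn"
      by (simp add: M inner_add_left ip) (simp add: algebra_simps power2_eq_square)
    then show ?thesis using k1 by simp
  qed
  have PP: "P \<bullet> P = 4 * kappa^2 * nn"
    by (subst (2) P) (simp add: inner_add_right Pp)
  have MP: "M \<bullet> P = 4 * kappa^2 * (kappa / 2 * nn)"
    by (subst P) (simp add: inner_add_right Pp MQ)
  have norm: "norm P = 2 * kappa * sqrt nn" "norm q = sqrt nn"
  proof -
    have "4 * kappa^2 * nn = (2 * kappa)^2 * nn" by (simp add: power_mult_distrib)
    then have "norm P = \<bar>2 * kappa\<bar> * sqrt nn"
      by (simp only: norm_eq_sqrt_inner PP real_sqrt_mult real_sqrt_abs)
    then show "norm P = 2 * kappa * sqrt nn" using kappa_pos by simp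
  qed (simp add: norm_eq_sqrt_inner ip)
  have e1: "sgn P = (1 / (2 * kappa * sqrt nn)) *\<^sub>R P"
    by (simp only: sgn_div_norm norm(1) inverse_eq_divide)
  have "(M \<bullet> sgn P) *\<^sub>R sgn P = ((M \<bullet> P) / (norm P)^2) *\<^sub>R P"
    by (simp add: sgn_div_norm divide_inverse power2_eq_square mult_ac)
  also have "(norm P)^2 = P \<bullet> P" by (rule power2_norm_eq_inner)
  finally have "(M \<bullet> sgn P) *\<^sub>R sgn P = ((M \<bullet> P) / (P \<bullet> P)) *\<^sub>R P" .
  also have "\<dots> = (kappa / 2) *\<^sub>R P"
    using nn_pos kappa_pos by (simp add: PP MP)
  finally have Pp: "(M \<bullet> sgn P) *\<^sub>R sgn P = (kappa / 2) *\<^sub>R P" .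
  have "M - (kappa / 2) *\<^sub>R P = (4 * kappa^2 * (1 - kappa^2 / 4)) *\<^sub>R q"
    by (simp add: P M algebra_simps power2_eq_square)
  then have Mq: "M - (M \<bullet> sgn P) *\<^sub>R sgn P = q" unfolding Pp k1 by simp
  have e2: "sgn (M - (M \<bullet> sgn P) *\<^sub>R sgn P) = (1 / sqrt nn) *\<^sub>R q"
    unfolding Mq by (simp only: sgn_div_norm norm(2) inverse_eq_divide)
  have kk: "4 * kappa^2 / (2 * kappa) = 2 * kappa" using kappa_pos by (simp add: power2_eq_square)
  have "x \<bullet> sgn P = 4 * kappa^2 / (2 * kappa) * (x \<bullet> p + (kappa / 2) * (x \<bullet> q)) / sqrt nn"
    unfolding e1 by (simp add: P inner_add_right)
  then show ?thesis
    unfolding plane_proj_def Let_def P_def[symmetric] M_def[symmetric] e2 kk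
    by (simp add: p_def q_def)
qed

text \<open>The radius of the inner circle. The 6 absorbs the factor 3 of the weights and the factor
  2 of \<open>sin_table\<close>.\<close>

definition r :: real where
  "r = 6 * (s * sqrt N * cc 0 / (2 * sqrt nn))"

lemma r_pos: "r > 0"
  using s_pos sqrt_N cc_pos[of 0] nn_pos by (simp add: r_def)

lemma weight_half_vec:
  assumes "length m = 6"
  shows "(s *\<^sub>R vec m) \<bullet> half_vec b / sqrt nn = r / 6 * kpoly (half_pairing b m)"
proof -
  have m: "m \<noteq> []" using assms by auto
  have e: "kpoly (half_pairing b m) = (\<Sum>i\<leftarrow>cls b. pairing i m * kpoly (eig_poly ! i))"
    using m by (cases b)
      (simp_all add: half_pairing_def cls_def kpoly_lin del: kpoly.simps klin.simps pairing.simps; simp)+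
  have "(s *\<^sub>R vec m) \<bullet> half_vec b =
      (1 / sqrt N) * (\<Sum>i\<leftarrow>cls b. (cc 0 * kpoly (eig_poly ! i)) * (s * (N / 2 * real_of_int (pairing i m))))"
    unfolding inner_half_vec using assms
    by (simp add: cls_def vec_inner cc_eig_poly[symmetric] del: pairing.simps kpoly.simps)
  also have "\<dots> = s * (N / sqrt N) * cc 0 / 2 * kpoly (half_pairing b m)"
    unfolding e by (simp add: cls_def algebra_simps add_divide_distrib del: pairing.simps kpoly.simps)
  finally have "(s *\<^sub>R vec m) \<bullet> half_vec b = s * sqrt N * cc 0 / 2 * kpoly (half_pairing b m)"
    unfolding sqrt_N .
  then show ?thesis unfolding r_def by (simp only: times_divide_eq_left times_divide_eq_right) (simp del: kpoly.simps)
qed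

lemma weight_proj:
  assumes "(m, t, k) \<in> set weight_codes"
  shows "plane_proj S c (s *\<^sub>R vec m) = rcis (r * ring_radius t) ((if plus then real k else 1 - real k) * pi / 12)"
proof -
  have len: "length m = 6" using weight_codes_range[OF assms] by simp
  define R where "R = r * ring_radius t"
  define A where "A b = (s *\<^sub>R vec m) \<bullet> half_vec b / sqrt nn" for b
  have A: "A False = R * sin (real k * pi / 12)" "A True = R * sin ((1 - real k) * pi / 12)"
    unfolding A_def weight_half_vec[OF len] half_pairing_sin[OF assms] R_def by simp_all
  have pp: "plane_proj S c (s *\<^sub>R vec m) = Complex (2 * kappa * (A plus + (kappa / 2) * A (\<not> plus))) (A (\<not> plus))"
  proof -
    have "2 * kappa * (u + (kappa / 2) * v) / w = 2 * kappa * (u / w + (kappa / 2) * (v / w))" for u v w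
      by (simp add: add_divide_distrib distrib_left)
    then show ?thesis unfolding plane_proj_half A_def by simp
  qed
  \<comment> \<open>sin (pi / 12 - y) + cos (pi / 12) sin y = sin (pi / 12) cos y, and
    \<open>sin_theta\<close> removes the remaining constant.\<close>
  have key: "2 * kappa * (R * sin (pi / 12 - y) + (kappa / 2) * (R * sin y)) = R * cos y" for y
  proof -
    have "2 * kappa * (R * sin (pi / 12 - y) + (kappa / 2) * (R * sin y)) = R * ((2 * kappa * sin (pi / 12)) * cos y)"
      by (simp add: sin_diff kappa_def algebra_simps)
    then show ?thesis by (simp add: sin_theta)
  qed
  show ?thesis
  proof (cases plus)
    case True
    define y where "y = real k * pi / 12"
    have "(1 - real k) * pi / 12 = pi / 12 - y" by (simp add: y_def algebra_simps diff_divide_distrib)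
    then have A': "A True = R * sin (pi / 12 - y)" "A False = R * sin y" by (simp_all only: A y_def)
    show ?thesis unfolding R_def[symmetric] pp using True
      by (simp add: rcis_def complex_eq_iff A' key y_def[symmetric] del: times_divide_eq_left times_divide_eq_right)
  next
    case False
    define y where "y = (1 - real k) * pi / 12"
    have "real k * pi / 12 = pi / 12 - y" by (simp add: y_def algebra_simps diff_divide_distrib)
    then have A': "A False = R * sin (pi / 12 - y)" "A True = R * sin y" by (simp_all only: A y_def)
    show ?thesis unfolding R_def[symmetric] pp using False
      by (simp add: rcis_def complex_eq_iff A' key y_def[symmetric] del: times_divide_eq_left times_divide_eq_right)
  qed
qed

section \<open>The projected weights and the enlarged rings\<close>

definition X :: "'a set" where
  "X = (\<lambda>m. s *\<^sub>R vec m) ` set W27"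

definition origin_weights :: "int list list" where
  "origin_weights = [[-2,0,-1,0,1,2],[1,0,-1,0,1,-1],[1,0,2,0,-2,-1]]"

text \<open>With exchanged signs index k is mirrored to 3 - k, the reflection that exchanges the
  lines L' at indices 1 and 2.\<close>

definition point_angle :: "nat \<Rightarrow> real" where
  "point_angle k = (if plus then real k else 3 - real k) * pi / 14"

definition pt :: "nat \<times> nat \<Rightarrow> 'a point" where
  "pt p = (case p of (t, k) \<Rightarrow> if t = 0 then Origin (s *\<^sub>R vec (origin_weights ! k))
     else Vertex (rcis (r * ring_radius t) (point_angle k)))"

definition weight_point :: "nat \<times> nat \<Rightarrow> nat \<times> nat" where
  "weight_point p = (case p of (t, k) \<Rightarrow> if t = 0 then (0, k) else (t, (if k \<le> 12 then k + 2 else k + 4) mod 28))"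

lemma hat_weight:
  assumes "(m, t, k) \<in> set weight_codes"
  shows "hat S c (s *\<^sub>R vec m) = pt (weight_point (t, k))"
proof (cases "t = 0")
  case True
  have "list_all (\<lambda>(m, t, k). t = 0 \<longrightarrow> m = origin_weights ! k) weight_codes"
    by (simp add: weight_codes_def origin_weights_def)
  then have "m = origin_weights ! k" using True assms unfolding list_all_iff by fastforce
  moreover have "plane_proj S c (s *\<^sub>R vec m) = 0"
    using weight_proj[OF assms] True by (simp add: ring_radius_def rcis_def)
  ultimately show ?thesis using True by (simp add: hat_def Let_def pt_def weight_point_def)
next
  case False
  have k: "1 \<le> k" "k \<le> 24" using weight_codes_range[OF assms] False by auto
  define R where "R = r * ring_radius t"
  have R: "R > 0" using False r_pos kappa_pos by (simp add: R_def ring_radius_def)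
  \<comment> \<open>The representative modulo 24, within the range prescribed by \<open>hat\<close>,
    of the mirrored index 1 - k.\<close>
  define k' where "k' = (if plus then k else if k = 1 then 24 else 25 - k)"
  have k': "1 \<le> k'" "k' \<le> 24" using k by (auto simp: k'_def)
  have per: "cis (y + 2 * pi) = cis y" for y by (simp add: complex_eq_iff)
  have "cis ((if plus then real k else 1 - real k) * pi / 12) = cis (real k' * pi / 12)"
  proof (cases plus)
    case False
    have e: "real k' * pi / 12 = (1 - real k) * pi / 12 + 2 * pi"
      using False k by (auto simp: k'_def of_nat_diff field_simps)
    show ?thesis by (simp only: False if_False e per)
  qed (simp add: k'_def)
  then have z: "plane_proj S c (s *\<^sub>R vec m) = rcis R (real k' * pi / real 12)"
    unfolding weight_proj[OF assms] R_def[symmetric] by (simp add: rcis_def)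
  have the: "(THE l::nat. 1 \<le> l \<and> l \<le> 2 * 12 \<and> rcis R (real k' * pi / real 12) = rcis R (real l * pi / real 12)) = k'"
  proof (rule the_equality)
    fix l :: nat
    assume "1 \<le> l \<and> l \<le> 2 * 12 \<and> rcis R (real k' * pi / real 12) = rcis R (real l * pi / real 12)"
    then show "l = k'" using k' R by (intro rcis_eq_iff_index[of R 12 l k']) auto
  qed (use k' in auto)
  have nz: "rcis R (real k' * pi / real 12) \<noteq> 0" using R by (simp add: rcis_def)
  have h: "hat S c (s *\<^sub>R vec m) = Vertex (rcis R (real (if k' \<le> 12 then k' + 2 else k' + 4) * pi / 14))"
    unfolding hat_def Let_def z coxeter_number_eq using nz the R by simp
  define l where "l = (if k \<le> 12 then k + 2 else k + 4)"
  have l: "l = l mod 28 + 28 * (l div 28)" "l div 28 \<le> 1" using k by (auto simp: l_def)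
  have "real (l mod 28 + 28 * (l div 28)) = real l" by (simp only: l(1)[symmetric])
  then have lr: "real l = real (l mod 28) + 28 * real (l div 28)"
    by (simp only: of_nat_add of_nat_mult of_nat_numeral)
  have "cis (real (if k' \<le> 12 then k' + 2 else k' + 4) * pi / 14) = cis (point_angle (l mod 28))"
  proof (cases plus)
    case True
    have "real l * pi / 14 = point_angle (l mod 28) + real (l div 28) * (2 * pi)"
      using True by (subst lr) (simp add: point_angle_def field_simps)
    moreover have "l div 28 = 0 \<or> l div 28 = 1" using l(2) by linarith
    ultimately have "cis (real l * pi / 14) = cis (point_angle (l mod 28))"
      using per by (metis mult_1 mult_zero_left add.right_neutral of_nat_0 of_nat_1)
    moreover have "(if k' \<le> 12 then k' + 2 else k' + 4) = l" using True by (simp add: k'_def l_def)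
    ultimately show ?thesis by (simp only:)
  next
    case False
    define l' where "l' = (if k' \<le> 12 then k' + 2 else k' + 4)"
    have "real l' = 31 - real l"
    proof -
      \<comment> \<open>31 is 3 modulo 28: the enlargement turns the mirroring k to 1 - k of the
        12-gons into l to 3 - l of the 14-gons.\<close>
      have "l' + l = 31" using False k by (auto simp: l'_def l_def k'_def)
      then show ?thesis by linarith
    qed
    then have "real l' * pi / 14 + real (l div 28) * (2 * pi) = point_angle (l mod 28) + 2 * pi"
    proof -
      assume "real l' = 31 - real l"
      then have e: "real l' = 31 - (real (l mod 28) + 28 * real (l div 28))" using lr by linarith
      show ?thesis unfolding e point_angle_def if_not_P[OF False] by (simp add: field_simps)
    qed
    moreover have "l div 28 = 0 \<or> l div 28 = 1" using l(2) by linarith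
    ultimately have "cis (real l' * pi / 14) = cis (point_angle (l mod 28))"
      using per by (metis mult_1 mult_zero_left add.right_neutral of_nat_0 of_nat_1)
    then show ?thesis by (simp add: l'_def)
  qed
  then show ?thesis using False
    unfolding h by (simp add: pt_def weight_point_def l_def R_def rcis_def)
qed

lemma ring_radii_eq: "ring_radii S c X = {r, kappa * r}"
proof -
  have cm: "cmod (plane_proj S c (s *\<^sub>R vec m)) = r * ring_radius t" if "(m, t, k) \<in> set weight_codes" for m t k
    using weight_proj[OF that] r_pos kappa_pos by (simp add: abs_mult ring_radius_def)
  have W: "set W27 = fst ` set weight_codes" using weight_codes_W27 by (metis set_map)
  have i: "([1,3,2,3,4,2], 1, 1) \<in> set weight_codes \<or> True" by simp
  have mem: "(W27 ! 4, 1, 1) \<in> set weight_codes" "(W27 ! 0, 2, 24) \<in> set weight_codes"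
    by (simp_all add: weight_codes_def W27_def)
  show ?thesis
  proof
    show "ring_radii S c X \<subseteq> {r, kappa * r}"
    proof
      fix q assume "q \<in> ring_radii S c X"
      then obtain m where q: "q > 0" "m \<in> set W27" "cmod (plane_proj S c (s *\<^sub>R vec m)) = q"
        by (auto simp: ring_radii_def X_def)
      then obtain t k where "(m, t, k) \<in> set weight_codes" unfolding W by auto
      then have "q = r * ring_radius t" "t < 3" using cm q weight_codes_range by blast+
      then show "q \<in> {r, kappa * r}" using q(1) by (auto simp: ring_radius_def split: if_splits)
    qed
    have "r \<in> ring_radii S c X" "kappa * r \<in> ring_radii S c X"
      using cm[OF mem(1)] cm[OF mem(2)] mem r_pos kappa_pos
      unfolding ring_radii_def X_def W by (force simp: ring_radius_def mult.commute)+
    then show "{r, kappa * r} \<subseteq> ring_radii S c X" by simp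
  qed
qed

end

section \<open>The diagrams as a finite table\<close>

type_synonym code_point = "nat \<times> nat"
type_synonym code_segment = "code_point \<times> code_point"

text \<open>Row \<open>i\<close> is the diagram of the root with coordinates \<open>apr ! i\<close>.  The code \<open>(t, k)\<close> stands for the
  point at angle \<open>k \<pi> / 14\<close> on the inner or outer ring if \<open>t = 1\<close> or \<open>t = 2\<close>, and for the origin point
  with label \<open>k\<close> if \<open>t = 0\<close>.\<close>

definition DG :: "code_segment list list" where
  "DG = [
    [((0,0),(1,23)), ((0,1),(1,9)), ((1,11),(2,10)), ((1,13),(1,19)), ((1,21),(2,22)), ((2,0),(2,4))],
    [((1,3),(2,6)), ((1,5),(1,25)), ((1,11),(1,19)), ((1,13),(2,10)), ((1,17),(2,20)), ((1,27),(2,24))],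
    [((0,1),(2,8)), ((0,2),(2,22)), ((1,7),(1,23)), ((1,13),(2,20)), ((1,17),(2,10)), ((2,4),(2,26))],
    [((1,7),(2,24)), ((1,11),(2,22)), ((1,21),(2,10)), ((1,25),(2,8)), ((2,6),(2,26)), ((2,12),(2,20))],
    [((0,1),(2,22)), ((0,2),(2,8)), ((1,3),(2,24)), ((1,9),(1,21)), ((1,27),(2,6)), ((2,12),(2,18))],
    [((0,0),(1,9)), ((0,1),(1,23)), ((1,5),(1,27)), ((1,7),(2,8)), ((1,25),(2,24)), ((2,14),(2,18))],
    [((0,0),(1,21)), ((0,1),(1,7)), ((1,9),(2,8)), ((1,11),(1,17)), ((1,19),(2,20)), ((2,2),(2,26))],
    [((1,1),(2,26)), ((1,5),(2,8)), ((1,7),(1,27)), ((1,13),(1,21)), ((1,15),(2,12)), ((1,19),(2,22))],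
    [((0,1),(2,10)), ((0,2),(2,24)), ((1,9),(1,25)), ((1,15),(2,22)), ((1,19),(2,12)), ((2,0),(2,6))],
    [((1,5),(2,22)), ((1,9),(2,20)), ((1,19),(2,8)), ((1,23),(2,6)), ((2,4),(2,24)), ((2,10),(2,18))],
    [((0,1),(2,24)), ((0,2),(2,10)), ((1,1),(2,8)), ((1,5),(2,26)), ((1,11),(1,23)), ((2,14),(2,20))],
    [((0,0),(1,7)), ((0,1),(1,21)), ((1,3),(1,25)), ((1,5),(2,6)), ((1,23),(2,22)), ((2,12),(2,16))],
    [((0,0),(1,11)), ((0,2),(1,25)), ((1,13),(2,12)), ((1,15),(1,21)), ((1,23),(2,24)), ((2,2),(2,6))],
    [((1,1),(2,4)), ((1,3),(1,23)), ((1,9),(1,17)), ((1,11),(2,8)), ((1,15),(2,18)), ((1,25),(2,22))],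
    [((0,0),(2,20)), ((0,2),(2,6)), ((1,5),(1,21)), ((1,11),(2,18)), ((1,15),(2,8)), ((2,2),(2,24))],
    [((1,9),(2,26)), ((1,13),(2,24)), ((1,23),(2,12)), ((1,27),(2,10)), ((2,0),(2,8)), ((2,14),(2,22))],
    [((0,0),(2,6)), ((0,2),(2,20)), ((1,1),(2,22)), ((1,7),(1,19)), ((1,25),(2,4)), ((2,10),(2,16))],
    [((0,0),(1,25)), ((0,2),(1,11)), ((1,1),(1,7)), ((1,9),(2,10)), ((1,27),(2,26)), ((2,16),(2,20))],
    [((0,1),(1,19)), ((0,2),(1,5)), ((1,7),(2,6)), ((1,9),(1,15)), ((1,17),(2,18)), ((2,0),(2,24))],
    [((1,1),(1,9)), ((1,3),(2,0)), ((1,7),(2,10)), ((1,15),(1,23)), ((1,17),(2,14)), ((1,21),(2,24))],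
    [((0,0),(2,12)), ((0,1),(2,26)), ((1,11),(1,27)), ((1,17),(2,24)), ((1,21),(2,14)), ((2,2),(2,8))],
    [((1,3),(2,20)), ((1,7),(2,18)), ((1,17),(2,6)), ((1,21),(2,4)), ((2,2),(2,22)), ((2,8),(2,16))],
    [((0,0),(2,26)), ((0,1),(2,12)), ((1,3),(2,10)), ((1,7),(2,0)), ((1,13),(1,25)), ((2,16),(2,22))],
    [((0,1),(1,5)), ((0,2),(1,19)), ((1,1),(1,23)), ((1,3),(2,4)), ((1,21),(2,20)), ((2,10),(2,14))],
    [((0,1),(1,27)), ((0,2),(1,13)), ((1,15),(2,14)), ((1,17),(1,23)), ((1,25),(2,26)), ((2,4),(2,8))],
    [((1,1),(1,21)), ((1,7),(1,15)), ((1,9),(2,6)), ((1,13),(2,16)), ((1,23),(2,20)), ((1,27),(2,2))],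
    [((0,0),(2,4)), ((0,1),(2,18)), ((1,3),(1,19)), ((1,9),(2,16)), ((1,13),(2,6)), ((2,0),(2,22))],
    [((1,1),(2,12)), ((1,11),(2,0)), ((1,15),(2,26)), ((1,25),(2,14)), ((2,2),(2,10)), ((2,16),(2,24))],
    [((0,0),(2,18)), ((0,1),(2,4)), ((1,5),(1,17)), ((1,23),(2,2)), ((1,27),(2,20)), ((2,8),(2,14))],
    [((0,1),(1,13)), ((0,2),(1,27)), ((1,1),(2,0)), ((1,3),(1,9)), ((1,11),(2,12)), ((2,18),(2,22))],
    [((0,0),(1,3)), ((0,2),(1,17)), ((1,5),(2,4)), ((1,7),(1,13)), ((1,15),(2,16)), ((2,22),(2,26))],
    [((1,3),(1,11)), ((1,5),(2,2)), ((1,9),(2,12)), ((1,17),(1,25)), ((1,19),(2,16)), ((1,23),(2,26))],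
    [((0,0),(2,0)), ((0,2),(2,14)), ((1,1),(1,13)), ((1,19),(2,26)), ((1,23),(2,16)), ((2,4),(2,10))],
    [((1,1),(2,18)), ((1,5),(2,16)), ((1,15),(2,4)), ((1,19),(2,2)), ((2,0),(2,20)), ((2,6),(2,14))],
    [((0,0),(2,14)), ((0,2),(2,0)), ((1,5),(2,12)), ((1,9),(2,2)), ((1,15),(1,27)), ((2,18),(2,24))],
    [((0,0),(1,17)), ((0,2),(1,3)), ((1,1),(2,2)), ((1,19),(2,18)), ((1,21),(1,27)), ((2,8),(2,12))],
    [((0,0),(1,1)), ((0,1),(1,15)), ((1,17),(2,16)), ((1,19),(1,25)), ((1,27),(2,0)), ((2,6),(2,10))],
    [((1,5),(1,13)), ((1,7),(2,4)), ((1,11),(2,14)), ((1,19),(1,27)), ((1,21),(2,18)), ((1,25),(2,0))],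
    [((0,1),(2,2)), ((0,2),(2,16)), ((1,1),(1,17)), ((1,7),(2,14)), ((1,11),(2,4)), ((2,20),(2,26))],
    [((1,3),(2,14)), ((1,13),(2,2)), ((1,17),(2,0)), ((1,27),(2,16)), ((2,4),(2,12)), ((2,18),(2,26))],
    [((0,1),(2,16)), ((0,2),(2,2)), ((1,3),(1,15)), ((1,21),(2,0)), ((1,25),(2,18)), ((2,6),(2,12))],
    [((0,0),(1,15)), ((0,1),(1,1)), ((1,3),(2,2)), ((1,5),(1,11)), ((1,13),(2,14)), ((2,20),(2,24))]]"

fun norm_seg :: "code_segment \<Rightarrow> code_segment" where
  "norm_seg ((t, k), (u, l)) = (if t < u \<or> t = u \<and> k \<le> l then ((t, k), (u, l)) else ((u, l), (t, k)))"

text \<open>The action of \<open>half b\<close> on the three weights that project to the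
  origin.\<close>

definition label_perm :: "bool \<Rightarrow> nat list" where
  "label_perm b = (if b then [1,0,2] else [0,2,1])"

text \<open>Reflection in the line at index 1 or 2 takes k to 2 - k or 4 - k; the additional 28
  keeps the subtraction within the natural numbers.\<close>

fun tau_code :: "bool \<Rightarrow> code_point \<Rightarrow> code_point" where
  "tau_code b (t, k) = (if t = 0 then (0, label_perm b ! k) else (t, ((if b then 30 else 32) - k) mod 28))"

text \<open>Seven steps are a right angle, so 8 and 9 modulo 14 are the directions perpendicular to
  the lines at 1 and 2; radial segments in these directions are fixed.\<close>

fun tau_code_seg :: "bool \<Rightarrow> code_segment \<Rightarrow> code_segment" where
  "tau_code_seg b ((t, k), (u, l)) =
     (if t = 0 \<and> u \<noteq> 0 \<and> l mod 14 = (if b then 8 else 9) then ((t, k), (u, l))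
      else norm_seg (tau_code b (t, k), tau_code b (u, l)))"

fun valid_code :: "code_point \<Rightarrow> bool" where
  "valid_code (t, k) \<longleftrightarrow> t < 3 \<and> (t = 0 \<longrightarrow> k < 3) \<and> k < 28"

fun valid_seg :: "code_segment \<Rightarrow> bool" where
  "valid_seg ((t, k), (u, l)) \<longleftrightarrow> valid_code (t, k) \<and> valid_code (u, l) \<and> u \<noteq> 0 \<and> t \<le> u \<and> (t, k) \<noteq> (u, l)"

lemma DG_valid: "list_all (list_all valid_seg) DG" "length DG = 42"
  by (simp_all add: DG_def)

lemma valid_DG: "i < 42 \<Longrightarrow> T \<in> set (DG ! i) \<Longrightarrow> valid_seg T"
proof -
  assume "i < 42" "T \<in> set (DG ! i)"
  moreover from this have "DG ! i \<in> set DG" using DG_valid(2) by simp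
  ultimately show ?thesis using DG_valid(1) unfolding list_all_iff by blast
qed

lemma DG_tau_True:
  "list_all (\<lambda>i. list_all (\<lambda>T. T \<in> set (DG ! (tau_table True ! i))) (map (tau_code_seg True) (DG ! i))) [0..<42]"
  "list_all (\<lambda>i. map (tau_code_seg True) (map (tau_code_seg True) (DG ! i)) = DG ! i) [0..<42]"
  by code_simp+

lemma DG_tau_False:
  "list_all (\<lambda>i. list_all (\<lambda>T. T \<in> set (DG ! (tau_table False ! i))) (map (tau_code_seg False) (DG ! i))) [0..<42]"
  "list_all (\<lambda>i. map (tau_code_seg False) (map (tau_code_seg False) (DG ! i)) = DG ! i) [0..<42]"
  by code_simp+

text \<open>An inclusion and the involution property are evaluated on codes; together they give
  equality of the sets of segments.\<close>

lemma DG_tau: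
  assumes "i < 42"
  shows "tau_code_seg b ` set (DG ! i) = set (DG ! (tau_table b ! i))"
proof -
  have *: "tau_code_seg b T \<in> set (DG ! (tau_table b ! i)) \<and> tau_code_seg b (tau_code_seg b T) = T"
    if "i < 42" "T \<in> set (DG ! i)" for i T
  proof -
    have i: "i \<in> set [0..<42]" using that by simp
    have "list_all (\<lambda>T. T \<in> set (DG ! (tau_table b ! i))) (map (tau_code_seg b) (DG ! i))"
      using DG_tau_True(1)[unfolded list_all_iff[of _ "[0..<42]"], THEN bspec, OF i]
        DG_tau_False(1)[unfolded list_all_iff[of _ "[0..<42]"], THEN bspec, OF i] by (cases b) simp_all
    moreover have "map (tau_code_seg b) (map (tau_code_seg b) (DG ! i)) = DG ! i"
      using DG_tau_True(2)[unfolded list_all_iff[of _ "[0..<42]"], THEN bspec, OF i]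
        DG_tau_False(2)[unfolded list_all_iff[of _ "[0..<42]"], THEN bspec, OF i] by (cases b) simp_all
    then have "tau_code_seg b (tau_code_seg b T) = T"
      using that(2) unfolding map_map by (metis comp_apply map_eq_conv map_ident)
    ultimately show ?thesis using that(2) by (simp add: list_all_iff)
  qed
  show ?thesis
  proof
    show "tau_code_seg b ` set (DG ! i) \<subseteq> set (DG ! (tau_table b ! i))" using *[OF assms] by blast
    show "set (DG ! (tau_table b ! i)) \<subseteq> tau_code_seg b ` set (DG ! i)"
    proof
      fix T assume T: "T \<in> set (DG ! (tau_table b ! i))"
      then have "tau_code_seg b T \<in> set (DG ! i)" "T = tau_code_seg b (tau_code_seg b T)"
        using *[OF tau_table_bound[OF assms] T] tau_table_involution[OF assms] by simp_all
      then show "T \<in> tau_code_seg b ` set (DG ! i)" by blast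
    qed
  qed
qed

definition code_of_weight :: "int list \<Rightarrow> code_point" where
  "code_of_weight m = (case the (map_of weight_codes m) of (t, k) \<Rightarrow> if t = 0 then (0, k) else
     (t, (if k \<le> 12 then k + 2 else k + 4) mod 28))"

text \<open>Recomputes the first six rows of \<open>DG\<close> from the weights. Each segment arises
  twice, once from either endpoint, and \<open>norm_seg\<close> makes the two copies equal.\<close>

definition simple_segments :: "nat \<Rightarrow> code_segment list" where
  "simple_segments i = concat (map (\<lambda>(m, _). if m = [] then [] else if refl_coords i m = m then [] else
     [norm_seg (code_of_weight m, code_of_weight (refl_coords i m))]) weight_codes)"

lemma DG_simple:
  assumes "i < 6"
  shows "set (simple_segments i) = set (DG ! i)"
proof -
  have "list_all (\<lambda>i. list_all (\<lambda>T. T \<in> set (DG ! i)) (simple_segments i) \<and>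
      list_all (\<lambda>T. T \<in> set (simple_segments i)) (DG ! i)) [0,1,2,3,4,5]"
    by code_simp
  from list_all6[OF this assms] show ?thesis unfolding list_all_iff by blast
qed

context E6_diagram
begin

definition seg :: "code_segment \<Rightarrow> 'a segment" where
  "seg T = {pt (fst T), pt (snd T)}"

lemma origin_weights_half:
  "k < 3 \<Longrightarrow> half b (origin_weights ! k) = origin_weights ! (label_perm b ! k)"
  "k < 3 \<Longrightarrow> length (origin_weights ! k) = 6"
proof -
  assume "k < 3"
  then have k: "k = 0 \<or> k = 1 \<or> k = 2" by linarith
  show "half b (origin_weights ! k) = origin_weights ! (label_perm b ! k)"
    using k by (cases b) (auto simp: origin_weights_def label_perm_def half_def cls_def cartan_def)
  show "length (origin_weights ! k) = 6"
    using k by (auto simp: origin_weights_def)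
qed

lemma cis_period: "cis (y + 2 * pi * of_int n) = cis y"
  using sin_cos_eq_iff[of "y + 2 * pi * of_int n" y] by (simp add: complex_eq_iff)

lemma cis_point_angle_mod: "cis (point_angle (n mod 28)) = cis (point_angle n)"
proof -
  have "real (n mod 28 + 28 * (n div 28)) = real n" by (simp only: mod_mult_div_eq)
  then have n: "real n = real (n mod 28) + 28 * real (n div 28)"
    by (simp only: of_nat_add of_nat_mult of_nat_numeral)
  show ?thesis
  proof (cases plus)
    case True
    have "point_angle n = point_angle (n mod 28) + 2 * pi * of_int (int (n div 28))"
      using True by (subst (1) point_angle_def, subst n) (simp add: point_angle_def field_simps)
    then show ?thesis by (simp only: cis_period)
  next
    case False
    have "point_angle n = point_angle (n mod 28) + 2 * pi * of_int (- int (n div 28))"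
      using False by (subst (1) point_angle_def, subst n) (simp add: point_angle_def field_simps)
    then show ?thesis by (simp only: cis_period)
  qed
qed

lemma mirror_sg: "mirror_dir n (sg b) = cis ((if b = plus then 1 else 2) * pi / real n)"
proof -
  have "sg b = (if b = plus then Plus else Minus)" using sg_plus by (cases b; cases plus) auto
  then show ?thesis by (simp add: mirror_dir_def)
qed

lemma tau_pt:
  assumes "valid_code p"
  shows "tau_point S (sg b) (pt p) = pt (tau_code b p)"
proof -
  obtain t k where p: "p = (t, k)" by (cases p)
  show ?thesis
  proof (cases "t = 0")
    case True
    then have k: "k < 3" using assms p by simp
    have "c_half S (sg b) (s *\<^sub>R vec (origin_weights ! k)) = s *\<^sub>R vec (half b (origin_weights ! k))"
      using linear_scale[OF linear_c_half] c_half_vec[OF origin_weights_half(2)[OF k]] by metis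
    then show ?thesis using True k p by (simp add: pt_def origin_weights_half)
  next
    case False
    then have k: "k < 28" using assms p by simp
    define M where "M = (if b = plus then 1 else 2 :: real)"
    have "cis (2 * (M * pi / 14) - point_angle k) = cis (point_angle ((if b then 30 else 32) - k))"
    proof -
      have r: "real (30 - k) = 30 - real k" "real (32 - k) = 32 - real k" using k by simp_all
      \<comment> \<open>The full turn that \<open>tau_code\<close> adds, in the orientation of
        \<open>point_angle\<close>.\<close>
      define n :: int where "n = (if plus then - 1 else 1)"
      have "2 * (M * pi / 14) - point_angle k = point_angle ((if b then 30 else 32) - k) + 2 * pi * of_int n"
        by (cases b; cases plus) (simp_all add: M_def n_def point_angle_def r field_simps)
      then show ?thesis by (simp only: cis_period)
    qed
    then have "cis (2 * (M * pi / 14) - point_angle k) = cis (point_angle (((if b then 30 else 32) - k) mod 28))"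
      by (simp only: cis_point_angle_mod)
    moreover have "(cis x)\<^sup>2 * cnj (rcis R y) = rcis R z" if "cis (2 * x - y) = cis z" for R x y z
    proof -
      have "(cis x)\<^sup>2 * cnj (rcis R y) = of_real R * ((cis x)\<^sup>2 * cis (- y))"
        by (simp add: rcis_def cis_cnj)
      also have "(cis x)\<^sup>2 * cis (- y) = cis (2 * x - y)" by (simp only: power2_eq_square cis_mult) (simp add: algebra_simps)
      finally show ?thesis using that by (simp add: rcis_def)
    qed
    ultimately have V: "(mirror_dir 14 (sg b))\<^sup>2 * cnj (rcis R (point_angle k)) =
        rcis R (point_angle (((if b then 30 else 32) - k) mod 28))" for R
      unfolding mirror_sg M_def[symmetric] by simp
    show ?thesis using False V[of "r * ring_radius t"] unfolding p pt_def by (cases b) (simp_all add: coxeter_number_eq)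
  qed
qed

text \<open>The product is a multiple of the cosine of l - 1 or l - 2 steps of pi / 14, which
  vanishes exactly at odd multiples of seven steps.\<close>

lemma perp_iff:
  assumes "t \<noteq> 0"
  shows "rcis (r * ring_radius t) (point_angle l) \<bullet> mirror_dir 14 (sg b) = 0 \<longleftrightarrow> l mod 14 = (if b then 8 else 9)"
proof -
  define M where "M = (if b = plus then 1 else 2 :: real)"
  define M' where "M' = (if b then 1 else 2 :: int)"
  have R: "r * ring_radius t \<noteq> 0" using assms r_pos kappa_pos by (simp add: ring_radius_def)
  have "rcis (r * ring_radius t) (point_angle l) \<bullet> mirror_dir 14 (sg b) =
      r * ring_radius t * cos (point_angle l - M * pi / 14)"
    by (simp add: mirror_sg M_def[symmetric] inner_complex_def rcis_def cos_diff algebra_simps)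
  also have "cos (point_angle l - M * pi / 14) = cos (of_int (int l - M') * pi / 14)"
  proof (cases plus)
    case True
    then have "point_angle l - M * pi / 14 = of_int (int l - M') * pi / 14"
      by (simp add: point_angle_def M_def M'_def field_simps)
    then show ?thesis by (simp only:)
  next
    case False
    then have "point_angle l - M * pi / 14 = - (of_int (int l - M') * pi / 14)"
      by (simp add: point_angle_def M_def M'_def field_simps)
    then show ?thesis by (simp only: cos_minus)
  qed
  finally have "rcis (r * ring_radius t) (point_angle l) \<bullet> mirror_dir 14 (sg b) = 0 \<longleftrightarrow>
      cos (of_int (int l - M') * pi / 14) = 0" using R by simp
  also have "\<dots> \<longleftrightarrow> (\<exists>i::int. odd i \<and> of_int (int l - M') * pi / 14 = of_int i * (pi / 2))"
    by (simp add: cos_zero_iff_int)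
  also have "\<dots> \<longleftrightarrow> (\<exists>i::int. odd i \<and> int l - M' = 7 * i)"
  proof -
    have "of_int (int l - M') * pi / 14 = of_int i * (pi / 2) \<longleftrightarrow> int l - M' = 7 * i" for i :: int
    proof -
      have "of_int (int l - M') * pi / 14 = of_int i * (pi / 2) \<longleftrightarrow> of_int (int l - M') * pi = (of_int (7 * i) :: real) * pi"
      proof -
        have "x * pi / 14 = y * (pi / 2) \<longleftrightarrow> x * pi = (7 * y) * pi" for x y :: real
        proof
          assume e: "x * pi / 14 = y * (pi / 2)"
          have "x * pi = 14 * (x * pi / 14)" by simp
          also have "\<dots> = (7 * y) * pi" unfolding e by simp
          finally show "x * pi = (7 * y) * pi" .
        next
          assume "x * pi = (7 * y) * pi"
          then show "x * pi / 14 = y * (pi / 2)" by simp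
        qed
        then show ?thesis by (simp only: of_int_mult of_int_numeral)
      qed
      also have "\<dots> \<longleftrightarrow> (of_int (int l - M') :: real) = of_int (7 * i)" by simp
      finally show ?thesis by (simp only: of_int_eq_iff)
    qed
    then show ?thesis by simp
  qed
  also have "\<dots> \<longleftrightarrow> l mod 14 = (if b then 8 else 9)"
    by (cases b) (simp_all add: M'_def, presburger+)
  finally show ?thesis .
qed

lemma seg_norm: "seg (norm_seg (p, q)) = {pt p, pt q}"
  by (cases p; cases q) (auto simp: seg_def)

lemma tau_seg:
  assumes "valid_seg T"
  shows "tau_segment S (sg b) (seg T) = seg (tau_code_seg b T)"
proof -
  obtain t k u l where T: "T = ((t, k), (u, l))" by (metis surj_pair)
  have v: "valid_code (t, k)" "valid_code (u, l)" "u \<noteq> 0" using assms T by auto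
  have u: "pt (u, l) = Vertex (rcis (r * ring_radius u) (point_angle l))" using v by (simp add: pt_def)
  have "(\<exists>x z. seg T = {Origin x, Vertex z} \<and> z \<bullet> mirror_dir (coxeter_number S + 2) (sg b) = 0) \<longleftrightarrow>
      t = 0 \<and> l mod 14 = (if b then 8 else 9)"
  proof (cases "t = 0")
    case True
    have "seg T = {Origin (s *\<^sub>R vec (origin_weights ! k)), Vertex (rcis (r * ring_radius u) (point_angle l))}"
      using True T u by (simp add: seg_def pt_def)
    then show ?thesis using True perp_iff[OF v(3), of l b]
      by (auto simp: coxeter_number_eq doubleton_eq_iff simp del: split_paired_Ex)
  next
    case False
    then have "pt (t, k) = Vertex (rcis (r * ring_radius t) (point_angle k))" by (simp add: pt_def)
    then show ?thesis using False T u by (auto simp: seg_def doubleton_eq_iff)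
  qed
  then show ?thesis
    using v tau_pt[OF v(1)] tau_pt[OF v(2)] seg_norm[of "tau_code b (t, k)" "tau_code b (u, l)"]
    unfolding tau_segment_def T by (auto simp: seg_def)
qed

lemma code_of_weight:
  assumes "m \<in> set W27"
  shows "hat S c (s *\<^sub>R vec m) = pt (code_of_weight m)"
proof -
  obtain t k where tk: "(m, t, k) \<in> set weight_codes" using assms weight_codes_W27
    by (metis (no_types, lifting) imageE list.set_map prod.collapse)
  have "distinct (map fst weight_codes)" by (simp add: weight_codes_def)
  then have "map_of weight_codes m = Some (t, k)" using tk by simp
  then show ?thesis using hat_weight[OF tk] by (simp add: code_of_weight_def weight_point_def)
qed

lemma neg_simple_diagram_eq:
  assumes i: "i < 6"
  shows "neg_simple_diagram S c X (a i) = seg ` set (DG ! i)"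
proof -
  have W: "length m = 6" "refl_coords i m \<in> set W27" if "m \<in> set W27" for m
    using closed_lists(1) that i list_all6[of "\<lambda>i. refl_coords i m \<in> set W27" i]
    unfolding reflection_closed_def list_all_iff by (metis (no_types, lifting))+
  have ref: "reflect (a i) (s *\<^sub>R vec m) = s *\<^sub>R vec (refl_coords i m)" if "m \<in> set W27" for m
    using that W i by (simp add: linear_scale[OF linear_reflect] reflect_vec del: refl_coords.simps)
  have ne: "reflect (a i) (s *\<^sub>R vec m) \<noteq> s *\<^sub>R vec m \<longleftrightarrow> refl_coords i m \<noteq> m" if "m \<in> set W27" for m
    using ref[OF that] vec_eq_iff[of "refl_coords i m" m] W[OF that] s_pos
    by (simp del: refl_coords.simps)
  have "neg_simple_diagram S c X (a i) =
      (\<lambda>m. {hat S c (s *\<^sub>R vec m), hat S c (reflect (a i) (s *\<^sub>R vec m))}) ` {m \<in> set W27. refl_coords i m \<noteq> m}"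
    unfolding neg_simple_diagram_def X_def using ne by blast
  also have "\<dots> = (\<lambda>m. seg (norm_seg (code_of_weight m, code_of_weight (refl_coords i m)))) ` {m \<in> set W27. refl_coords i m \<noteq> m}"
    by (intro image_cong refl) (simp add: ref code_of_weight W seg_norm del: refl_coords.simps norm_seg.simps)
  also have "\<dots> = seg ` set (simple_segments i)"
  proof -
    have "set (simple_segments i) = (\<lambda>m. norm_seg (code_of_weight m, code_of_weight (refl_coords i m))) ` {m \<in> set W27. refl_coords i m \<noteq> m}"
    proof -
      define F where "F m = norm_seg (code_of_weight m, code_of_weight (refl_coords i m))" for m
      have nz: "m \<noteq> []" if "(m, p) \<in> set weight_codes" for m p
        using weight_codes_range[of m "fst p" "snd p"] that by auto
      have "set (simple_segments i) = (\<Union>(m, p)\<in>set weight_codes. if refl_coords i m = m then {} else {F m})"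
        unfolding simple_segments_def F_def[symmetric] set_concat set_map image_image
        by (intro SUP_cong refl) (auto split: prod.splits dest: nz simp del: refl_coords.simps)
      also have "\<dots> = F ` {m \<in> fst ` set weight_codes. refl_coords i m \<noteq> m}"
        by (force simp del: refl_coords.simps split: if_splits)
      also have "fst ` set weight_codes = set W27" using weight_codes_W27 by (metis set_map)
      finally show ?thesis unfolding F_def .
    qed
    then show ?thesis by (simp add: image_image)
  qed
  finally show ?thesis using DG_simple[OF i] by simp
qed

text \<open>As for compatibility: the family D0 taken from \<open>DG\<close> satisfies the
  description, and any other solution agrees with it by \<open>apr_index_induct\<close>.\<close>

theorem diagram_eq:
  assumes "i < 42"
  shows "diagram \<Phi> S c X (vec (apr ! i)) = seg ` set (DG ! i)"
proof -
  define A where "A = almost_positive_roots \<Phi> (simples S)"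
  define v where "v i = vec (apr ! i)" for i
  have A: "A = v ` {..<42}" by (simp add: A_def v_def almost_positive_roots_eq)
  define Q where "Q D \<longleftrightarrow> (\<forall>b. b \<notin> A \<longrightarrow> D b = {}) \<and>
        (\<forall>a\<in>simples S. D (- a) = neg_simple_diagram S c X a) \<and>
        (\<forall>\<epsilon>. \<forall>b\<in>A. D (tau S \<epsilon> b) = tau_segment S \<epsilon> ` D b)" for D
  define D0 where "D0 x = (if x \<in> A then seg ` set (DG ! (THE i. i < 42 \<and> x = v i)) else {})" for x
  have vinj: "v i = v j \<longleftrightarrow> i = j" if "i < 42" "j < 42" for i j
    using that by (simp add: v_def vec_apr_inj)
  have D0: "D0 (v i) = seg ` set (DG ! i)" if "i < 42" for i
  proof -
    have "(THE j. j < 42 \<and> v i = v j) = i" using that vinj by (intro the_equality) auto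
    then show ?thesis using that by (simp add: D0_def A)
  qed
  have tv: "tau S (sg b) (v i) = v (tau_table b ! i)" if "i < 42" for b i
    using that by (simp add: v_def tau_apr)
  have vneg: "- a k = v k" if "k < 6" for k using vec_apr_neg[OF that] by (simp add: v_def)
  have "Q D0"
    unfolding Q_def
  proof (intro conjI allI ballI impI)
    fix x assume "x \<in> simples S"
    then obtain k where "k < 6" "x = a k" by (auto simp: simples_S)
    then show "D0 (- x) = neg_simple_diagram S c X x"
      by (simp add: vneg D0 neg_simple_diagram_eq)
  next
    fix \<epsilon> x assume "x \<in> A"
    then obtain i where i: "i < 42" "x = v i" by (auto simp: A)
    obtain b where b: "\<epsilon> = sg b" using ex_sg by blast
    have "tau_segment S \<epsilon> ` D0 x = seg ` tau_code_seg b ` set (DG ! i)"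
      unfolding i D0[OF i(1)] b image_image using tau_seg valid_DG[OF i(1)] by (intro image_cong) auto
    then show "D0 (tau S \<epsilon> x) = tau_segment S \<epsilon> ` D0 x"
      unfolding DG_tau[OF i(1)] i b tv[OF i(1)] by (simp add: D0 tau_table_bound i)
  qed (simp add: D0_def)
  moreover have "D = D0" if "Q D" for D
  proof -
    have "D (v j) = D0 (v j)" if "j < 42" for j
      using that
    proof (induction j rule: apr_index_induct)
      case (neg k)
      have "a k \<in> simples S" using neg by (simp add: simples_S)
      then show ?case using \<open>Q D\<close> \<open>Q D0\<close> unfolding Q_def vneg[OF neg, symmetric] by blast
    next
      case (tau b j)
      then have "v j \<in> A" by (simp add: A)
      then have "D (tau S (sg b) (v j)) = D0 (tau S (sg b) (v j))"
        using \<open>Q D\<close> \<open>Q D0\<close> tau.IH unfolding Q_def by metis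
      then show ?case using tv[OF tau.hyps(1)] by simp
    qed
    then have "D x = D0 x" for x using \<open>Q D\<close> \<open>Q D0\<close> unfolding Q_def A by (cases "x \<in> v ` {..<42}") auto
    then show ?thesis by blast
  qed
  ultimately have "(THE D. Q D) = D0" by (intro the_equality)
  then have "diagram \<Phi> S c X = D0"
    unfolding diagram_def Let_def A_def[symmetric] Q_def by simp
  then show ?thesis using D0[OF assms] by (simp add: v_def)
qed

end

section \<open>Deciding crossings in integer arithmetic\<close>

text \<open>The standard picture, with inner radius 1 and S_+ as the half \<open>True\<close>. The
  geometry is done here and is carried to the actual diagram by the similarity \<open>iso\<close>
  below.\<close>

fun zst :: "code_point \<Rightarrow> complex" where
  "zst (t, k) = rcis (ring_radius t) (real k * pi / 14)"

text \<open>Twice the signed area of the triangle: its sign tells on which side of the line through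
  a and b the point z lies.\<close>

definition det3 :: "complex \<Rightarrow> complex \<Rightarrow> complex \<Rightarrow> real" where
  "det3 a b z = (Re b - Re a) * (Im z - Im a) - (Im b - Im a) * (Re z - Re a)"

lemma det3_affine: "det3 a b ((1 - u) *\<^sub>R p + u *\<^sub>R q) = (1 - u) * det3 a b p + u * det3 a b q"
  by (simp add: det3_def algebra_simps)

lemma det3_left: "det3 a b a = 0"
  by (simp add: det3_def)

lemma det3_right: "det3 a b b = 0"
  by (simp add: det3_def)

lemma det3_open_segment: "z \<in> open_segment a b \<Longrightarrow> det3 a b z = 0"
  by (auto simp: in_segment det3_affine det3_left det3_right)

lemma det3_open_segment_pos:
  assumes "z \<in> open_segment p q" "det3 a b p \<ge> 0" "det3 a b q \<ge> 0" "det3 a b p > 0 \<or> det3 a b q > 0"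
  shows "det3 a b z > 0"
proof -
  obtain u where "0 < u" "u < 1" "z = (1 - u) *\<^sub>R p + u *\<^sub>R q" using assms(1) by (auto simp: in_segment)
  then show ?thesis using assms(2-4)
    by (auto simp: det3_affine intro: add_pos_nonneg add_nonneg_pos)
qed

lemma det3_swap: "det3 b a z = - det3 a b z"
  by (simp add: det3_def algebra_simps)

lemma open_segments_disjoint:
  assumes "det3 a b p \<ge> 0" "det3 a b q \<ge> 0" "det3 a b p > 0 \<or> det3 a b q > 0"
  shows "open_segment a b \<inter> open_segment p q = {}"
  using det3_open_segment det3_open_segment_pos[OF _ assms] by force

text \<open>The parameters of the common point are quotients of determinants, and the identity
  \<open>rel\<close> gives both quotients the same denominator.\<close>

lemma open_segments_cross:
  assumes "det3 a b p * det3 a b q < 0" "det3 p q a * det3 p q b < 0"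
  shows "\<exists>z. z \<in> open_segment a b \<and> z \<in> open_segment p q"
proof -
  define f where "f = det3 a b"
  define g where "g = det3 p q"
  have fg: "f p \<noteq> 0" "f q \<noteq> 0" "f p - f q \<noteq> 0" "g a - g b \<noteq> 0"
    using assms by (auto simp: f_def g_def mult_less_0_iff)
  define u where "u = f p / (f p - f q)"
  define v where "v = g a / (g a - g b)"
  have u: "0 < u" "u < 1" using assms fg unfolding u_def f_def
    by (auto simp: field_simps mult_less_0_iff zero_less_divide_iff divide_less_eq)
  have v: "0 < v" "v < 1" using assms fg unfolding v_def g_def
    by (auto simp: field_simps mult_less_0_iff zero_less_divide_iff divide_less_eq)
  have rel: "g a - g b = f q - f p" by (simp add: f_def g_def det3_def algebra_simps)
  have "(1 - v) *\<^sub>R a + v *\<^sub>R b = (1 - u) *\<^sub>R p + u *\<^sub>R q"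
  proof -
    have d: "f q - f p \<noteq> 0" using fg by simp
    have u': "u = - f p / (f q - f p)" unfolding u_def by (metis minus_diff_eq minus_divide_divide minus_minus)
    have v': "v = g a / (f q - f p)" unfolding v_def rel ..
    have "(f q - f p) *\<^sub>R ((1 - v) *\<^sub>R a + v *\<^sub>R b) = (f q - f p) *\<^sub>R ((1 - u) *\<^sub>R p + u *\<^sub>R q)"
    proof -
      have "(f q - f p) * v = g a" "(f q - f p) * u = - f p" using d by (simp_all add: u' v')
      then have "(f q - f p) *\<^sub>R ((1 - v) *\<^sub>R a + v *\<^sub>R b) = (f q - f p - g a) *\<^sub>R a + g a *\<^sub>R b"
        "(f q - f p) *\<^sub>R ((1 - u) *\<^sub>R p + u *\<^sub>R q) = (f q - f p + f p) *\<^sub>R p + (- f p) *\<^sub>R q"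
        by (simp_all add: scaleR_add_right right_diff_distrib)
      then show ?thesis
        by (simp add: complex_eq_iff f_def g_def det3_def algebra_simps)
    qed
    then show ?thesis using d by simp
  qed
  moreover have "a \<noteq> b" "p \<noteq> q" using fg by auto
  ultimately show ?thesis using u v
    by (intro exI[of _ "(1 - v) *\<^sub>R a + v *\<^sub>R b"]) (auto simp: in_segment)
qed

text \<open>In the triangle a, c, w the line ab passes through a and separates c from w, while the
  line cd passes through c and separates a from w. Two such cevians meet inside the
  triangle.\<close>

lemma cevians_meet_inside:
  assumes f: "det3 a b c * det3 a b w < 0" and g: "det3 c d a * det3 c d w < 0"
    and z: "det3 a b z = 0" "z \<in> open_segment c d"
  shows "z \<in> convex hull {a, c, w}"
proof -
  have z': "det3 c d z = 0" using z(2) by (rule det3_open_segment)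
  \<comment> \<open>Barycentric weights, relative to weight 1 at w, of the point where both
    determinants vanish.\<close>
  define \<beta> where "\<beta> = - det3 a b w / det3 a b c"
  define \<alpha> where "\<alpha> = - det3 c d w / det3 c d a"
  have pos: "\<alpha> > 0" "\<beta> > 0" using f g by (auto simp: \<alpha>_def \<beta>_def mult_less_0_iff divide_less_0_iff)
  have nz: "det3 a b c \<noteq> 0" "det3 c d a \<noteq> 0" using f g by auto
  define T where "T = \<alpha> + \<beta> + 1"
  have T: "T > 0" using pos by (simp add: T_def)
  define y where "y = (\<alpha> / T) *\<^sub>R a + (\<beta> / T) *\<^sub>R c + (1 / T) *\<^sub>R w"
  have aff: "det3 p q y = (\<alpha> * det3 p q a + \<beta> * det3 p q c + det3 p q w) / T" for p q
  proof -
    have "T * Re y = \<alpha> * Re a + \<beta> * Re c + Re w" "T * Im y = \<alpha> * Im a + \<beta> * Im c + Im w"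
      using T by (simp_all add: y_def distrib_left)
    then have "T * det3 p q y = \<alpha> * det3 p q a + \<beta> * det3 p q c + det3 p q w"
    proof -
      assume h: "T * Re y = \<alpha> * Re a + \<beta> * Re c + Re w" "T * Im y = \<alpha> * Im a + \<beta> * Im c + Im w"
      have "T * det3 p q y = (Re q - Re p) * (T * Im y - T * Im p) - (Im q - Im p) * (T * Re y - T * Re p)"
        by (simp add: det3_def algebra_simps)
      also have "\<dots> = \<alpha> * det3 p q a + \<beta> * det3 p q c + det3 p q w"
        unfolding h by (simp add: det3_def T_def algebra_simps)
      finally show ?thesis .
    qed
    then show ?thesis using T by (simp add: field_simps)
  qed
  have y: "det3 a b y = 0" "det3 c d y = 0"
    using nz by (simp_all add: aff det3_left \<alpha>_def \<beta>_def)
  have par: "(Re b - Re a) * (Im d - Im c) - (Im b - Im a) * (Re d - Re c) \<noteq> 0" (is "?D \<noteq> 0")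
  proof
    assume "?D = 0"
    then have "det3 a b d = det3 a b c" by (simp add: det3_def algebra_simps)
    moreover obtain u where u: "z = (1 - u) *\<^sub>R c + u *\<^sub>R d" using z(2) by (auto simp: in_segment)
    have "det3 a b z = (1 - u) * det3 a b c + u * det3 a b d" unfolding u det3_affine ..
    ultimately have "det3 a b z = det3 a b c" by (simp add: algebra_simps)
    then show False using z(1) nz by simp
  qed
  have e1: "(Re b - Re a) * (Im z - Im y) - (Im b - Im a) * (Re z - Re y) = 0"
    using z(1) y(1) by (simp add: det3_def algebra_simps)
  have e2: "(Re d - Re c) * (Im z - Im y) - (Im d - Im c) * (Re z - Re y) = 0"
    using z' y(2) by (simp add: det3_def algebra_simps)
  have "?D * (Re z - Re y) = 0" "?D * (Im z - Im y) = 0"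
    using arg_cong2[OF e1 e2, of "\<lambda>p q. (Re d - Re c) * p - (Re b - Re a) * q"]
      arg_cong2[OF e1 e2, of "\<lambda>p q. (Im d - Im c) * p - (Im b - Im a) * q"]
    by (simp_all add: algebra_simps)
  then have "z = y" using par by (simp add: complex_eq_iff)
  moreover have "y \<in> convex hull {a, c, w}"
    unfolding convex_hull_3
  proof (intro CollectI exI conjI)
    show "y = (\<alpha> / T) *\<^sub>R a + (\<beta> / T) *\<^sub>R c + (1 / T) *\<^sub>R w" by (rule y_def)
    show "\<alpha> / T + \<beta> / T + 1 / T = 1"
      using T by (simp only: add_divide_distrib[symmetric] T_def[symmetric]) simp
  qed (use T pos in simp_all)
  ultimately show ?thesis by simp
qed

section \<open>Numerical bounds for cosines of multiples of pi / 14\<close>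

lemma sin_7th: 
  defines "x \<equiv> sin (pi / 14)"
  shows "8 * x^3 - 4 * x^2 - 4 * x + 1 = 0"
proof -
  have c: "cos (pi / 14) > 0" by (intro cos_gt_zero_pi) auto
  \<comment> \<open>Seven steps are a right angle, so the sine of four is the cosine of three. Both
    have the factor cos (pi / 14), and cancelling it leaves the cubic.\<close>
  have "sin (4 * (pi / 14)) = cos (3 * (pi / 14))"
    by (subst sin_cos_eq) (simp add: field_simps)
  moreover have "sin (4 * (pi / 14)) = 4 * x * cos (pi / 14) * (1 - 2 * x^2)"
    using sin_double[of "2 * (pi / 14)"] sin_double[of "pi / 14"] cos_double_sin[of "pi / 14"]
    by (simp add: x_def)
  moreover have "cos (3 * (pi / 14)) = cos (pi / 14) * (1 - 4 * x^2)"
  proof -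
    have "cos (3 * (pi / 14)) = 4 * cos (pi / 14) ^ 3 - 3 * cos (pi / 14)" by (rule cos_treble_cos)
    also have "\<dots> = cos (pi / 14) * (4 * (cos (pi / 14))\<^sup>2 - 3)"
      by (simp add: power3_eq_cube power2_eq_square algebra_simps)
    finally show ?thesis by (simp add: x_def cos_squared_eq algebra_simps)
  qed
  ultimately have "cos (pi / 14) * (4 * x * (1 - 2 * x^2)) = cos (pi / 14) * (1 - 4 * x^2)"
    by (simp add: algebra_simps)
  then have "4 * x * (1 - 2 * x^2) = 1 - 4 * x^2" using c by simp
  then show ?thesis by (simp add: algebra_simps power3_eq_cube power2_eq_square)
qed

lemma sin_7th_bounds: "22252093 / 10^8 < sin (pi / 14)" "sin (pi / 14) < 22252094 / 10^8"
proof -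
  define x where "x = sin (pi / 14)"
  have eq: "8 * x^3 - 4 * x^2 - 4 * x + 1 = 0" using sin_7th by (simp add: x_def)
  have x0: "0 < x" unfolding x_def by (intro sin_gt_zero) auto
  have x1: "x < 1 / 2"
  proof -
    have "sin (pi / 14) < sin (pi / 6)" by (rule sin_monotone_2pi) auto
    then show ?thesis by (simp add: x_def sin_30)
  qed
  \<comment> \<open>The cubic is strictly decreasing on [0, 1/2], so its values at the two decimal
    bounds enclose the root.\<close>
  have mono: "8 * q^3 - 4 * q^2 - 4 * q < 8 * p^3 - 4 * p^2 - 4 * p" if "0 \<le> p" "p < q" "q \<le> 1 / 2" for p q :: real
  proof -
    have "(q - p) * (8 * (q * q + q * p + p * p) - 4 * (q + p) - 4) < 0"
    proof (rule mult_pos_neg)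
      have "q * q \<le> (1 / 2) * q" "p * p \<le> (1 / 2) * p" "q * p \<le> (1 / 2) * p"
        using that by (intro mult_right_mono; simp)+
      then have "q * q + q * p + p * p \<le> q / 2 + p" by simp
      moreover have "p < 1 / 2" using that by simp
      ultimately show "8 * (q * q + q * p + p * p) - 4 * (q + p) - 4 < 0" by argo
    qed (use that in simp)
    then show ?thesis by (simp add: algebra_simps power3_eq_cube power2_eq_square)
  qed
  have mono': "8 * q^3 - 4 * q^2 - 4 * q \<le> 8 * p^3 - 4 * p^2 - 4 * p" if "0 \<le> p" "p \<le> q" "q \<le> 1 / 2" for p q :: real
    using mono[of p q] that by (cases "p = q") auto
  show "22252093 / 10^8 < sin (pi / 14)"
  proof (rule ccontr)
    assume "\<not> ?thesis"
    then have "x \<le> 22252093 / 10^8" unfolding x_def by linarith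
    from mono'[OF _ this] x0 eq show False by (simp add: power3_eq_cube power2_eq_square[of "_ / _"])
  qed
  show "sin (pi / 14) < 22252094 / 10^8"
  proof (rule ccontr)
    assume "\<not> ?thesis"
    then have "22252094 / 10^8 \<le> x" unfolding x_def by linarith
    from mono'[OF _ this] x1 eq show False by (simp add: power3_eq_cube power2_eq_square[of "_ / _"])
  qed
qed

lemma kappa_bounds': "1931851 / 10^6 < kappa" "kappa < 1931852 / 10^6"
proof -
  have s3: "17320507 / 10^7 < sqrt 3" "sqrt 3 < 17320509 / 10^7"
    by (rule real_less_rsqrt real_less_lsqrt; simp add: power2_eq_square)+
  show "1931851 / 10^6 < kappa"
    by (rule power2_less_imp_less) (use s3 kappa_pos in \<open>simp_all add: kappa_sq power2_eq_square[of "_ / _"]\<close>)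
  show "kappa < 1931852 / 10^6"
    by (rule power2_less_imp_less) (use s3 kappa_pos in \<open>simp_all add: kappa_sq power2_eq_square[of "_ / _"]\<close>)
qed

lemma abs_diff_mult_le:
  fixes x y X Y :: real
  assumes "\<bar>x - X\<bar> \<le> e" "\<bar>y - Y\<bar> \<le> f"
  shows "\<bar>x * y - X * Y\<bar> \<le> e * \<bar>y\<bar> + \<bar>X\<bar> * f"
proof -
  have "x * y - X * Y = (x - X) * y + X * (y - Y)" by (simp add: algebra_simps)
  also have "\<bar>\<dots>\<bar> \<le> \<bar>x - X\<bar> * \<bar>y\<bar> + \<bar>X\<bar> * \<bar>y - Y\<bar>"
    by (metis abs_mult abs_triangle_ineq)
  also have "\<dots> \<le> e * \<bar>y\<bar> + \<bar>X\<bar> * f"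
    using assms by (intro add_mono mult_right_mono mult_left_mono) auto
  finally show ?thesis .
qed

lemma cos_7th_bounds:
  assumes "j \<le> 7"
  shows "\<bar>[1000000, 974928, 900969, 781831, 623490, 433884, 222521, 0::real] ! j - 10^6 * cos (real j * pi / 14)\<bar> \<le> 5"
proof -
  define x where "x = sin (pi / 14)"
  define c where "c = cos (pi / 14)"
  have x: "22252093 / 10^8 < x" "x < 22252094 / 10^8" using sin_7th_bounds by (simp_all add: x_def)
  have xx: "(22252093 / 10^8)^2 < x^2" "x^2 < (22252094 / 10^8)^2"
    using x by (auto intro!: power_strict_mono)
  have cx: "c^2 = 1 - x^2" unfolding c_def x_def by (simp add: cos_squared_eq)
  have c0: "0 < c" unfolding c_def by (intro cos_gt_zero_pi) auto
  have c: "974927 / 10^6 < c" "c < 974929 / 10^6"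
    by (rule power2_less_imp_less; use xx cx c0 in \<open>simp add: power2_eq_square[of "_ / _"]\<close>)+
  have xc: "2169 / 10^4 < x * c" "x * c < 21695 / 10^5" "216941 / 10^6 < x * c" "x * c < 216943 / 10^6"
  proof -
    have "22252093 / 10^8 * (974927 / 10^6) < x * c" using x c by (intro mult_strict_mono) auto
    moreover have "x * c < 22252094 / 10^8 * (974929 / 10^6)" using x c c0 by (intro mult_strict_mono) auto
    ultimately show "2169 / 10^4 < x * c" "x * c < 21695 / 10^5" "216941 / 10^6 < x * c" "x * c < 216943 / 10^6"
      by simp_all
  qed
  have s: "sin (real i * pi / 14) = cos (real (7 - i) * pi / 14)" if "i \<le> 7" for i
    using that by (subst sin_cos_eq) (simp add: of_nat_diff field_simps)
  have C: "cos (1 * pi / 14) = c" "cos (2 * pi / 14) = 1 - 2 * x^2" "cos (3 * pi / 14) = c * (1 - 4 * x^2)"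
    "cos (4 * pi / 14) = 3 * x - 4 * x^3" "cos (5 * pi / 14) = 2 * (x * c)" "cos (6 * pi / 14) = x" "cos (7 * pi / 14) = 0"
  proof -
    show "cos (2 * pi / 14) = 1 - 2 * x^2" using cos_double_sin[of "pi / 14"] by (simp add: x_def)
    have "cos (3 * pi / 14) = 4 * c ^ 3 - 3 * c" using cos_treble_cos[of "pi / 14"] by (simp add: c_def)
    also have "\<dots> = c * (4 * c^2 - 3)" by (simp add: algebra_simps power3_eq_cube power2_eq_square)
    finally show "cos (3 * pi / 14) = c * (1 - 4 * x^2)" by (simp add: cx algebra_simps)
    have "sin (3 * (pi / 14)) = sin (2 * (pi / 14) + pi / 14)" by simp
    also have "\<dots> = 2 * x * c * c + (1 - 2 * x^2) * x"
      unfolding sin_add sin_double cos_double_sin x_def c_def by simp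
    also have "\<dots> = 2 * x * c^2 + (1 - 2 * x^2) * x" by (simp add: power2_eq_square)
    finally have "sin (3 * (pi / 14)) = 3 * x - 4 * x^3"
      unfolding cx by (simp add: algebra_simps power2_eq_square power3_eq_cube)
    then show "cos (4 * pi / 14) = 3 * x - 4 * x^3" using s[of 3] by simp
    show "cos (5 * pi / 14) = 2 * (x * c)" using s[of 2] sin_double[of "pi / 14"] by (simp add: x_def c_def)
    show "cos (6 * pi / 14) = x" using s[of 1] by (simp add: x_def)
  qed (simp_all add: c_def)
  have c3: "781826 / 10^6 < c * (1 - 4 * x^2)" "c * (1 - 4 * x^2) < 781836 / 10^6"
  proof -
    have "974927 / 10^6 * (1 - 4 * (22252094 / 10^8)^2) < c * (1 - 4 * x^2)"
      using c xx c0 by (intro mult_strict_mono) (auto simp: power2_eq_square)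
    moreover have "c * (1 - 4 * x^2) < 974929 / 10^6 * (1 - 4 * (22252093 / 10^8)^2)"
    proof (intro mult_strict_mono)
      show "0 \<le> 1 - 4 * x^2" using xx by (simp add: power2_eq_square)
    qed (use c xx in \<open>auto simp: power2_eq_square\<close>)
    ultimately show "781826 / 10^6 < c * (1 - 4 * x^2)" "c * (1 - 4 * x^2) < 781836 / 10^6"
      by (simp_all add: power2_eq_square)
  qed
  have x3: "(22252093 / 10^8)^3 < x^3" "x^3 < (22252094 / 10^8)^3"
    using x by (auto intro!: power_strict_mono)
  have "j = 0 \<or> j = 1 \<or> j = 2 \<or> j = 3 \<or> j = 4 \<or> j = 5 \<or> j = 6 \<or> j = 7" using assms by linarith
  then show ?thesis
    using c x xx xc c3 x3 unfolding abs_le_iff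
    by (elim disjE) (simp_all add: C[simplified] C power2_eq_square[of "_ / _"] power3_eq_cube[of "_ / _"])
qed

lemma cos_mod_28: "cos (real (n mod 28) * pi / 14) = cos (real n * pi / 14)"
proof -
  have "real (n mod 28 + 28 * (n div 28)) = real n" by (simp only: mod_mult_div_eq)
  then have n: "real n = real (n mod 28) + 28 * real (n div 28)"
    by (simp only: of_nat_add of_nat_mult of_nat_numeral)
  have "real n * pi / 14 = real (n mod 28) * pi / 14 + 2 * pi * of_int (int (n div 28))"
    by (subst n) (simp add: field_simps)
  then have "\<exists>m::int. real n * pi / 14 = real (n mod 28) * pi / 14 + 2 * pi * of_int m" by (rule exI)
  then show ?thesis using sin_cos_eq_iff[of "real n * pi / 14" "real (n mod 28) * pi / 14"] by metis
qed

text \<open>Cosines of multiples of \<open>\<pi> / 14\<close>, scaled and rounded, from those in the first quadrant.\<close>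

definition fold_table :: "int list \<Rightarrow> nat \<Rightarrow> int" where
  "fold_table tb n = (let k = n mod 28 in if k \<le> 7 then tb ! k else if k \<le> 14 then - (tb ! (14 - k))
     else if k \<le> 21 then - (tb ! (k - 14)) else tb ! (28 - k))"

lemma fold_table_approx:
  assumes tb: "\<And>j. j \<le> 7 \<Longrightarrow> \<bar>real_of_int (tb ! j) - A * cos (real j * pi / 14)\<bar> \<le> 1"
  shows "\<bar>real_of_int (fold_table tb n) - A * cos (real n * pi / 14)\<bar> \<le> 1"
proof -
  define k where "k = n mod 28"
  have k: "k < 28" by (simp add: k_def)
  have e: "cos (real n * pi / 14) = cos (real k * pi / 14)" by (simp add: k_def cos_mod_28)
  have ft: "fold_table tb n = (if k \<le> 7 then tb ! k else if k \<le> 14 then - (tb ! (14 - k))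
     else if k \<le> 21 then - (tb ! (k - 14)) else tb ! (28 - k))"
    unfolding fold_table_def Let_def k_def ..
  consider "k \<le> 7" | "7 < k" "k \<le> 14" | "14 < k" "k \<le> 21" | "21 < k" by linarith
  then show ?thesis
  proof cases
    case 1
    then show ?thesis using tb[OF 1] by (simp add: ft e)
  next
    case 2
    have "real k * pi / 14 = pi - real (14 - k) * pi / 14" using 2 by (simp add: of_nat_diff field_simps)
    then have "cos (real k * pi / 14) = - cos (real (14 - k) * pi / 14)" by (simp only: cos_pi_minus)
    then show ?thesis using tb[of "14 - k"] 2 by (simp add: ft e abs_le_iff)
  next
    case 3
    have "real k * pi / 14 = real (k - 14) * pi / 14 + pi" using 3 by (simp add: of_nat_diff field_simps)
    then have "cos (real k * pi / 14) = - cos (real (k - 14) * pi / 14)" by (simp only: cos_periodic_pi)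
    then show ?thesis using tb[of "k - 14"] 3 by (simp add: ft e abs_le_iff)
  next
    case 4
    have "real k * pi / 14 = 2 * pi - real (28 - k) * pi / 14" using 4 k by (simp add: of_nat_diff field_simps)
    then have "cos (real k * pi / 14) = cos (real (28 - k) * pi / 14)" by (simp only: cos_2pi_minus)
    then show ?thesis using tb[of "28 - k"] 4 k by (simp add: ft e)
  qed
qed

definition cos_table :: "nat \<Rightarrow> int list" where
  "cos_table t = (if t = 1 then [10000, 9749, 9010, 7818, 6235, 4339, 2225, 0]
     else [19319, 18834, 17405, 15104, 12045, 8382, 4299, 0])"

lemma cos_table_approx:
  assumes "j \<le> 7" "t = 1 \<or> t = 2"
  shows "\<bar>real_of_int (cos_table t ! j) - (10^4 * ring_radius t) * cos (real j * pi / 14)\<bar> \<le> 1"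
proof -
  define y where "y = cos (real j * pi / 14)"
  define v where "v = [1000000, 974928, 900969, 781831, 623490, 433884, 222521, 0::real] ! j"
  have y: "\<bar>v - 10^6 * y\<bar> \<le> 5" using cos_7th_bounds[OF assms(1)] by (simp add: y_def v_def)
  have j: "j = 0 \<or> j = 1 \<or> j = 2 \<or> j = 3 \<or> j = 4 \<or> j = 5 \<or> j = 6 \<or> j = 7" using assms(1) by linarith
  have v: "0 \<le> v" "v \<le> 10^6" using j by (auto simp: v_def)
  show ?thesis
  proof (cases "t = 1")
    case True
    have "\<bar>real_of_int (cos_table 1 ! j) - v / 100\<bar> \<le> 6 / 10" using j by (auto simp: v_def cos_table_def)
    then have "\<bar>real_of_int (cos_table 1 ! j) - 10^4 * y\<bar> \<le> 1" using y unfolding abs_le_iff by (intro conjI; elim conjE; simp)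
    then show ?thesis using True by (simp add: ring_radius_def y_def)
  next
    case False
    have L: "\<bar>p * w - q * w\<bar> = \<bar>p - q\<bar> * w" if "0 \<le> w" for p q w :: real
      using that by (simp add: left_diff_distrib[symmetric] abs_mult)
    have L': "\<bar>p * x - p * w\<bar> = p * \<bar>x - w\<bar>" if "0 \<le> p" for p x w :: real
      using that by (simp add: right_diff_distrib[symmetric] abs_mult)
    have k: "\<bar>kappa - 19318515 / 10^7\<bar> \<le> 1 / 10^6" using kappa_bounds' unfolding abs_le_iff by simp
    have "\<bar>kappa * (v / 100) - 19318515 / 10^7 * (v / 100)\<bar> \<le> 1 / 100"
    proof -
      have "\<bar>kappa * (v / 100) - 19318515 / 10^7 * (v / 100)\<bar> = \<bar>kappa - 19318515 / 10^7\<bar> * (v / 100)"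
        by (rule L) (use v in simp)
      also have "\<dots> \<le> 1 / 10^6 * 10^4" using k v by (intro mult_mono) auto
      finally show ?thesis by simp
    qed
    moreover have "\<bar>kappa * (v / 100) - kappa * (10^4 * y)\<bar> \<le> 2 * (5 / 100)"
    proof -
      have "\<bar>kappa * (v / 100) - kappa * (10^4 * y)\<bar> = kappa * \<bar>v / 100 - 10^4 * y\<bar>"
        by (rule L') (use kappa_pos in simp)
      also have "\<dots> \<le> 2 * (5 / 100)"
      proof (rule mult_mono)
        show "\<bar>v / 100 - 10^4 * y\<bar> \<le> 5 / 100" using y unfolding abs_le_iff by simp
      qed (use kappa_bounds in simp_all)
      finally show ?thesis .
    qed
    moreover have "\<bar>real_of_int (cos_table 2 ! j) - 19318515 / 10^7 * (v / 100)\<bar> \<le> 6 / 10"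
      using j by (auto simp: v_def cos_table_def)
    ultimately have "\<bar>real_of_int (cos_table 2 ! j) - kappa * (10^4 * y)\<bar> \<le> 1" unfolding abs_le_iff by (intro conjI; elim conjE; simp)
    then show ?thesis using False assms(2) by (simp add: ring_radius_def y_def mult_ac)
  qed
qed

text \<open>21 steps of pi / 14 make 3 pi / 2, so a shift by 21 turns the cosine table into a sine
  table.\<close>

fun coord :: "code_point \<Rightarrow> int \<times> int" where
  "coord (t, k) = (if t = 0 then (0, 0) else (fold_table (cos_table t) k, fold_table (cos_table t) (k + 21)))"

definition approx :: "int \<times> int \<Rightarrow> complex \<Rightarrow> bool" where
  "approx p z \<longleftrightarrow> \<bar>real_of_int (fst p) - 10^4 * Re z\<bar> \<le> 1 \<and> \<bar>real_of_int (snd p) - 10^4 * Im z\<bar> \<le> 1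
     \<and> - (1932 / 1000) \<le> Re z \<and> Re z \<le> 1932 / 1000 \<and> - (1932 / 1000) \<le> Im z \<and> Im z \<le> 1932 / 1000"

lemma coord_approx:
  assumes "t < 3"
  shows "approx (coord (t, k)) (zst (t, k))"
proof (cases "t = 0")
  case False
  then have t: "t = 1 \<or> t = 2" using assms by linarith
  have sin: "sin (real k * pi / 14) = cos (real (k + 21) * pi / 14)"
  proof -
    have "real (k + 21) * pi / 14 = real k * pi / 14 + pi / 2 + pi" by (simp add: field_simps)
    then have "cos (real (k + 21) * pi / 14) = - cos (real k * pi / 14 + pi / 2)" by (simp only: cos_periodic_pi)
    also have "\<dots> = sin (real k * pi / 14)" by (simp add: cos_add)
    finally show ?thesis by simp
  qed
  note ft = fold_table_approx[OF cos_table_approx[OF _ t]]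
  have rr: "0 \<le> ring_radius t" "ring_radius t \<le> 1932 / 1000" using kappa_bounds kappa_pos by (auto simp: ring_radius_def)
  have b: "- (1932 / 1000) \<le> ring_radius t * x \<and> ring_radius t * x \<le> 1932 / 1000" if "\<bar>x\<bar> \<le> 1" for x
  proof -
    have "\<bar>ring_radius t * x\<bar> \<le> 1932 / 1000"
      using rr that mult_mono[of "ring_radius t" "1932 / 1000" "\<bar>x\<bar>" 1] by (simp add: abs_mult)
    then show ?thesis unfolding abs_le_iff by linarith
  qed
  have z: "Re (zst (t, k)) = ring_radius t * cos (real k * pi / 14)"
    "Im (zst (t, k)) = ring_radius t * cos (real (k + 21) * pi / 14)"
    unfolding sin[symmetric] by simp_all
  show ?thesis using ft[of k] ft[of "k + 21"] False b[OF abs_cos_le_one]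
    unfolding approx_def z by (simp only: coord.simps if_False fst_conv snd_conv mult.assoc simp_thms)
qed (simp add: approx_def ring_radius_def)

fun apl :: "int \<times> int \<times> int \<Rightarrow> int \<times> int \<Rightarrow> int" where
  "apl (A, B, C) (x, y) = A * x + B * y + C"

fun line :: "int \<times> int \<Rightarrow> int \<times> int \<Rightarrow> int \<times> int \<times> int" where
  "line (ax, ay) (bx, by) = (ay - by, bx - ax, ax * by - ay * bx)"

text \<open>The origin of the margin: coordinates are off by at most 1 and their differences by 2;
  with differences of at most 38642 each product is off by at most 2 * 38642 + 2 * 38640 = 154564,
  and the determinant by less than 310000.\<close>

lemma apl_line_det3:
  assumes "approx p a" "approx q b" "approx s z"
  shows "\<bar>real_of_int (apl (line p q) s) - 10^8 * det3 a b z\<bar> < 310000"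
proof -
  obtain px py qx qy sx sy where pqs: "p = (px, py)" "q = (qx, qy)" "s = (sx, sy)" by (metis surj_pair)
  define ux where "ux = real_of_int qx - real_of_int px"
  define uy where "uy = real_of_int qy - real_of_int py"
  define vx where "vx = real_of_int sx - real_of_int px"
  define vy where "vy = real_of_int sy - real_of_int py"
  define Ux where "Ux = 10^4 * (Re b - Re a)"
  define Uy where "Uy = 10^4 * (Im b - Im a)"
  define Vx where "Vx = 10^4 * (Re z - Re a)"
  define Vy where "Vy = 10^4 * (Im z - Im a)"
  note D = ux_def uy_def vx_def vy_def Ux_def Uy_def Vx_def Vy_def
  have d: "\<bar>ux - Ux\<bar> \<le> 2" "\<bar>uy - Uy\<bar> \<le> 2" "\<bar>vx - Vx\<bar> \<le> 2" "\<bar>vy - Vy\<bar> \<le> 2"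
    "\<bar>Ux\<bar> \<le> 38640" "\<bar>Uy\<bar> \<le> 38640" "\<bar>vx\<bar> \<le> 38642" "\<bar>vy\<bar> \<le> 38642"
    using assms unfolding approx_def pqs D by (simp_all add: abs_le_iff)
  have "\<bar>ux * vy - Ux * Vy\<bar> \<le> 2 * \<bar>vy\<bar> + \<bar>Ux\<bar> * 2" "\<bar>uy * vx - Uy * Vx\<bar> \<le> 2 * \<bar>vx\<bar> + \<bar>Uy\<bar> * 2"
    using d by (intro abs_diff_mult_le; simp)+
  then have "\<bar>(ux * vy - uy * vx) - (Ux * Vy - Uy * Vx)\<bar> < 310000" using d(5-8) by linarith
  moreover have "real_of_int (apl (line p q) s) = ux * vy - uy * vx"
    unfolding pqs D by (simp add: algebra_simps)
  moreover have "10^8 * det3 a b z = Ux * Vy - Uy * Vx"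
    unfolding D by (simp add: det3_def algebra_simps)
  ultimately show ?thesis by simp
qed

section \<open>Tests on pairs of segments\<close>

definition far :: "int \<Rightarrow> bool" where
  "far u \<longleftrightarrow> u > 310000 \<or> u < -310000"

definition same_side :: "int \<Rightarrow> int \<Rightarrow> bool" where
  "same_side u v \<longleftrightarrow> (if u > 310000 then v > 310000 else if u < -310000 then v < -310000 else False)"

definition opp_side :: "int \<Rightarrow> int \<Rightarrow> bool" where
  "opp_side u v \<longleftrightarrow> (if u > 310000 then v < -310000 else if u < -310000 then v > 310000 else False)"

text \<open>The rounded endpoints and the line of a segment are carried along, so that they are
  computed once and not for every comparison.\<close>

type_synonym ext_segment = "code_segment \<times> ((int \<times> int) \<times> (int \<times> int)) \<times> (int \<times> int \<times> int)"

fun ext :: "code_segment \<Rightarrow> ext_segment" where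
  "ext (p, q) = ((p, q), (coord p, coord q), line (coord p) (coord q))"

text \<open>The second segment stays on one side of the line of the first. A shared endpoint gives
  determinant 0, which rounding cannot certify; it is recognized by its code, and then the other
  endpoint only has to be off the line.\<close>

fun disjoint_test :: "ext_segment \<Rightarrow> ext_segment \<Rightarrow> bool" where
  "disjoint_test ((a, b), _, L) ((c, d), (pc, pd), _) =
     (if c = a \<or> c = b then (if d = a \<or> d = b then False else far (apl L pd))
      else if d = a \<or> d = b then far (apl L pc) else same_side (apl L pc) (apl L pd))"

fun cross_test :: "ext_segment \<Rightarrow> ext_segment \<Rightarrow> bool" where
  "cross_test (_, (pa, pb), L) (_, (pc, pd), L') =
     (opp_side (apl L pc) (apl L pd) \<and> opp_side (apl L' pa) (apl L' pb))"

text \<open>Two segments from the inner to the outer ring, with w the inner vertex opposite to the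
  first inner endpoint: by \<open>cevians_meet_inside\<close> any common point lies in a triangle of
  inner vertices. It is then inside the inner polygon and does not count as a crossing in the
  annulus.\<close>

fun deep_test :: "ext_segment \<Rightarrow> ext_segment \<Rightarrow> bool" where
  "deep_test (((t, k), b), (pa, _), L) (((u, l), d), (pc, _), L') =
     (t = 1 \<and> u = 1 \<and> fst b = 2 \<and> fst d = 2 \<and> odd k \<and> odd l \<and>
      opp_side (apl L pc) (apl L (coord (1, (k + 14) mod 28))) \<and>
      opp_side (apl L' pa) (apl L' (coord (1, (k + 14) mod 28))))"

text \<open>Segments of equal length from the origin coincide or have disjoint interiors, whatever
  their labels.\<close>

fun radial_test :: "ext_segment \<Rightarrow> ext_segment \<Rightarrow> bool" where
  "radial_test (((t, k), (t', k')), _) (((u, l), (u', l')), _) \<longleftrightarrow> t = 0 \<and> u = 0 \<and> t' = u'"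

definition ok :: "ext_segment \<Rightarrow> ext_segment \<Rightarrow> bool" where
  "ok X Y \<longleftrightarrow> (if disjoint_test X Y then True else if disjoint_test Y X then True else
     if radial_test X Y then True else if fst X = fst Y then True else deep_test X Y)"

definition seg_interior :: "code_segment \<Rightarrow> complex set" where
  "seg_interior T = open_segment (zst (fst T)) (zst (snd T))"

definition seg_ends :: "code_segment \<Rightarrow> complex set" where
  "seg_ends T = {zst (fst T), zst (snd T)}"

text \<open>The rings are interlaced: inner vertices have odd indices, outer ones even
  indices.\<close>

definition vertices :: "nat \<Rightarrow> complex set" where
  "vertices t = {zst (t, k) | k. k < 28 \<and> k mod 2 = t mod 2}"

lemma valid_seg_approx:
  assumes "valid_seg T"
  shows "approx (coord (fst T)) (zst (fst T))" "approx (coord (snd T)) (zst (snd T))"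
  using assms coord_approx by (cases T; cases "fst T"; cases "snd T"; auto simp del: coord.simps zst.simps)+

lemma far_det3:
  assumes "approx p a" "approx q b" "approx s z" "far (apl (line p q) s)"
  shows "det3 a b z \<noteq> 0"
  using apl_line_det3[OF assms(1-3)] assms(4) unfolding far_def by fastforce

lemma side_det3:
  assumes "approx p a" "approx q b" "approx s z"
  shows "apl (line p q) s > 310000 \<Longrightarrow> det3 a b z > 0" "apl (line p q) s < -310000 \<Longrightarrow> det3 a b z < 0"
proof -
  have e: "\<bar>real_of_int (apl (line p q) s) - 10^8 * det3 a b z\<bar> < 310000" by (rule apl_line_det3[OF assms])
  show "det3 a b z > 0" if "apl (line p q) s > 310000"
  proof -
    have "real_of_int (apl (line p q) s) > 310000" using that by linarith
    then show ?thesis using e by simp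
  qed
  show "det3 a b z < 0" if "apl (line p q) s < -310000"
  proof -
    have "real_of_int (apl (line p q) s) < -310000" using that by linarith
    then show ?thesis using e by simp
  qed
qed

lemma opp_side_det3:
  assumes "approx p a" "approx q b" "approx s z" "approx s' z'"
    "opp_side (apl (line p q) s) (apl (line p q) s')"
  shows "det3 a b z * det3 a b z' < 0"
  using side_det3[OF assms(1,2,3)] side_det3[OF assms(1,2,4)] assms(5)
  by (auto simp: opp_side_def mult_less_0_iff split: if_splits)

lemma disjoint_one_side:
  assumes "det3 a b p \<ge> 0 \<and> det3 a b q \<ge> 0 \<and> (det3 a b p > 0 \<or> det3 a b q > 0) \<or>
    det3 a b p \<le> 0 \<and> det3 a b q \<le> 0 \<and> (det3 a b p < 0 \<or> det3 a b q < 0)"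
  shows "open_segment a b \<inter> open_segment p q = {}"
  using assms open_segments_disjoint[of a b p q] open_segments_disjoint[of b a p q]
  by (auto simp: det3_swap[of a b] open_segment_commute[of b a])

lemma disjoint_test:
  assumes "disjoint_test (ext T) (ext U)" "valid_seg T" "valid_seg U"
  shows "seg_interior T \<inter> seg_interior U = {}"
proof -
  obtain a b c d where TU: "T = (a, b)" "U = (c, d)" by (metis surj_pair)
  have ap: "approx (coord a) (zst a)" "approx (coord b) (zst b)" "approx (coord c) (zst c)" "approx (coord d) (zst d)"
    using valid_seg_approx[OF assms(2)] valid_seg_approx[OF assms(3)] TU by simp_all
  note S = side_det3[OF ap(1,2)] far_det3[OF ap(1,2)]
  have z: "det3 (zst a) (zst b) (zst e) = 0" if "e = a \<or> e = b" for e
    using that det3_left det3_right by auto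
  let ?f = "det3 (zst a) (zst b)"
  have "?f (zst c) \<ge> 0 \<and> ?f (zst d) \<ge> 0 \<and> (?f (zst c) > 0 \<or> ?f (zst d) > 0) \<or>
    ?f (zst c) \<le> 0 \<and> ?f (zst d) \<le> 0 \<and> (?f (zst c) < 0 \<or> ?f (zst d) < 0)"
  proof -
    consider "c = a \<or> c = b" "far (apl (line (coord a) (coord b)) (coord d))"
      | "d = a \<or> d = b" "far (apl (line (coord a) (coord b)) (coord c))"
      | "same_side (apl (line (coord a) (coord b)) (coord c)) (apl (line (coord a) (coord b)) (coord d))"
      using assms(1) unfolding TU by (auto simp del: apl.simps line.simps coord.simps split: if_splits)
    then show ?thesis
    proof cases
      case 1
      then show ?thesis using z[OF 1(1)] far_det3[OF ap(1,2,4) 1(2)] by linarith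
    next
      case 2
      then show ?thesis using z[OF 2(1)] far_det3[OF ap(1,2,3) 2(2)] by linarith
    next
      case 3
      then show ?thesis using side_det3[OF ap(1,2,3)] side_det3[OF ap(1,2,4)]
        unfolding same_side_def by (auto split: if_splits)
    qed
  qed
  then show ?thesis unfolding seg_interior_def TU by (simp only: fst_conv snd_conv disjoint_one_side)
qed

lemma cross_test:
  assumes "cross_test (ext T) (ext U)" "valid_seg T" "valid_seg U"
  shows "\<exists>z. z \<in> seg_interior T \<and> z \<in> seg_interior U" "seg_ends T \<noteq> seg_ends U"
proof -
  obtain a b c d where TU: "T = (a, b)" "U = (c, d)" by (metis surj_pair)
  have ap: "approx (coord a) (zst a)" "approx (coord b) (zst b)" "approx (coord c) (zst c)" "approx (coord d) (zst d)"
    using valid_seg_approx[OF assms(2)] valid_seg_approx[OF assms(3)] TU by simp_all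
  have "det3 (zst a) (zst b) (zst c) * det3 (zst a) (zst b) (zst d) < 0"
    "det3 (zst c) (zst d) (zst a) * det3 (zst c) (zst d) (zst b) < 0"
    using opp_side_det3[OF ap(1,2,3,4)] opp_side_det3[OF ap(3,4,1,2)] assms(1) unfolding TU
    by (simp_all del: apl.simps line.simps coord.simps)
  then show "\<exists>z. z \<in> seg_interior T \<and> z \<in> seg_interior U" "seg_ends T \<noteq> seg_ends U"
    unfolding seg_interior_def seg_ends_def TU
    using open_segments_cross by (auto simp: det3_left det3_right doubleton_eq_iff)
qed

lemma deep_test:
  assumes "deep_test (ext T) (ext U)" "valid_seg T" "valid_seg U"
  shows "seg_interior T \<inter> seg_interior U \<subseteq> convex hull vertices 1" "fst (snd T) = 2"
proof -
  obtain k b l d where TU: "T = ((1, k), b)" "U = ((1, l), d)" "odd k" "odd l" "fst b = 2"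
    using assms(1) by (cases T; cases U; cases "fst T"; cases "fst U") (auto simp del: apl.simps line.simps coord.simps)
  define w where "w = (1::nat, (k + 14) mod 28)"
  have ap: "approx (coord (1, k)) (zst (1, k))" "approx (coord b) (zst b)" "approx (coord (1, l)) (zst (1, l))"
    "approx (coord d) (zst d)" "approx (coord w) (zst w)"
    using valid_seg_approx[OF assms(2)] valid_seg_approx[OF assms(3)] TU coord_approx[of 1 "(k + 14) mod 28"]
    by (simp_all add: w_def del: coord.simps zst.simps)
  have "det3 (zst (1, k)) (zst b) (zst (1, l)) * det3 (zst (1, k)) (zst b) (zst w) < 0"
    "det3 (zst (1, l)) (zst d) (zst (1, k)) * det3 (zst (1, l)) (zst d) (zst w) < 0"
    using opp_side_det3[OF ap(1,2,3,5)] opp_side_det3[OF ap(3,4,1,5)] assms(1) unfolding TU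
    by (simp_all add: w_def del: apl.simps line.simps coord.simps zst.simps)
  then have "z \<in> convex hull {zst (1, k), zst (1, l), zst w}"
    if "z \<in> seg_interior T" "z \<in> seg_interior U" for z
    using cevians_meet_inside det3_open_segment that unfolding seg_interior_def TU fst_conv snd_conv by blast
  moreover have "{zst (1, k), zst (1, l), zst w} \<subseteq> vertices 1"
  proof -
    have "k < 28" "l < 28" using assms(2,3) unfolding TU by (cases b; cases d; simp)+
    moreover have "(k + 14) mod 28 mod 2 = 1" using TU(3) by presburger
    ultimately show ?thesis using TU(3,4) unfolding vertices_def w_def
      by (auto simp: odd_iff_mod_2_eq_one simp del: zst.simps)
  qed
  then have "convex hull {zst (1, k), zst (1, l), zst w} \<subseteq> convex hull vertices 1" by (rule hull_mono)
  ultimately show "seg_interior T \<inter> seg_interior U \<subseteq> convex hull vertices 1" by blast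
  show "fst (snd T) = 2" using TU by simp
qed

lemma radial_test:
  assumes "radial_test (ext T) (ext U)" "valid_seg T" "valid_seg U"
  shows "seg_ends T = seg_ends U \<or> seg_interior T \<inter> seg_interior U = {}"
proof (rule disjCI)
  obtain k t l m n where TU: "T = ((0, k), (t, l))" "U = ((0, m), (t, n))"
    using assms(1) by (cases T; cases U; cases "fst T"; cases "fst U"; cases "snd T"; cases "snd U") auto
  assume "seg_interior T \<inter> seg_interior U \<noteq> {}"
  then obtain z where z: "z \<in> open_segment 0 (zst (t, l))" "z \<in> open_segment 0 (zst (t, n))"
    by (auto simp: seg_interior_def TU ring_radius_def)
  then obtain u v where uv: "0 < u" "0 < v" "z = u *\<^sub>R zst (t, l)" "z = v *\<^sub>R zst (t, n)"
    by (auto simp: in_segment)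
  have rr: "ring_radius t > 0" using assms(2) TU kappa_pos by (auto simp: ring_radius_def)
  have "cmod (x *\<^sub>R zst (t, y)) = x * ring_radius t" if "x > 0" for x y using that rr by simp
  then have "u * ring_radius t = v * ring_radius t" using uv by metis
  then have "u = v" using rr by simp
  then have "zst (t, l) = zst (t, n)" using uv by simp
  then show "seg_ends T = seg_ends U" by (simp add: seg_ends_def TU ring_radius_def)
qed

lemma ok:
  assumes "ok (ext T) (ext U)" "valid_seg T" "valid_seg U"
  shows "seg_ends T = seg_ends U \<or> seg_interior T \<inter> seg_interior U = {} \<or>
     fst (snd T) = 2 \<and> seg_interior T \<inter> seg_interior U \<subseteq> convex hull vertices 1"
proof -
  consider "disjoint_test (ext T) (ext U)" | "disjoint_test (ext U) (ext T)" | "radial_test (ext T) (ext U)"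
    | "T = U" | "deep_test (ext T) (ext U)"
    using assms(1) unfolding ok_def by (cases T; cases U) (auto simp del: disjoint_test.simps radial_test.simps deep_test.simps split: if_splits)
  then show ?thesis
  proof cases
    case 1 then show ?thesis using disjoint_test assms by blast
  next
    case 2 then show ?thesis using disjoint_test[OF 2] assms by blast
  next
    case 3 then show ?thesis using radial_test assms by blast
  next
    case 4 then show ?thesis by simp
  next
    case 5 then show ?thesis using deep_test assms by blast
  qed
qed

section \<open>Checking all pairs of compatible roots\<close>

abbreviation outerT :: "code_segment \<Rightarrow> bool" where
  "outerT T \<equiv> fst (snd T) = 2"

definition outer_row :: "nat \<Rightarrow> ext_segment list" where
  "outer_row i = map ext (filter outerT (DG ! i))"

definition inner_row :: "nat \<Rightarrow> code_segment list" where
  "inner_row i = filter (\<lambda>T. \<not> outerT T) (DG ! i)"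

definition outer_points :: "nat \<Rightarrow> code_point list" where
  "outer_points i = concat (map (\<lambda>T. [fst T, snd T]) (filter outerT (DG ! i)))"

definition later_compatible :: "nat \<Rightarrow> nat list" where
  "later_compatible i = filter (\<lambda>j. i < j) (compat_table ! i)"

text \<open>Segments reaching the outer ring are always active, so rows are compared as they stand,
  including each row with itself.\<close>

definition outer_row_ok :: "nat \<Rightarrow> bool" where
  "outer_row_ok i \<longleftrightarrow> list_all (\<lambda>j. list_all (\<lambda>X. list_all (ok X) (outer_row j)) (outer_row i))
     (i # later_compatible i)"

lemma outer_ok_0:
  "list_all outer_row_ok [0..<6]"
  by code_simp

lemma outer_ok_1:
  "list_all outer_row_ok [6..<12]"
  by code_simp

lemma outer_ok_2:
  "list_all outer_row_ok [12..<20]"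
  by code_simp

lemma outer_ok_3:
  "list_all outer_row_ok [20..<42]"
  by code_simp

definition touches :: "code_point list \<Rightarrow> code_segment \<Rightarrow> bool" where
  "touches ps T \<longleftrightarrow> fst T \<in> set ps \<or> snd T \<in> set ps"

text \<open>Activity of inner segments depends on the pair of roots, since either diagram may supply
  the outer segment that activates them; hence the filter for every pair.\<close>

definition active_inner :: "nat \<Rightarrow> nat \<Rightarrow> code_segment list" where
  "active_inner i j = filter (touches (outer_points i @ outer_points j)) (inner_row i @ inner_row j)"

fun pairwise_ok :: "ext_segment list \<Rightarrow> bool" where
  "pairwise_ok [] = True"
| "pairwise_ok (X # Xs) = (list_all (ok X) Xs \<and> pairwise_ok Xs)"

text \<open>Indices 8 and 22 are perpendicular to the line at 1, indices 9 and 23 to the line at 2.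
  So the vertices from 23 through 0 to 8 lie in one closed obtuse wedge, and those from 9 to 22 in
  the other.\<close>

definition upper_wedge :: "nat \<Rightarrow> bool" where
  "upper_wedge k \<longleftrightarrow> k \<le> 8 \<or> 23 \<le> k"

fun gray_ok :: "code_segment \<Rightarrow> code_segment \<Rightarrow> bool" where
  "gray_ok ((t, k), (_, l)) ((u, m), (_, n)) \<longleftrightarrow>
     (if t = 0 then if u = 0 then if k = m then if l mod 14 = n mod 14 then True else upper_wedge l = upper_wedge n
      else True else True else True)"

definition inner_row_ok :: "nat \<Rightarrow> bool" where
  "inner_row_ok i \<longleftrightarrow> list_all (\<lambda>j. pairwise_ok (map ext (active_inner i j))) (later_compatible i)"

lemma inner_ok_0:
  "list_all inner_row_ok [0..<6]"
  by code_simp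

lemma inner_ok_1:
  "list_all inner_row_ok [6..<12]"
  by code_simp

lemma inner_ok_2:
  "list_all inner_row_ok [12..<20]"
  by code_simp

lemma inner_ok_3:
  "list_all inner_row_ok [20..<42]"
  by code_simp

definition gray_row_ok :: "nat \<Rightarrow> bool" where
  "gray_row_ok i \<longleftrightarrow> list_all (\<lambda>j. list_all (\<lambda>T. list_all (gray_ok T)
     (filter (touches (outer_points i @ outer_points j)) (inner_row j)))
     (filter (touches (outer_points i @ outer_points j)) (inner_row i))) (later_compatible i)"

lemma gray_ok_0:
  "list_all gray_row_ok [0..<6]"
  by code_simp

lemma gray_ok_1:
  "list_all gray_row_ok [6..<12]"
  by code_simp

lemma gray_ok_2:
  "list_all gray_row_ok [12..<20]"
  by code_simp

lemma gray_ok_3: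
  "list_all gray_row_ok [20..<42]"
  by code_simp

text \<open>Row \<open>i\<close> contains \<open>(j, p, q, e)\<close> for every \<open>j > i\<close> such that the roots \<open>i\<close> and \<open>j\<close> are not
  compatible: segments number \<open>p\<close> and \<open>q\<close> of the two diagrams cross, and the first one lies
  beyond an edge of the inner polygon in direction \<open>e \<pi> / 14\<close>, or both are inner segments if \<open>e = 99\<close>.\<close>

definition witnesses :: "(nat \<times> nat \<times> nat \<times> nat) list list" where
  "witnesses = [
    [(6,5,11,0), (12,5,11,0), (14,5,11,0), (20,5,11,0), (21,5,10,0), (25,5,11,0), (27,5,10,0), (28,5,9,0), (31,5,7,0), (33,5,9,0), (34,5,9,0), (35,5,8,0), (38,5,6,0), (39,5,7,0), (40,5,7,0), (41,5,8,0)],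
    [(7,9,2,99), (13,8,2,99), (15,10,0,4), (20,11,0,4), (21,10,5,26), (22,11,4,18), (24,11,0,4), (26,11,5,24), (27,10,0,6), (28,11,3,10), (29,11,4,18), (30,11,5,22), (31,0,7,2), (32,11,0,6), (33,10,5,24), (34,11,4,20), (35,11,3,8), (37,0,7,2), (38,11,5,22), (39,10,0,8), (40,11,3,8)],
    [(8,5,11,0), (12,5,11,0), (14,5,11,0), (15,5,10,0), (18,5,11,0), (19,5,7,0), (20,5,11,0), (21,5,10,0), (22,5,9,0), (25,5,11,0), (26,5,11,0), (27,5,7,0), (28,5,9,0), (29,5,8,0), (31,5,7,0), (32,5,6,0), (33,5,9,0), (34,5,7,0), (35,5,8,0), (36,5,10,0), (37,5,11,0), (38,5,6,0), (39,5,7,0), (40,5,7,0), (41,5,8,0)],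
    [(9,4,10,2), (13,4,6,2), (14,4,11,2), (15,4,10,2), (16,4,10,2), (18,4,11,2), (19,4,7,2), (20,4,11,2), (21,4,9,2), (22,4,9,2), (23,4,9,2), (24,4,11,2), (25,4,11,2), (26,4,6,2), (27,4,7,2), (28,4,7,2), (29,4,8,2), (30,4,8,2), (31,4,7,2), (32,4,6,2), (33,4,8,2), (34,4,7,2), (35,4,8,2), (36,4,10,2), (37,4,7,2), (38,4,6,2), (39,4,7,2), (40,4,7,2), (41,4,8,2)],
    [(10,5,11,14), (15,5,11,14), (16,5,11,14), (17,5,11,14), (19,5,10,14), (20,5,10,14), (21,5,11,14), (22,5,11,14), (23,5,11,14), (24,5,8,14), (25,5,9,14), (26,5,9,14), (27,5,9,14), (28,5,11,14), (30,5,10,14), (31,5,10,14), (32,5,7,14), (33,5,7,14), (34,5,6,14), (36,5,8,14), (37,5,8,14), (38,5,7,14), (39,5,6,14), (40,5,6,14), (41,5,10,14)],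
    [(11,5,11,14), (16,5,11,14), (17,5,11,14), (21,5,11,14), (22,5,11,14), (25,5,9,14), (26,5,9,14), (27,5,11,14), (30,5,10,14), (31,5,10,14), (32,5,10,14), (33,5,7,14), (36,5,8,14), (38,5,7,14), (39,5,9,14), (40,5,6,14)],
    [(8,5,11,0), (15,5,10,0), (18,5,11,0), (19,5,7,0), (22,5,9,0), (26,5,11,0), (27,5,7,0), (29,5,8,0), (32,5,6,0), (33,5,10,0), (34,5,7,0), (36,5,10,0), (37,5,11,0), (39,5,8,0), (40,5,9,0)],
    [(9,10,0,0), (14,11,0,0), (16,11,4,12), (18,11,0,0), (19,9,3,99), (21,10,0,26), (23,11,4,10), (25,0,11,0), (26,11,0,24), (27,10,1,6), (28,11,4,10), (32,11,1,6), (33,10,0,24), (34,11,5,20), (36,11,1,6), (37,0,11,0), (38,11,5,22), (39,10,1,8), (40,11,1,8), (41,11,5,20)],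
    [(9,5,10,2), (13,5,6,2), (14,5,11,2), (16,5,10,2), (20,5,11,2), (21,5,9,2), (23,5,9,2), (24,5,11,2), (25,5,11,2), (26,5,6,2), (27,5,10,2), (28,5,7,2), (30,5,8,2), (31,5,7,2), (32,5,11,2), (33,5,8,2), (34,5,9,2), (35,5,8,2), (37,5,7,2), (38,5,6,2), (39,5,7,2), (40,5,7,2), (41,5,8,2)],
    [(10,4,9,0), (12,4,11,0), (15,4,6,0), (17,4,10,0), (19,4,7,0), (20,4,7,0), (21,4,10,0), (22,4,6,0), (24,4,10,0), (25,4,11,0), (26,4,11,0), (27,4,7,0), (28,4,9,0), (29,4,8,0), (30,4,11,0), (31,4,7,0), (32,4,6,0), (33,4,9,0), (34,4,7,0), (35,4,8,0), (36,4,10,0), (37,4,11,0), (38,4,6,0), (39,4,7,0), (40,4,7,0), (41,4,8,0)],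
    [(11,5,11,16), (13,5,10,16), (14,5,9,16), (16,5,11,16), (18,5,10,16), (21,5,7,16), (22,5,11,16), (25,5,9,16), (26,5,7,16), (27,5,11,16), (28,5,6,16), (29,5,11,16), (30,5,10,16), (31,5,10,16), (32,5,10,16), (33,5,6,16), (34,5,11,16), (35,5,9,16), (36,5,8,16), (37,5,10,16), (38,5,7,16), (39,5,9,16), (40,5,6,16)],
    [(15,5,11,12), (19,5,10,12), (20,5,10,12), (23,5,11,12), (24,5,8,12), (27,5,9,12), (28,5,11,12), (32,5,7,12), (33,5,11,12), (34,5,6,12), (37,5,8,12), (38,5,9,12), (39,5,6,12), (41,5,10,12)],
    [(13,5,6,2), (16,5,10,2), (21,5,9,2), (23,5,9,2), (24,5,11,2), (26,5,6,2), (28,5,7,2), (30,5,8,2), (32,5,11,2), (33,5,8,2), (37,5,7,2), (38,5,10,2), (39,5,10,2)],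
    [(15,10,0,4), (17,11,4,16), (19,0,7,0), (20,11,0,4), (22,11,4,18), (25,7,2,99), (27,10,0,6), (31,0,7,0), (32,11,3,6), (33,10,5,24), (34,11,5,20), (36,11,3,6), (38,11,5,22), (39,10,3,8), (40,11,3,8), (41,11,5,20)],
    [(15,5,6,0), (17,5,10,0), (19,5,7,0), (20,5,7,0), (22,5,6,0), (24,5,10,0), (26,5,11,0), (27,5,7,0), (29,5,8,0), (30,5,11,0), (31,5,11,0), (32,5,6,0), (33,5,10,0), (34,5,7,0), (36,5,10,0), (37,5,11,0), (38,5,11,0), (39,5,8,0), (40,5,9,0)],
    [(16,4,6,4), (18,4,8,4), (21,4,8,4), (23,4,9,4), (25,4,8,4), (26,4,6,4), (27,4,10,4), (28,4,7,4), (30,4,8,4), (31,4,7,4), (32,4,11,4), (33,4,8,4), (34,4,9,4), (35,4,8,4), (36,4,11,4), (37,4,7,4), (38,4,6,4), (39,4,7,4), (40,4,7,4), (41,4,8,4)],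
    [(19,5,10,12), (20,5,6,12), (22,5,7,12), (24,5,8,12), (27,5,6,12), (28,5,11,12), (29,5,10,12), (31,5,8,12), (32,5,7,12), (33,5,11,12), (34,5,6,12), (35,5,11,12), (37,5,8,12), (38,5,9,12), (39,5,6,12), (40,5,11,12), (41,5,10,12)],
    [(18,5,10,16), (21,5,7,16), (26,5,7,16), (28,5,6,16), (29,5,11,16), (33,5,6,16), (34,5,11,16), (35,5,9,16), (37,5,10,16), (39,5,11,16), (40,5,10,16)],
    [(20,5,7,0), (22,5,6,0), (24,5,10,0), (27,5,8,0), (30,5,11,0), (31,5,11,0), (32,5,9,0), (38,5,11,0), (39,5,11,0)],
    [(21,10,1,26), (25,1,11,2), (26,11,5,24), (28,11,2,10), (30,11,5,22), (31,9,3,99), (33,10,5,24), (35,11,2,8), (38,11,5,22), (39,10,2,8), (40,11,2,8)],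
    [(21,5,8,4), (23,5,9,4), (25,5,8,4), (26,5,6,4), (28,5,7,4), (30,5,8,4), (32,5,11,4), (33,5,8,4), (36,5,11,4), (37,5,7,4), (38,5,10,4), (39,5,10,4), (40,5,11,4)],
    [(22,4,6,26), (24,4,10,26), (27,4,7,26), (29,4,8,26), (31,4,11,26), (32,4,6,26), (33,4,10,26), (34,4,7,26), (36,4,10,26), (37,4,11,26), (38,4,11,26), (39,4,8,26), (40,4,9,26), (41,4,11,26)],
    [(23,5,10,18), (25,5,10,18), (26,5,7,18), (28,5,6,18), (33,5,6,18), (34,5,11,18), (35,5,9,18), (37,5,10,18), (38,5,11,18), (39,5,11,18), (40,5,10,18), (41,5,11,18)],
    [(27,5,6,10), (29,5,10,10), (31,5,8,10), (34,5,8,10), (35,5,11,10), (39,5,10,10), (40,5,11,10)],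
    [(25,5,8,4), (26,5,10,4), (33,5,11,4), (36,5,11,4), (40,5,11,4)],
    [(27,10,2,6), (29,11,4,18), (32,11,2,6), (34,11,4,20), (37,9,0,99), (39,10,2,8)],
    [(27,5,8,24), (31,5,11,24), (32,5,9,24), (34,5,11,24), (38,5,11,24), (39,5,11,24), (41,5,11,24)],
    [(28,4,7,6), (30,4,8,6), (33,4,8,6), (35,4,11,6), (37,4,7,6), (38,4,10,6), (39,4,10,6), (40,4,11,6)],
    [(29,5,10,10), (31,5,8,10), (32,5,11,10), (34,5,8,10), (36,5,11,10), (39,5,10,10), (40,5,11,10)],
    [(33,5,10,18), (38,5,11,18), (41,5,11,18)],
    [(34,5,11,22), (41,5,11,22)],
    [(33,10,5,24), (37,9,3,99)],
    [(33,5,11,6), (35,5,11,6), (40,5,11,6)],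
    [(34,4,11,24), (39,4,11,24)],
    [(38,5,11,20)],
    [(36,5,11,8)],
    [],
    [],
    [],
    [],
    [],
    []]"

text \<open>The half-plane beyond the inner edge with midpoint direction e; this edge ends at e + 1
  and e - 1, written e + 27. For an outer vertex the product has to exceed 0.98, while the distance
  of the edge is cos (pi / 14) < 0.975; the gap absorbs the rounding.\<close>

fun beyond :: "nat \<Rightarrow> code_point \<times> int \<times> int \<Rightarrow> bool" where
  "beyond e ((t, k), x, y) \<longleftrightarrow> (if t = 1 then k = (e + 1) mod 28 \<or> k = (e + 27) mod 28
     else (case coord (1, e) of (u, v) \<Rightarrow> t = 2 \<and> x * u + y * v > 98000000))"

section \<open>From the evaluated checks to statements about segments\<close>

lemma fst_ext [simp]: "fst (ext T) = T"
  by (cases T) (simp del: coord.simps line.simps)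

lemma set_rows:
  "set (outer_row i) = ext ` {T \<in> set (DG ! i). outerT T}"
  "set (inner_row i) = {T \<in> set (DG ! i). \<not> outerT T}"
  "set (outer_points i) = {p. \<exists>T\<in>set (DG ! i). outerT T \<and> (p = fst T \<or> p = snd T)}"
  by (auto simp: outer_row_def inner_row_def outer_points_def simp del: ext.simps)

text \<open>With only two rings, the recursion for active segments has depth one.\<close>

definition act :: "code_segment set \<Rightarrow> code_segment \<Rightarrow> bool" where
  "act D T \<longleftrightarrow> outerT T \<or> (\<exists>U\<in>D. outerT U \<and> {fst T, snd T} \<inter> {fst U, snd U} \<noteq> {})"

lemma touches_points:
  assumes "T \<in> set (DG ! i) \<union> set (DG ! j)" "\<not> outerT T"
  shows "touches (outer_points i @ outer_points j) T \<longleftrightarrow> act (set (DG ! i) \<union> set (DG ! j)) T"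
  using assms by (auto simp: set_rows act_def touches_def)

lemma chunks_all:
  assumes "list_all P [0..<6]" "list_all P [6..<12]" "list_all P [12..<20]" "list_all P [20..<42]" "i < 42"
  shows "P i"
proof -
  have "i \<in> set [0..<6] \<or> i \<in> set [6..<12] \<or> i \<in> set [12..<20] \<or> i \<in> set [20..<42]"
    using assms(5) unfolding set_upt atLeastLessThan_iff by linarith
  then show ?thesis using assms(1-4) unfolding list_all_iff by blast
qed

lemmas outer_ok_all = chunks_all[OF outer_ok_0 outer_ok_1 outer_ok_2 outer_ok_3]
lemmas inner_ok_all = chunks_all[OF inner_ok_0 inner_ok_1 inner_ok_2 inner_ok_3]
lemmas gray_ok_all = chunks_all[OF gray_ok_0 gray_ok_1 gray_ok_2 gray_ok_3]

lemma compat_table_sym: "i < 42 \<Longrightarrow> j \<in> set (compat_table ! i) \<Longrightarrow> i \<in> set (compat_table ! j)"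
proof -
  have "list_all (\<lambda>i. list_all (\<lambda>j. i \<in> set (compat_table ! j)) (compat_table ! i)) [0..<42]"
    by code_simp
  then show "i < 42 \<Longrightarrow> j \<in> set (compat_table ! i) \<Longrightarrow> i \<in> set (compat_table ! j)"
    unfolding list_all_iff by simp
qed

text \<open>The last alternative is for pairs whose region is the outer annulus: there, meeting
  inside the inner polygon is allowed.\<close>

definition harmless :: "code_segment \<Rightarrow> code_segment \<Rightarrow> bool" where
  "harmless T U \<longleftrightarrow> seg_ends T = seg_ends U \<or> seg_interior T \<inter> seg_interior U = {} \<or>
     outerT T \<and> outerT U \<and> seg_interior T \<inter> seg_interior U \<subseteq> convex hull vertices 1"

lemma harmless_sym: "harmless T U = harmless U T"
  by (auto simp: harmless_def Int_commute)

lemma ok_harmless: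
  assumes "ok (ext T) (ext U)" "valid_seg T" "valid_seg U" "outerT T = outerT U"
  shows "harmless T U"
  using ok[OF assms(1-3)] assms(4) unfolding harmless_def by blast

lemma pairwise_ok_harmless:
  assumes "pairwise_ok Xs" "X \<in> set Xs" "Y \<in> set Xs"
  shows "X = Y \<or> ok X Y \<or> ok Y X"
  using assms by (induction Xs rule: pairwise_ok.induct) (auto simp: list_all_iff)

text \<open>Only pairs with the same outer ring are at issue: for a mixed pair the region is the
  outer annulus, which the inner segment does not enter.\<close>

lemma compatible_harmless:
  assumes i: "i < 42" and ij: "i < j" "j \<in> set (compat_table ! i)"
    and T: "T \<in> set (DG ! i) \<union> set (DG ! j)" "act (set (DG ! i) \<union> set (DG ! j)) T"
    and U: "U \<in> set (DG ! i) \<union> set (DG ! j)" "act (set (DG ! i) \<union> set (DG ! j)) U"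
    and o: "outerT T = outerT U"
  shows "harmless T U"
proof -
  have j: "j < 42" using compat_table_lengths i ij by (force simp: list_all_iff)
  have jl: "j \<in> set (later_compatible i)" using ij by (simp add: later_compatible_def)
  have v: "valid_seg T" "valid_seg U" using T U valid_DG i j by blast+
  show ?thesis
  proof (cases "outerT T")
    case True
    have *: "harmless A B"
      if "k < 42" "l = k \<or> l \<in> set (later_compatible k)" "A \<in> set (DG ! k)" "B \<in> set (DG ! l)" "outerT A" "outerT B" "l < 42"
      for A B k l
    proof -
      have "ext A \<in> set (outer_row k)" "ext B \<in> set (outer_row l)" using that by (auto simp: set_rows)
      then have "ok (ext A) (ext B)"
        using outer_ok_all[OF that(1)] that(2) unfolding outer_row_ok_def list_all_iff by auto
      then show ?thesis using ok_harmless valid_DG that by metis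
    qed
    have O: "outerT T" "outerT U" using True o by simp_all
    consider "T \<in> set (DG ! i)" "U \<in> set (DG ! i)" | "T \<in> set (DG ! i)" "U \<in> set (DG ! j)"
      | "T \<in> set (DG ! j)" "U \<in> set (DG ! i)" | "T \<in> set (DG ! j)" "U \<in> set (DG ! j)"
      using T(1) U(1) by blast
    then show ?thesis
    proof cases
      case 1 then show ?thesis using *[OF i _ 1 O i] by blast
    next
      case 2 then show ?thesis using *[OF i _ 2 O j] jl by blast
    next
      case 3 then show ?thesis using *[OF i _ 3(2,1) O(2,1) j] jl harmless_sym by blast
    next
      case 4 then show ?thesis using *[OF j _ 4 O j] by blast
    qed
  next
    case False
    have pw: "pairwise_ok (map ext (active_inner i j))" using inner_ok_all[OF i] jl unfolding inner_row_ok_def list_all_iff by blast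
    have "A \<in> set (active_inner i j)"
      if "A \<in> set (DG ! i) \<union> set (DG ! j)" "act (set (DG ! i) \<union> set (DG ! j)) A" "\<not> outerT A" for A
      using that touches_points[OF that(1,3)] unfolding active_inner_def
      by (auto simp: set_rows(1,2))
    then have "ext T \<in> set (map ext (active_inner i j))" "ext U \<in> set (map ext (active_inner i j))"
      using T U False o unfolding set_map by blast+
    then have "ext T = ext U \<or> ok (ext T) (ext U) \<or> ok (ext U) (ext T)" using pairwise_ok_harmless[OF pw] by blast
    moreover have "T = U" if "ext T = ext U" using arg_cong[OF that, of fst] by simp
    ultimately show ?thesis using ok_harmless v o harmless_sym by (metis harmless_def)
  qed
qed

lemma compatible_gray:
  assumes i: "i < 42" and ij: "i < j" "j \<in> set (compat_table ! i)"
    and T: "T \<in> set (DG ! i)" "act (set (DG ! i) \<union> set (DG ! j)) T" "\<not> outerT T"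
    and U: "U \<in> set (DG ! j)" "act (set (DG ! i) \<union> set (DG ! j)) U" "\<not> outerT U"
    and l: "fst T = (0, k)" "fst U = (0, k)"
  shows "snd (snd T) mod 14 = snd (snd U) mod 14 \<or> upper_wedge (snd (snd T)) = upper_wedge (snd (snd U))"
proof -
  have jl: "j \<in> set (later_compatible i)" using ij by (simp add: later_compatible_def)
  have "T \<in> set (filter (touches (outer_points i @ outer_points j)) (inner_row i))"
    using touches_points[of T i j] T by (auto simp: set_rows(1,2))
  moreover have "U \<in> set (filter (touches (outer_points i @ outer_points j)) (inner_row j))"
    using touches_points[of U i j] U by (auto simp: set_rows(1,2))
  ultimately have "gray_ok T U"
    using gray_ok_all[OF i] jl unfolding gray_row_ok_def list_all_iff by blast
  then show ?thesis using l by (cases T; cases U; cases "snd T"; cases "snd U")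
    (auto split: if_splits)
qed

lemma DG_parity: "i < 42 \<Longrightarrow> T \<in> set (DG ! i) \<Longrightarrow> fst p \<noteq> 0 \<Longrightarrow> p = fst T \<or> p = snd T \<Longrightarrow> snd p mod 2 = fst p mod 2"
proof -
  have *: "list_all (list_all (\<lambda>((t, k), (u, l)). (t = 0 \<or> k mod 2 = t mod 2) \<and> l mod 2 = u mod 2)) DG"
    by (simp add: DG_def)
  assume a: "i < 42" "T \<in> set (DG ! i)" "fst p \<noteq> 0" "p = fst T \<or> p = snd T"
  then have "DG ! i \<in> set DG" using DG_valid(2) by simp
  then have "(\<lambda>((t, k), (u, l)). (t = 0 \<or> k mod 2 = t mod 2) \<and> l mod 2 = u mod 2) T"
    using * a(2) unfolding list_all_iff by blast
  then show ?thesis using a(3,4) by (cases T; cases "fst T"; cases "snd T") auto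
qed

text \<open>The code 99 marks a pair of inner segments. Outer segments are active anyway, but have
  to cross outside the inner polygon; inner segments have to be activated, and their crossing lies
  in the inner polygon anyway.\<close>

definition witness_test :: "nat \<Rightarrow> nat \<Rightarrow> nat \<Rightarrow> code_segment \<Rightarrow> code_segment \<Rightarrow> bool" where
  "witness_test i j e T U \<longleftrightarrow> cross_test (ext T) (ext U) \<and>
     (if e = 99 then \<not> outerT T \<and> \<not> outerT U \<and>
        touches (outer_points i @ outer_points j) T \<and> touches (outer_points i @ outer_points j) U
      else outerT T \<and> outerT U \<and> even e \<and> e < 28 \<and>
        beyond e (fst T, coord (fst T)) \<and> beyond e (snd T, coord (snd T)))"

definition witness_row_ok :: "nat \<Rightarrow> bool" where
  "witness_row_ok i \<longleftrightarrow> list_all (\<lambda>(j, p, q, e). p < 12 \<and> q < 12 \<and>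
     witness_test i j e ((DG ! i @ DG ! j) ! p) ((DG ! i @ DG ! j) ! q)) (witnesses ! i)"

lemma witness_ok_0:
  "list_all witness_row_ok [0..<6]"
  by code_simp

lemma witness_ok_1:
  "list_all witness_row_ok [6..<12]"
  by code_simp

lemma witness_ok_2:
  "list_all witness_row_ok [12..<20]"
  by code_simp

lemma witness_ok_3:
  "list_all witness_row_ok [20..<42]"
  by code_simp

lemmas witness_ok_all = chunks_all[OF witness_ok_0 witness_ok_1 witness_ok_2 witness_ok_3]

text \<open>Walks through n consecutive numbers while consuming two ascending lists; here the lists
  are the compatible later indices and the indices with a witness.\<close>

fun merge_covers :: "nat \<Rightarrow> nat \<Rightarrow> nat list \<Rightarrow> nat list \<Rightarrow> bool" where
  "merge_covers 0 x ys zs = True"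
| "merge_covers (Suc n) x ys zs = (if ys \<noteq> [] \<and> hd ys = x then merge_covers n (x + 1) (tl ys) zs
     else if zs \<noteq> [] \<and> hd zs = x then merge_covers n (x + 1) ys (tl zs) else False)"

lemma merge_covers: "merge_covers n x ys zs \<Longrightarrow> x \<le> y \<Longrightarrow> y < x + n \<Longrightarrow> y \<in> set ys \<or> y \<in> set zs"
proof (induction n x ys zs rule: merge_covers.induct)
  case (2 n x ys zs)
  then show ?case by (cases "x = y"; cases ys; cases zs) (auto split: if_splits)
qed simp

lemma merge_covers_witnesses:
  "list_all (\<lambda>i. merge_covers (41 - i) (i + 1) (later_compatible i) (map fst (witnesses ! i))) [0..<42]"
  by (code_simp)

lemma witnesses_complete:
  assumes "i < 42" "i < j" "j < 42" "j \<notin> set (compat_table ! i)"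
  shows "\<exists>p q e. (j, p, q, e) \<in> set (witnesses ! i)"
proof -
  have "merge_covers (41 - i) (i + 1) (later_compatible i) (map fst (witnesses ! i))"
    using merge_covers_witnesses assms(1) unfolding list_all_iff by simp
  then have "j \<in> set (later_compatible i) \<or> j \<in> set (map fst (witnesses ! i))"
    using assms by (intro merge_covers) auto
  then have "j \<in> set (map fst (witnesses ! i))" using assms by (simp add: later_compatible_def)
  then obtain w where "w \<in> set (witnesses ! i)" "j = fst w" by (auto simp: in_set_conv_nth)
  then show ?thesis by (cases w rule: prod_cases4) auto
qed

section \<open>The two polygons and their hulls\<close>

lemma zst_mod: "zst (t, n mod 28) = zst (t, n)"
proof -
  have "real (n mod 28 + 28 * (n div 28)) = real n" by (simp only: mod_mult_div_eq)
  then have n: "real n = real (n mod 28) + 28 * real (n div 28)"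
    by (simp only: of_nat_add of_nat_mult of_nat_numeral)
  have "real n * pi / 14 = real (n mod 28) * pi / 14 + 2 * pi * of_int (int (n div 28))"
    by (subst n) (simp add: field_simps)
  then have "\<exists>m::int. real n * pi / 14 = real (n mod 28) * pi / 14 + 2 * pi * of_int m" by (rule exI)
  then have "sin (real n * pi / 14) = sin (real (n mod 28) * pi / 14) \<and> cos (real n * pi / 14) = cos (real (n mod 28) * pi / 14)"
    using sin_cos_eq_iff by metis
  then show ?thesis by (simp add: complex_eq_iff)
qed

lemma zst_vertices: "n mod 2 = t mod 2 \<Longrightarrow> zst (t, n) \<in> vertices t"
proof -
  assume "n mod 2 = t mod 2"
  then have "n mod 28 < 28 \<and> n mod 28 mod 2 = t mod 2" by (simp add: mod_mod_cancel)
  moreover have "zst (t, n) = zst (t, n mod 28)" by (rule zst_mod[symmetric])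
  ultimately show ?thesis unfolding vertices_def by blast
qed

lemma zst_inner: "zst (t, k) \<bullet> cis (real e * pi / 14) = ring_radius t * cos ((real k - real e) * pi / 14)"
  by (simp add: inner_complex_def cos_diff left_diff_distrib diff_divide_distrib algebra_simps)

text \<open>An even direction points to the midpoint of an inner edge, and every inner vertex is an
  odd number of steps away from it; the product is largest at one step.\<close>

lemma inner_vertex_bound:
  assumes "v \<in> vertices 1" "even e"
  shows "v \<bullet> cis (real e * pi / 14) \<le> cos (pi / 14)"
proof -
  obtain k where k: "v = zst (1, k)" "odd k" using assms(1) unfolding vertices_def
    by (auto simp: odd_iff_mod_2_eq_one simp del: zst.simps)
  define m where "m = (if k \<ge> e then k - e else e - k)"
  have m: "odd m" using k(2) assms(2) by (auto simp: m_def)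
  have c: "cos ((real k - real e) * pi / 14) = cos (real m * pi / 14)"
  proof (cases "k \<ge> e")
    case False
    then have "(real k - real e) * pi / 14 = - (real m * pi / 14)" by (simp add: m_def of_nat_diff field_simps)
    then show ?thesis by (simp only: cos_minus)
  qed (simp add: m_def of_nat_diff)
  define n where "n = m mod 28"
  have n: "n < 28" "odd n" using m by (auto simp: n_def) presburger
  have cn: "cos (real m * pi / 14) = cos (real n * pi / 14)" unfolding n_def by (rule cos_mod_28[symmetric])
  have "cos (real n * pi / 14) \<le> cos (pi / 14)"
  proof (cases "n \<le> 14")
    case True
    have "1 \<le> n" using n(2) by (cases n) auto
    then show ?thesis using True by (intro cos_monotone_0_pi_le) (auto simp: field_simps)
  next
    case False
    have "real n * pi / 14 = 2 * pi - real (28 - n) * pi / 14" using n by (simp add: of_nat_diff field_simps)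
    then have "cos (real n * pi / 14) = cos (real (28 - n) * pi / 14)" by (simp only: cos_2pi_minus)
    also have "\<dots> \<le> cos (pi / 14)" using False n by (intro cos_monotone_0_pi_le) (auto simp: field_simps of_nat_diff)
    finally show ?thesis .
  qed
  then show ?thesis unfolding k(1) zst_inner c cn by (simp add: ring_radius_def)
qed

lemma beyond_bound:
  assumes "beyond e (p, coord p)" "fst p < 3" "snd p < 28" "e < 28" "even e"
  shows "zst p \<bullet> cis (real e * pi / 14) \<ge> cos (pi / 14)"
    "fst p = 2 \<Longrightarrow> zst p \<bullet> cis (real e * pi / 14) > cos (pi / 14)"
proof -
  obtain t k where p: "p = (t, k)" by (cases p)
  have two: "zst p \<bullet> cis (real e * pi / 14) > cos (pi / 14)" if t: "t = 2"
  proof -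
    define w where "w = zst (1, e)"
    have w: "cis (real e * pi / 14) = w" by (simp add: w_def ring_radius_def rcis_def)
    obtain x y u v where c: "coord p = (x, y)" "coord (1, e) = (u, v)" by (metis surj_pair)
    have ap: "approx (x, y) (zst p)" "approx (u, v) w"
      using coord_approx[of t k] coord_approx[of 1 e] assms(2) c unfolding p w_def by auto
    have num: "98000000 < x * u + y * v" using assms(1) t c by (simp add: p del: coord.simps)
    have w1: "\<bar>Re w\<bar> \<le> 1" "\<bar>Im w\<bar> \<le> 1" by (simp_all add: w_def ring_radius_def)
    have d: "\<bar>real_of_int x - 10^4 * Re (zst p)\<bar> \<le> 1" "\<bar>real_of_int y - 10^4 * Im (zst p)\<bar> \<le> 1"
      "\<bar>real_of_int u - 10^4 * Re w\<bar> \<le> 1" "\<bar>real_of_int v - 10^4 * Im w\<bar> \<le> 1"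
      using ap unfolding approx_def by simp_all
    have r: "- (1932 / 1000) \<le> Re (zst p)" "Re (zst p) \<le> 1932 / 1000" "- (1932 / 1000) \<le> Im (zst p)" "Im (zst p) \<le> 1932 / 1000"
      using ap(1) unfolding approx_def by blast+
    have b: "\<bar>real_of_int u\<bar> \<le> 10001" "\<bar>real_of_int v\<bar> \<le> 10001" "\<bar>10^4 * Re (zst p)\<bar> \<le> 19320" "\<bar>10^4 * Im (zst p)\<bar> \<le> 19320"
      using d(3,4) w1 r by (simp_all only: abs_le_iff; simp; linarith)+
    \<comment> \<open>29321 = 10001 + 19320 bounds the error of each product; two such errors still
      leave more than 97900000 of the 98000000.\<close>
    have "\<bar>real_of_int x * real_of_int u - (10^4 * Re (zst p)) * (10^4 * Re w)\<bar> \<le> 29321"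
      using abs_diff_mult_le[OF d(1,3)] b by linarith
    moreover have "\<bar>real_of_int y * real_of_int v - (10^4 * Im (zst p)) * (10^4 * Im w)\<bar> \<le> 29321"
      using abs_diff_mult_le[OF d(2,4)] b by linarith
    moreover have "real_of_int x * real_of_int u + real_of_int y * real_of_int v > 98000000"
      using num by (metis of_int_add of_int_less_iff of_int_mult of_int_numeral)
    ultimately have "10^8 * (zst p \<bullet> w) > 97900000"
      unfolding inner_complex_def by (simp only: distrib_left) (simp add: abs_le_iff del: zst.simps)
    moreover have "cos (pi / 14) < 975 / 1000"
      using cos_7th_bounds[of 1] by (simp add: abs_le_iff)
    ultimately show ?thesis unfolding w by simp
  qed
  have one: "zst p \<bullet> cis (real e * pi / 14) = cos (pi / 14)" if t: "t = 1"
  proof -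
    have "k = (e + 1) mod 28 \<or> k = (e + 27) mod 28" using assms(1) t by (simp add: p)
    then have "zst p = zst (1, e + 1) \<or> zst p = zst (1, e + 27)" using zst_mod t p by metis
    moreover have "cos (27 * pi / 14) = cos (pi / 14)"
    proof -
      have "27 * pi / 14 = 2 * pi - pi / 14" by simp
      then show ?thesis by (simp only: cos_2pi_minus)
    qed
    ultimately show ?thesis by (auto simp: zst_inner ring_radius_def simp del: zst.simps)
  qed
  obtain x y u v where "coord (t, k) = (x, y)" "coord (1, e) = (u, v)" by (metis surj_pair)
  then have "t \<noteq> 0" using assms(1) by (auto simp: p split: if_splits prod.splits simp del: coord.simps One_nat_def)
  then have "t = 1 \<or> t = 2" using assms(2) by (auto simp: p)
  then show "zst p \<bullet> cis (real e * pi / 14) \<ge> cos (pi / 14)" using one two by force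
  show "fst p = 2 \<Longrightarrow> zst p \<bullet> cis (real e * pi / 14) > cos (pi / 14)" using two by (simp add: p)
qed

lemma zero_in_outer_hull: "0 \<in> convex hull vertices 2"
proof -
  have "zst (2, 0) \<in> convex hull vertices 2" "zst (2, 14) \<in> convex hull vertices 2"
    by (intro hull_inc zst_vertices; simp)+
  then have "(1/2) *\<^sub>R zst (2, 0) + (1/2) *\<^sub>R zst (2, 14) \<in> convex hull vertices 2"
    by (intro convexD convex_convex_hull) auto
  moreover have "(1/2) *\<^sub>R zst (2, 0) + (1/2) *\<^sub>R zst (2, 14) = 0" by (simp add: complex_eq_iff)
  ultimately show ?thesis by simp
qed

text \<open>An inner vertex points to the midpoint of an outer edge, which is farther from the
  origin since kappa cos (pi / 14) > 1.\<close>

lemma inner_vertices_subset: "vertices 1 \<subseteq> convex hull vertices 2"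
proof
  fix z assume "z \<in> vertices 1"
  then obtain k where k: "z = zst (1, k)" "odd k" unfolding vertices_def
    by (auto simp: odd_iff_mod_2_eq_one simp del: zst.simps)
  have c: "cos (pi / 14) > 974 / 1000" using cos_7th_bounds[of 1] by (simp add: abs_le_iff)
  define x where "x = 1 / (kappa * cos (pi / 14))"
  have kc: "kappa * cos (pi / 14) > 1"
    using mult_strict_mono[OF kappa_bounds(1) c] kappa_pos by simp
  then have x: "0 \<le> x" "x \<le> 1" by (simp_all add: x_def)
  have "(k - 1) mod 2 = 2 mod (2::nat)" "(k + 1) mod 2 = 2 mod (2::nat)" using k(2) by presburger+
  then have "zst (2, k - 1) \<in> convex hull vertices 2" "zst (2, k + 1) \<in> convex hull vertices 2"
    by (intro hull_inc zst_vertices; simp)+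
  then have "(1/2) *\<^sub>R zst (2, k - 1) + (1/2) *\<^sub>R zst (2, k + 1) \<in> convex hull vertices 2"
    by (intro convexD convex_convex_hull) auto
  from convexD[OF convex_convex_hull zero_in_outer_hull this, of "1 - x" x] x have "(1 - x) *\<^sub>R 0 + x *\<^sub>R ((1/2) *\<^sub>R zst (2, k - 1) + (1/2) *\<^sub>R zst (2, k + 1)) \<in> convex hull vertices 2"
    by (simp del: zst.simps)
  moreover have "(1 - x) *\<^sub>R 0 + x *\<^sub>R ((1/2) *\<^sub>R zst (2, k - 1) + (1/2) *\<^sub>R zst (2, k + 1)) = z"
  proof -
    define y where "y = real k * pi / 14"
    have "1 \<le> k" using k(2) by (cases k) auto
    then have e: "real (k - 1) * pi / 14 = y - pi / 14" "real (k + 1) * pi / 14 = y + pi / 14"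
      by (simp_all add: y_def of_nat_diff field_simps)
    have "kappa * cos (pi / 14) \<noteq> 0" using kc by linarith
    then have x: "x * (kappa * cos (pi / 14)) = 1" by (simp add: x_def)
    have z: "z = cis y" by (simp add: k(1) y_def ring_radius_def rcis_def)
    have r: "ring_radius 2 = kappa" by (simp add: ring_radius_def)
    have "zst (2, k - 1) = rcis kappa (y - pi / 14)" "zst (2, k + 1) = rcis kappa (y + pi / 14)"
      unfolding zst.simps r e by (rule refl)+
    then have "zst (2, k - 1) + zst (2, k + 1) = (2 * (kappa * cos (pi / 14))) *\<^sub>R z"
      unfolding z by (simp only:) (simp add: complex_eq_iff cos_add sin_add cos_diff sin_diff algebra_simps)
    moreover have "(1 - x) *\<^sub>R 0 + x *\<^sub>R ((1/2) *\<^sub>R zst (2, k - 1) + (1/2) *\<^sub>R zst (2, k + 1)) =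
        (x / 2) *\<^sub>R (zst (2, k - 1) + zst (2, k + 1))"
      by (simp add: scaleR_add_right del: zst.simps)
    ultimately show ?thesis using x by (simp only: scaleR_scaleR) simp
  qed
  ultimately show "z \<in> convex hull vertices 2" by simp
qed

lemma seg_interior_subset:
  assumes "i < 42" "T \<in> set (DG ! i)"
  shows "seg_interior T \<subseteq> convex hull vertices 2" "\<not> outerT T \<Longrightarrow> seg_interior T \<subseteq> convex hull vertices 1"
proof -
  have v: "valid_seg T" by (rule valid_DG[OF assms])
  obtain t k u l where T: "T = ((t, k), (u, l))" by (metis surj_pair)
  have par: "t \<noteq> 0 \<Longrightarrow> k mod 2 = t mod 2" "l mod 2 = u mod 2"
    using DG_parity[OF assms, of "fst T"] DG_parity[OF assms, of "snd T"] v by (auto simp: T)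
  have z0: "0 \<in> convex hull vertices 1"
  proof -
    have "zst (1, 1) \<in> convex hull vertices 1" "zst (1, 15) \<in> convex hull vertices 1"
      by (intro hull_inc zst_vertices; simp)+
    then have "(1/2) *\<^sub>R zst (1, 1) + (1/2) *\<^sub>R zst (1, 15) \<in> convex hull vertices 1"
      by (intro convexD convex_convex_hull) auto
    moreover have e: "15 * pi / 14 = pi / 14 + pi" by simp
    have "cos (15 * pi / 14) = - cos (pi / 14)" "sin (15 * pi / 14) = - sin (pi / 14)" unfolding e by (rule cos_periodic_pi sin_periodic_pi)+
    then have "(1/2) *\<^sub>R zst (1, 1) + (1/2) *\<^sub>R zst (1, 15) = 0" by (simp add: complex_eq_iff)
    ultimately show ?thesis by simp
  qed
  have z: "zst (0, n) = 0" for n by (simp add: ring_radius_def)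
  have sub: "convex hull vertices 1 \<subseteq> convex hull vertices 2"
    using inner_vertices_subset by (simp add: hull_minimal)
  have inhull: "zst (t', n) \<in> convex hull vertices 2" "t' < 2 \<Longrightarrow> zst (t', n) \<in> convex hull vertices 1"
    if "t' < 3" "t' \<noteq> 0 \<longrightarrow> n mod 2 = t' mod 2" for t' n
  proof -
    have "t' = 0 \<or> t' = 1 \<or> t' = 2" using that(1) by linarith
    then show "zst (t', n) \<in> convex hull vertices 2"
      using that(2) zst_vertices[of n t'] z[of n] zero_in_outer_hull inner_vertices_subset hull_inc[of "zst (t', n)" "vertices 2" convex]
      by (elim disjE) (auto simp del: zst.simps)
    show "zst (t', n) \<in> convex hull vertices 1" if "t' < 2"
    proof -
      have "t' = 0 \<or> t' = 1" using that by linarith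
      then show ?thesis
        using \<open>t' \<noteq> 0 \<longrightarrow> n mod 2 = t' mod 2\<close> zst_vertices[of n t'] z[of n] z0 hull_inc[of "zst (t', n)" "vertices 1" convex]
        by (elim disjE) (auto simp del: zst.simps)
    qed
  qed
  have os: "open_segment a b \<subseteq> H" if "a \<in> H" "b \<in> H" "convex H" for a b :: complex and H
    using that closed_segment_subset segment_open_subset_closed[of a b] by blast
  show "seg_interior T \<subseteq> convex hull vertices 2"
    unfolding seg_interior_def T fst_conv snd_conv using v par inhull
    by (intro os convex_convex_hull inhull(1)) (auto simp: T)
  show "seg_interior T \<subseteq> convex hull vertices 1" if "\<not> outerT T"
    unfolding seg_interior_def T fst_conv snd_conv using v par that
    by (intro os convex_convex_hull inhull(2)) (auto simp: T)
qed

text \<open>Outer witnesses: the first segment lies beyond an inner edge, strictly so at its outer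
  endpoint. Hence its interior misses the half-plane containing the inner polygon, and the crossing
  is in the annulus.\<close>

lemma incompatible_crossing:
  assumes ij: "i < 42" "i < j" "j < 42" "j \<notin> set (compat_table ! i)"
  shows "\<exists>T U z. T \<in> set (DG ! i) \<union> set (DG ! j) \<and> U \<in> set (DG ! i) \<union> set (DG ! j) \<and>
     act (set (DG ! i) \<union> set (DG ! j)) T \<and> act (set (DG ! i) \<union> set (DG ! j)) U \<and> outerT T = outerT U \<and>
     seg_ends T \<noteq> seg_ends U \<and> z \<in> seg_interior T \<and> z \<in> seg_interior U \<and> (outerT T \<longrightarrow> z \<notin> convex hull vertices 1)"
proof -
  let ?D = "set (DG ! i) \<union> set (DG ! j)"
  obtain p q e where w: "(j, p, q, e) \<in> set (witnesses ! i)" using witnesses_complete[OF ij] by blast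
  have len: "length (DG ! i @ DG ! j) = 12"
  proof -
    have "list_all (\<lambda>d. length d = 6) DG" by (simp add: DG_def)
    then show ?thesis using DG_valid(2) ij by (simp add: list_all_length)
  qed
  have "p < 12" "q < 12" and wt: "witness_test i j e ((DG ! i @ DG ! j) ! p) ((DG ! i @ DG ! j) ! q)"
    using witness_ok_all[OF ij(1)] w unfolding witness_row_ok_def list_all_iff by fastforce+
  define T where "T = (DG ! i @ DG ! j) ! p"
  define U where "U = (DG ! i @ DG ! j) ! q"
  have TU: "T \<in> ?D" "U \<in> ?D"
    using nth_mem[of p "DG ! i @ DG ! j"] nth_mem[of q "DG ! i @ DG ! j"] len \<open>p < 12\<close> \<open>q < 12\<close>
    by (auto simp: T_def U_def)
  then have v: "valid_seg T" "valid_seg U" using valid_DG ij by blast+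
  obtain a b where Tab: "T = (a, b)" by (cases T)
  have ct: "cross_test (ext T) (ext U)"
    using wt unfolding T_def[symmetric] U_def[symmetric] witness_test_def by blast
  have rest: "if e = 99 then \<not> outerT T \<and> \<not> outerT U \<and> touches (outer_points i @ outer_points j) T
       \<and> touches (outer_points i @ outer_points j) U
     else outerT T \<and> outerT U \<and> even e \<and> e < 28 \<and> beyond e (a, coord a) \<and> beyond e (b, coord b)"
    using wt[unfolded T_def[symmetric] U_def[symmetric] witness_test_def, THEN conjunct2] unfolding Tab fst_conv snd_conv .
  obtain z where z: "z \<in> seg_interior T" "z \<in> seg_interior U" using cross_test(1)[OF ct v] by blast
  have ne: "seg_ends T \<noteq> seg_ends U" by (rule cross_test(2)[OF ct v])
  show ?thesis
  proof (cases "e = 99")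
    case True
    then have "act ?D T" "act ?D U" "\<not> outerT T" "\<not> outerT U"
      using rest touches_points[OF TU(1)] touches_points[OF TU(2)] by auto
    then show ?thesis using TU z ne by blast
  next
    case False
    then have e: "outerT T" "outerT U" "even e" "e < 28" "beyond e (a, coord a)" "beyond e (b, coord b)"
      using rest by (simp_all only: if_False)
    have ab: "fst a < 3" "snd a < 28" "fst b < 3" "snd b < 28" using v(1) unfolding Tab by (cases a; cases b; simp)+
    have "zst a \<bullet> cis (real e * pi / 14) \<ge> cos (pi / 14)" "zst b \<bullet> cis (real e * pi / 14) > cos (pi / 14)"
      using beyond_bound[OF e(5) ab(1,2) e(4,3)] beyond_bound[OF e(6) ab(3,4) e(4,3)] e(1) unfolding Tab by simp_all
    moreover obtain x where "0 < x" "x < 1" "z = (1 - x) *\<^sub>R zst a + x *\<^sub>R zst b"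
      using z(1) unfolding seg_interior_def Tab by (auto simp: in_segment)
    ultimately have "z \<bullet> cis (real e * pi / 14) > (1 - x) * cos (pi / 14) + x * cos (pi / 14)"
      by (simp add: inner_add_left) (intro add_le_less_mono mult_left_mono mult_strict_left_mono; simp)
    then have "z \<bullet> cis (real e * pi / 14) > cos (pi / 14)" by (simp add: algebra_simps)
    moreover have "convex hull vertices 1 \<subseteq> {z. z \<bullet> cis (real e * pi / 14) \<le> cos (pi / 14)}"
    proof (rule hull_minimal)
      show "vertices 1 \<subseteq> {z. z \<bullet> cis (real e * pi / 14) \<le> cos (pi / 14)}"
        using inner_vertex_bound e(3) by blast
      show "convex {z. z \<bullet> cis (real e * pi / 14) \<le> cos (pi / 14)}"
        using convex_halfspace_le[of "cis (real e * pi / 14)" "cos (pi / 14)"] by (simp add: inner_commute)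
    qed
    ultimately have "z \<notin> convex hull vertices 1" by auto
    then show ?thesis using TU z ne e(1,2) unfolding act_def by blast
  qed
qed

section \<open>From the tables to the criterion\<close>

text \<open>Uniqueness behind \<open>ring_vertices\<close>: rotating any one vertex recovers the
  whole polygon.\<close>

lemma regular_polygon_through:
  assumes "regular_polygon n R V" "v \<in> V" "n > 0"
  shows "V = (\<lambda>j. v * cis (2 * pi * real j / real n)) ` {..<n}"
proof -
  obtain u where u: "V = (\<lambda>j. u * cis (2 * pi * real j / real n)) ` {..<n}"
    using assms(1) unfolding regular_polygon_def by blast
  then obtain j0 where j0: "j0 < n" "v = u * cis (2 * pi * real j0 / real n)" using assms(2) by auto
  define e where "e j = cis (2 * pi * real j / real n)" for j :: nat
  have j0': "v = u * e j0" using j0(2) by (simp add: e_def)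
  have e_add: "e i * e j = e (i + j)" for i j
    by (simp add: e_def cis_mult distrib_left add_divide_distrib)
  have e_mod: "e (j mod n) = e j" for j
  proof -
    have "e (n * q) = 1" for q
    proof -
      have "2 * pi * real (n * q) / real n = 0 + 2 * pi * of_int (int q)" using assms(3) by simp
      then show ?thesis unfolding e_def using sin_cos_eq_iff[of "2 * pi * real (n * q) / real n" 0]
        by (metis cis.ctr cis_zero cos_zero sin_zero)
    qed
    then show ?thesis using e_add[of "n * (j div n)" "j mod n"] by simp
  qed
  have uv: "u = v * e (n - j0)"
  proof -
    have "e j0 * e (n - j0) = e (n mod n)" using e_add[of j0 "n - j0"] j0(1) e_mod[of n] by simp
    also have "\<dots> = 1" by (simp add: e_def)
    finally show ?thesis by (simp add: j0' mult.assoc)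
  qed
  have V: "V = (\<lambda>j. u * e j) ` {..<n}" using u by (simp add: e_def)
  have "V = (\<lambda>j. v * e j) ` {..<n}"
  proof
    show "V \<subseteq> (\<lambda>j. v * e j) ` {..<n}"
    proof
      fix w assume "w \<in> V"
      then obtain j where "w = u * e j" using V by blast
      then have "w = v * e ((n - j0 + j) mod n)" by (simp add: uv mult.assoc e_add e_mod)
      moreover have "(n - j0 + j) mod n < n" using assms(3) by simp
      ultimately show "w \<in> (\<lambda>j. v * e j) ` {..<n}" by blast
    qed
    show "(\<lambda>j. v * e j) ` {..<n} \<subseteq> V"
    proof
      fix w assume "w \<in> (\<lambda>j. v * e j) ` {..<n}"
      then obtain j where "w = v * e j" by blast
      then have "w = u * e ((j0 + j) mod n)" by (simp add: j0' mult.assoc e_add e_mod)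
      moreover have "(j0 + j) mod n < n" using assms(3) by simp
      ultimately show "w \<in> V" unfolding V by blast
    qed
  qed
  then show ?thesis by (simp add: e_def)
qed

lemma zst_inj:
  assumes "valid_code (t, k)" "valid_code (u, l)" "t \<noteq> 0" "zst (t, k) = zst (u, l)"
  shows "(t, k) = (u, l)"
proof -
  have "cmod (zst (t, k)) = ring_radius t" "cmod (zst (u, l)) = ring_radius u"
    using kappa_pos by (simp_all add: ring_radius_def)
  then have "ring_radius t = ring_radius u" using assms(4) by metis
  then have tu: "t = u" using assms(1-3) kappa_bounds by (auto simp: ring_radius_def split: if_splits)
  have rr: "ring_radius t > 0" using assms(3) kappa_pos by (simp add: ring_radius_def)
  have "ring_radius t \<noteq> 0" using rr by simp
  then have "cis (real k * pi / 14) = cis (real l * pi / 14)"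
    using assms(4) unfolding zst.simps rcis_def tu by simp
  then obtain n :: int where n: "real k * pi / 14 = real l * pi / 14 + 2 * pi * of_int n"
    using sin_cos_eq_iff by (metis cis.simps)
  then have "real k * pi = (real l + 28 * of_int n) * pi" by (simp add: field_simps)
  then have "real k = real l + 28 * of_int n" by (simp only: mult_cancel_right pi_neq_zero simp_thms)
  then have e: "int k = int l + 28 * n" by linarith
  have "k < 28" "l < 28" using assms(1,2) by simp_all
  then have "n = 0" using e by linarith
  then show ?thesis using e tu by simp
qed

lemma valid_seg_codes: "valid_seg T \<Longrightarrow> valid_code (fst T) \<and> valid_code (snd T) \<and> fst (snd T) \<noteq> 0 \<and> fst T \<noteq> snd T
    \<and> fst (fst T) \<le> fst (snd T)"
  by (cases T; cases "fst T"; cases "snd T") auto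

lemma zst_ends_distinct:
  assumes "valid_seg T"
  shows "zst (fst T) \<noteq> zst (snd T)"
proof -
  obtain t k u l where T: "T = ((t, k), (u, l))" by (metis surj_pair)
  show ?thesis using zst_inj[of u l t k] assms unfolding T by (auto simp del: zst.simps)
qed

context E6_diagram
begin

text \<open>Scaling by r, preceded, if the half \<open>True\<close> is S_-, by the reflection that
  takes angle \<theta> to 3 pi / 14 - \<theta> and so exchanges L'_+ and L'_-.\<close>

definition iso :: "complex \<Rightarrow> complex" where
  "iso z = of_real r * (if plus then z else cis (3 * pi / 14) * cnj z)"

lemma linear_iso: "linear iso"
  by (rule linearI) (simp_all add: iso_def algebra_simps scaleR_conv_of_real)

lemma inj_iso: "inj iso"
  using r_pos by (auto simp: inj_def iso_def)

lemma loc_pt: "loc (pt p) = iso (zst p)"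
proof -
  obtain t k where p: "p = (t, k)" by (cases p)
  have "iso (zst (t, k)) = rcis (r * ring_radius t) (point_angle k)"
  proof (cases plus)
    case True
    then show ?thesis by (simp add: iso_def rcis_def point_angle_def)
  next
    case False
    have "cis (3 * pi / 14) * cnj (cis (real k * pi / 14)) = cis (point_angle k)"
      using False by (simp add: cis_cnj cis_mult point_angle_def left_diff_distrib diff_divide_distrib)
    then show ?thesis using False by (simp add: iso_def rcis_def mult_ac)
  qed
  then show ?thesis by (simp add: p pt_def ring_radius_def rcis_def)
qed

lemma cmod_loc: "cmod (loc (pt p)) = r * ring_radius (fst p)"
proof -
  have "cmod (iso z) = r * cmod z" for z using r_pos by (simp add: iso_def norm_mult)
  moreover have "cmod (zst p) = ring_radius (fst p)"
    using kappa_pos by (cases p) (simp add: ring_radius_def)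
  ultimately show ?thesis by (simp add: loc_pt)
qed

lemma ring_radius_mono: "t \<le> u \<Longrightarrow> u < 3 \<Longrightarrow> ring_radius t \<le> ring_radius u"
  using kappa_bounds by (auto simp: ring_radius_def)

lemma outer_radius_seg:
  assumes "valid_seg T"
  shows "outer_radius (seg T) = r * ring_radius (fst (snd T))"
proof -
  have "fst (fst T) \<le> fst (snd T)" "fst (snd T) < 3"
    using valid_seg_codes[OF assms] by (auto, metis prod.collapse valid_code.simps)
  then have "r * ring_radius (fst (fst T)) \<le> r * ring_radius (fst (snd T))"
    using ring_radius_mono r_pos by simp
  then show ?thesis unfolding outer_radius_def seg_def by (simp add: cmod_loc max_def)
qed

text \<open>Labels keep the origin points apart, so a shared endpoint of two segments is the same as
  a shared code.\<close>

lemma pt_inj: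
  assumes "valid_code p" "valid_code q" "pt p = pt q"
  shows "p = q"
proof -
  obtain t k u l where pq: "p = (t, k)" "q = (u, l)" by (metis surj_pair)
  show ?thesis
  proof (cases "t = 0")
    case True
    then have u: "u = 0" using assms(3) by (auto simp: pt_def pq split: if_splits)
    then have kl: "k < 3" "l < 3" using assms True pq by simp_all
    have "s *\<^sub>R vec (origin_weights ! k) = s *\<^sub>R vec (origin_weights ! l)"
      using assms(3) True u by (simp add: pt_def pq)
    then have "origin_weights ! k = origin_weights ! l"
      using s_pos vec_eq_iff origin_weights_half(2) kl by simp
    moreover have "distinct origin_weights" "length origin_weights = 3" by (simp_all add: origin_weights_def)
    ultimately have "k = l" using kl nth_eq_iff_index_eq by metis
    then show ?thesis using True u pq by simp
  next
    case False
    have "iso (zst p) = iso (zst q)" using assms(3) loc_pt by metis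
    then have "zst p = zst q" using inj_iso by (simp only: inj_eq)
    then show ?thesis using zst_inj[of t k u l] assms False unfolding pq by blast
  qed
qed

lemma radii: "kappa * r > r" "r > 0" "ring_radius 1 = 1" "ring_radius 2 = kappa"
  using kappa_bounds r_pos by (simp_all add: ring_radius_def)

lemma next_larger_radii: "next_larger (ring_radii S c X) R q \<longleftrightarrow> R = kappa * r \<and> q = r"
  using radii by (auto simp: next_larger_def ring_radii_eq)

lemma max_radii: "Max (ring_radii S c X) = kappa * r" "Min (ring_radii S c X) = r"
  using radii by (auto simp: ring_radii_eq max_def min_def)

lemma outer_radius_iff:
  assumes "valid_seg T"
  shows "outer_radius (seg T) = kappa * r \<longleftrightarrow> outerT T" "outer_radius (seg T) = r \<longleftrightarrow> \<not> outerT T"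
proof -
  have "fst (snd T) \<noteq> 0" "valid_code (snd T)" using valid_seg_codes[OF assms] by auto
  then have "fst (snd T) = 1 \<or> fst (snd T) = 2" by (cases "snd T") auto
  then show "outer_radius (seg T) = kappa * r \<longleftrightarrow> outerT T" "outer_radius (seg T) = r \<longleftrightarrow> \<not> outerT T"
    unfolding outer_radius_seg[OF assms] using radii by (auto simp: mult.commute)
qed

lemma seg_meet:
  assumes "valid_seg T" "valid_seg U" "seg T \<inter> seg U \<noteq> {}"
  shows "{fst T, snd T} \<inter> {fst U, snd U} \<noteq> {}"
proof -
  obtain A where A: "A \<in> seg T" "A \<in> seg U" using assms(3) by blast
  obtain p where "p \<in> {fst T, snd T}" "A = pt p" using A(1) unfolding seg_def by blast
  moreover obtain q where "q \<in> {fst U, snd U}" "A = pt q" using A(2) unfolding seg_def by blast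
  moreover have "valid_code x" if "x \<in> {fst T, snd T}" for x using that valid_seg_codes[OF assms(1)] by auto
  moreover have "valid_code x" if "x \<in> {fst U, snd U}" for x using that valid_seg_codes[OF assms(2)] by auto
  ultimately show ?thesis using pt_inj by blast
qed

text \<open>\<open>next_larger\<close> relates only the two radii, so an activating segment must
  reach the outer ring, and chains stop after one step.\<close>

lemma active_seg:
  assumes D: "\<And>T. T \<in> D \<Longrightarrow> valid_seg T"
  shows "A \<in> active (ring_radii S c X) (seg ` D) \<longleftrightarrow> (\<exists>T\<in>D. A = seg T \<and> act D T)"
proof
  show "A \<in> active (ring_radii S c X) (seg ` D) \<Longrightarrow> \<exists>T\<in>D. A = seg T \<and> act D T"
  proof (induction rule: active.induct)
    case (outermost T)
    then show ?case using outer_radius_iff(1) D unfolding max_radii act_def by blast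
  next
    case (inner T T')
    then obtain U V where UV: "U \<in> D" "T = seg U" "V \<in> D" "T' = seg V" by blast
    then have "outerT V" using inner outer_radius_iff(1) D next_larger_radii by metis
    moreover have "{fst U, snd U} \<inter> {fst V, snd V} \<noteq> {}" using seg_meet D UV inner by blast
    ultimately show ?case using UV unfolding act_def by blast
  qed
next
  assume "\<exists>T\<in>D. A = seg T \<and> act D T"
  then obtain T where T: "T \<in> D" "A = seg T" "act D T" by blast
  have o: "seg U \<in> active (ring_radii S c X) (seg ` D)" if "U \<in> D" "outerT U" for U
    using that outer_radius_iff(1)[of U] D by (intro active.outermost) (auto simp: max_radii)
  show "A \<in> active (ring_radii S c X) (seg ` D)"
  proof (cases "outerT T")
    case False
    then obtain U where U: "U \<in> D" "outerT U" "{fst T, snd T} \<inter> {fst U, snd U} \<noteq> {}"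
      using T(3) unfolding act_def by blast
    then have "seg T \<inter> seg U \<noteq> {}" by (auto simp: seg_def)
    then show ?thesis
      using T(1,2) o[OF U(1,2)] False outer_radius_iff D U(1,2)
      by (intro active.inner[of A _ "seg U"]) (auto simp: next_larger_radii)
  qed (use T o in simp)
qed

lemma cross_within_seg:
  assumes "valid_seg T" "valid_seg U"
  shows "cross_within (iso ` Y) (seg T) (seg U) \<longleftrightarrow>
    seg_ends T \<noteq> seg_ends U \<and> (\<exists>z\<in>Y. z \<in> seg_interior T \<and> z \<in> seg_interior U)"
proof -
  have ri: "rel_interior (convex hull (loc ` seg V)) = iso ` seg_interior V" "loc ` seg V = iso ` seg_ends V"
    if "valid_seg V" for V
  proof -
    have "iso (zst (fst V)) \<noteq> iso (zst (snd V))"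
      using zst_ends_distinct[OF that] inj_iso by (simp add: inj_eq)
    then show "rel_interior (convex hull (loc ` seg V)) = iso ` seg_interior V"
      using open_segment_linear_image[OF linear_iso inj_iso, of "zst (fst V)" "zst (snd V)"]
      by (simp add: seg_def seg_interior_def loc_pt rel_interior_closed_segment flip: segment_convex_hull)
    show "loc ` seg V = iso ` seg_ends V" by (simp add: seg_def seg_ends_def loc_pt)
  qed
  have "loc ` seg T = loc ` seg U \<longleftrightarrow> seg_ends T = seg_ends U"
    unfolding ri(2)[OF assms(1)] ri(2)[OF assms(2)] using inj_iso by (simp add: inj_image_eq_iff)
  moreover have "iso ` seg_interior T \<inter> iso ` seg_interior U \<inter> iso ` Y = iso ` (seg_interior T \<inter> seg_interior U \<inter> Y)"
    using inj_iso by (simp add: image_Int)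
  ultimately show ?thesis
    unfolding cross_within_def ri(1)[OF assms(1)] ri(1)[OF assms(2)] by auto
qed

lemma vertices_polygon:
  assumes "t = 1 \<or> t = 2"
  shows "regular_polygon 14 (r * ring_radius t) (iso ` vertices t)"
proof -
  define k0 where "k0 = t mod 2"
  have k0: "k0 < 2" by (simp add: k0_def)
  define R where "R = r * ring_radius t"
  have R: "R > 0" using assms radii r_pos kappa_pos by (auto simp: R_def)
  have iz: "iso (zst (t, k)) = of_real R * cis (point_angle k)" for k
    using loc_pt[of "(t, k)"] assms by (auto simp: pt_def R_def rcis_def simp del: zst.simps)
  have V: "vertices t = (\<lambda>j. zst (t, k0 + 2 * j)) ` {..<14}"
  proof
    show "vertices t \<subseteq> (\<lambda>j. zst (t, k0 + 2 * j)) ` {..<14}"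
    proof
      fix z assume "z \<in> vertices t"
      then obtain k where k: "z = zst (t, k)" "k < 28" "k mod 2 = k0" unfolding vertices_def k0_def by blast
      then have "k = k0 + 2 * (k div 2)" "k div 2 < 14" by auto
      then show "z \<in> (\<lambda>j. zst (t, k0 + 2 * j)) ` {..<14}" using k(1) by (metis imageI lessThan_iff)
    qed
    show "(\<lambda>j. zst (t, k0 + 2 * j)) ` {..<14} \<subseteq> vertices t"
    proof
      fix z assume "z \<in> (\<lambda>j. zst (t, k0 + 2 * j)) ` {..<14}"
      then obtain j where "z = zst (t, k0 + 2 * j)" by blast
      moreover have "(k0 + 2 * j) mod 2 = t mod 2" by (simp add: k0_def)
      ultimately show "z \<in> vertices t" using zst_vertices by metis
    qed
  qed
  show ?thesis
  proof (cases plus)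
    case True
    have "iso (zst (t, k0 + 2 * j)) = of_real R * cis (point_angle k0) * cis (2 * pi * real j / real 14)" for j
      unfolding iz mult.assoc cis_mult using True by (simp add: point_angle_def field_simps)
    then have "iso ` vertices t = (\<lambda>j. of_real R * cis (point_angle k0) * cis (2 * pi * real j / real 14)) ` {..<14}"
      unfolding V image_image by (simp only:)
    moreover have "cmod (of_real R * cis (point_angle k0)) = R" using R by (simp add: norm_mult)
    ultimately show ?thesis unfolding regular_polygon_def R_def by blast
  next
    case False
    \<comment> \<open>In the mirrored picture indices run clockwise, so the vertices are listed
      backwards, starting from index k0 + 26.\<close>
    have e: "iso (zst (t, k0 + 2 * (13 - j))) = of_real R * cis (point_angle (k0 + 26)) * cis (2 * pi * real j / real 14)"
      if "j < 14" for j
    proof -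
      have "real (13 - j) = 13 - real j" using that by (simp add: of_nat_diff)
      then have "point_angle (k0 + 2 * (13 - j)) = point_angle (k0 + 26) + 2 * pi * real j / real 14"
        using False by (simp add: point_angle_def field_simps)
      then show ?thesis unfolding iz mult.assoc cis_mult by (simp only:)
    qed
    have h: "(\<lambda>j. 13 - j) ` {..<14} = {..<14::nat}"
    proof
      show "{..<14::nat} \<subseteq> (\<lambda>j. 13 - j) ` {..<14}"
      proof
        fix j :: nat assume "j \<in> {..<14}"
        then have "j = 13 - (13 - j)" "13 - j \<in> {..<14}" by auto
        then show "j \<in> (\<lambda>j. 13 - j) ` {..<14}" by blast
      qed
    qed auto
    have "iso ` vertices t = (\<lambda>j. iso (zst (t, k0 + 2 * j))) ` {..<14}"
      unfolding V image_image by (rule refl)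
    also have "\<dots> = (\<lambda>j. iso (zst (t, k0 + 2 * j))) ` (\<lambda>j. 13 - j) ` {..<14}"
      by (simp only: h)
    also have "\<dots> = (\<lambda>j. of_real R * cis (point_angle (k0 + 26)) * cis (2 * pi * real j / real 14)) ` {..<14}"
      unfolding image_image using e by (intro image_cong) auto
    finally have "iso ` vertices t = (\<lambda>j. of_real R * cis (point_angle (k0 + 26)) * cis (2 * pi * real j / real 14)) ` {..<14}" .
    moreover have "cmod (of_real R * cis (point_angle (k0 + 26))) = R" using R by (simp add: norm_mult)
    ultimately show ?thesis unfolding regular_polygon_def R_def by blast
  qed
qed

text \<open>Each ring carries a point of the orbit, and that one vertex determines the
  polygon.\<close>

lemma ring_vertices_eq:
  assumes t: "t = 1 \<or> t = 2"
  shows "ring_vertices S c X (r * ring_radius t) = iso ` vertices t"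
proof -
  let ?R = "r * ring_radius t"
  define H where "H = {z. Vertex z \<in> hat S c ` X \<and> cmod z = ?R}"
  have hX: "hat S c ` X = pt ` weight_point ` snd ` set weight_codes"
  proof -
    have "hat S c ` X = (\<lambda>(m, p). hat S c (s *\<^sub>R vec m)) ` set weight_codes"
      unfolding X_def weight_codes_W27[symmetric] set_map image_image by (simp add: case_prod_unfold)
    also have "\<dots> = (\<lambda>x. pt (weight_point (snd x))) ` set weight_codes"
      by (intro image_cong refl) (auto simp: hat_weight)
    finally show ?thesis by (simp add: image_image)
  qed
  have par: "list_all (\<lambda>x. fst (weight_point (snd x)) < 3 \<and> (fst (weight_point (snd x)) \<noteq> 0 \<longrightarrow>
      snd (weight_point (snd x)) mod 2 = fst (weight_point (snd x)) mod 2)) weight_codes"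
    by (simp add: weight_codes_def weight_point_def)
  have "H \<subseteq> iso ` vertices t"
  proof
    fix z assume "z \<in> H"
    then obtain x where x: "x \<in> set weight_codes" "Vertex z = pt (weight_point (snd x))" "cmod z = ?R"
      unfolding H_def hX by auto
    obtain u k where uk: "weight_point (snd x) = (u, k)" by (cases "weight_point (snd x)")
    have z: "z = iso (zst (u, k))" using x(2) uk loc_pt[of "(u, k)"] by (metis loc.simps(2))
    have u: "u < 3" "u \<noteq> 0 \<longrightarrow> k mod 2 = u mod 2" using par x(1) uk unfolding list_all_iff by auto
    have "r * ring_radius u = r * ring_radius t"
      using cmod_loc[of "(u, k)"] x(3) loc_pt[of "(u, k)"] z by simp
    then have "u = t" using t u(1) radii kappa_bounds r_pos by (auto simp: ring_radius_def split: if_splits)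
    moreover have "k mod 2 = u mod 2" using u t \<open>u = t\<close> by auto
    then have "zst (u, k) \<in> vertices u" by (rule zst_vertices)
    ultimately show "z \<in> iso ` vertices t" unfolding z by simp
  qed
  moreover have "H \<noteq> {}"
  proof -
    define x :: "int list \<times> nat \<times> nat" where "x = (if t = 1 then (W27 ! 4, 1, 1) else (W27 ! 0, 2, 24 :: nat))"
    have "x \<in> set weight_codes" by (simp add: x_def weight_codes_def W27_def)
    moreover obtain k where k: "weight_point (snd x) = (t, k)" using t by (auto simp: x_def weight_point_def)
    ultimately have "pt (t, k) \<in> hat S c ` X" unfolding hX by (metis image_eqI)
    moreover have "pt (t, k) = Vertex (loc (pt (t, k)))" using t by (auto simp: pt_def)
    ultimately have "loc (pt (t, k)) \<in> H" unfolding H_def using cmod_loc[of "(t, k)"] by simp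
    then show ?thesis by blast
  qed
  ultimately show ?thesis
    unfolding ring_vertices_def H_def[symmetric]
  proof (intro the_equality)
    assume H: "H \<subseteq> iso ` vertices t" "H \<noteq> {}"
    show "regular_polygon (coxeter_number S + 2) ?R (iso ` vertices t) \<and> H \<subseteq> iso ` vertices t"
      using vertices_polygon[OF t] H by (simp add: coxeter_number_eq)
    fix V assume V: "regular_polygon (coxeter_number S + 2) ?R V \<and> H \<subseteq> V"
    obtain v where "v \<in> H" using H by blast
    then have v: "v \<in> V" "v \<in> iso ` vertices t" using V H by blast+
    have "regular_polygon 14 ?R V" using V by (simp add: coxeter_number_eq)
    from regular_polygon_through[OF this v(1)] regular_polygon_through[OF vertices_polygon[OF t] v(2)]
    show "V = iso ` vertices t" by simp
  qed
qed

lemma annulus_eq: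
  "annulus S c X r = iso ` (convex hull vertices 1)"
  "annulus S c X (kappa * r) = iso ` (convex hull vertices 2 - convex hull vertices 1)"
proof -
  have rv: "ring_vertices S c X r = iso ` vertices 1" "ring_vertices S c X (kappa * r) = iso ` vertices 2"
    using ring_vertices_eq[of 1] ring_vertices_eq[of 2] radii by (simp_all add: mult.commute)
  have h: "convex hull (iso ` V) = iso ` (convex hull V)" for V
    by (rule convex_hull_linear_image[OF linear_iso, symmetric])
  have e1: "{q. next_larger (ring_radii S c X) r q} = {}" using radii by (auto simp: next_larger_radii)
  show "annulus S c X r = iso ` (convex hull vertices 1)"
    unfolding annulus_def e1 by (simp add: rv h)
  have e2: "{q. next_larger (ring_radii S c X) (kappa * r) q} = {r}" by (auto simp: next_larger_radii)
  show "annulus S c X (kappa * r) = iso ` (convex hull vertices 2 - convex hull vertices 1)"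
    unfolding annulus_def e2 by (simp add: rv h image_set_diff[OF inj_iso])
qed

section \<open>The gray zone\<close>

lemma inner_mirror:
  "rcis R (point_angle l) \<bullet> mirror_dir 14 (sg b) = R * cos (of_int (int l - (if b then 1 else 2)) * pi / 14)"
proof -
  define M where "M = (if b = plus then 1 else 2 :: real)"
  define M' where "M' = (if b then 1 else 2 :: int)"
  have "rcis R (point_angle l) \<bullet> mirror_dir 14 (sg b) = R * cos (point_angle l - M * pi / 14)"
    by (simp add: mirror_sg M_def[symmetric] inner_complex_def rcis_def cos_diff algebra_simps)
  also have "cos (point_angle l - M * pi / 14) = cos (of_int (int l - M') * pi / 14)"
  proof (cases plus)
    case True
    then have "point_angle l - M * pi / 14 = of_int (int l - M') * pi / 14"
      by (simp add: point_angle_def M_def M'_def field_simps)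
    then show ?thesis by (simp only:)
  next
    case False
    then have "point_angle l - M * pi / 14 = - (of_int (int l - M') * pi / 14)"
      by (simp add: point_angle_def M_def M'_def field_simps)
    then show ?thesis by (simp only: cos_minus)
  qed
  finally show ?thesis unfolding M'_def .
qed

text \<open>The wedges are closed, so the opposite wedge is excluded by a strict inequality for one
  of the two mirrors. Vertices 8, 9, 22 and 23 are perpendicular to one mirror and need the other
  one.\<close>

lemma wedge_side:
  assumes "R > 0" "l < 28"
  shows "upper_wedge l \<Longrightarrow> rcis R (point_angle l) \<notin> obtuse_wedge 14 Minus"
    "\<not> upper_wedge l \<Longrightarrow> rcis R (point_angle l) \<notin> obtuse_wedge 14 Plus"
proof -
  have pos: "cos (of_int m * pi / 14) > 0" if "\<bar>m\<bar> < 7" for m :: int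
  proof (rule cos_gt_zero_pi)
    have "\<bar>real_of_int m\<bar> < 7" using that by linarith
    then have "- 7 < real_of_int m" "real_of_int m < 7" by linarith+
    note this[THEN mult_strict_left_mono, OF pi_gt_zero]
    then show "- (pi / 2) < of_int m * pi / 14" "of_int m * pi / 14 < pi / 2"
      by (simp_all add: field_simps)
  qed
  have neg: "cos (of_int m * pi / 14) < 0" if "\<bar>m - 14\<bar> < 7" for m :: int
  proof -
    have "of_int m * pi / 14 = of_int (m - 14) * pi / 14 + pi" by (simp add: field_simps)
    then have "cos (of_int m * pi / 14) = - cos (of_int (m - 14) * pi / 14)" by (simp only: cos_periodic_pi)
    then show ?thesis using pos[OF that] by simp
  qed
  have per: "cos (of_int m * pi / 14) = cos (of_int (m - 28) * pi / 14)" for m :: int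
  proof -
    have "of_int m * pi / 14 = of_int (m - 28) * pi / 14 + 2 * pi" by (simp add: field_simps)
    then show ?thesis by (simp only: cos_periodic)
  qed
  show "rcis R (point_angle l) \<notin> obtuse_wedge 14 Minus" if "upper_wedge l"
  proof -
    have "\<exists>b. cos (of_int (int l - (if b then 1 else 2)) * pi / 14) > 0"
    proof -
      have "l \<le> 7 \<or> l = 8 \<or> 23 \<le> l" using that unfolding upper_wedge_def by linarith
      then consider "l \<le> 7" | "l = 8" | "23 \<le> l" by blast
      then show ?thesis
      proof cases
        case 1
        then show ?thesis using pos[of "int l - 1"] by (intro exI[of _ True]) simp
      next
        case 2
        then show ?thesis using pos[of "int l - 2"] by (intro exI[of _ False]) simp
      next
        case 3
        then show ?thesis using pos[of "int l - 1 - 28"] per[of "int l - 1"] assms(2) by (intro exI[of _ True]) simp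
      qed
    qed
    then obtain b where b: "cos (of_int (int l - (if b then 1 else 2)) * pi / 14) > 0" ..
    have "rcis R (point_angle l) \<bullet> mirror_dir 14 (sg b) > 0"
      unfolding inner_mirror using assms(1) b by (rule mult_pos_pos)
    then show ?thesis unfolding obtuse_wedge_def by (auto simp: not_le)
  qed
  show "rcis R (point_angle l) \<notin> obtuse_wedge 14 Plus" if "\<not> upper_wedge l"
  proof -
    have l: "9 \<le> l" "l \<le> 22" using that by (auto simp: upper_wedge_def)
    have "\<exists>b. cos (of_int (int l - (if b then 1 else 2)) * pi / 14) < 0"
    proof (cases "l \<le> 20")
      case True
      then show ?thesis using neg[of "int l - 1"] l by (intro exI[of _ True]) simp
    next
      case False
      then show ?thesis using neg[of "int l - 2"] l by (intro exI[of _ False]) simp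
    qed
    then obtain b where b: "cos (of_int (int l - (if b then 1 else 2)) * pi / 14) < 0" ..
    have "rcis R (point_angle l) \<bullet> mirror_dir 14 (sg b) < 0"
      unfolding inner_mirror using assms(1) b by (rule mult_pos_neg)
    then show ?thesis unfolding obtuse_wedge_def by (auto simp: not_le)
  qed
qed

lemma not_crosses_gray_zone:
  assumes "R > 0" "l < 28" "n < 28" "upper_wedge l = upper_wedge n"
  shows "\<not> crosses_gray_zone 14 (rcis R (point_angle l)) (rcis R (point_angle n))"
proof
  assume "crosses_gray_zone 14 (rcis R (point_angle l)) (rcis R (point_angle n))"
  then obtain \<sigma> where "rcis R (point_angle l) \<in> obtuse_wedge 14 \<sigma>" "rcis R (point_angle n) \<in> obtuse_wedge 14 (opp \<sigma>)"
    unfolding crosses_gray_zone_def by blast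
  then show False using wedge_side[OF assms(1,2)] wedge_side[OF assms(1,3)] assms(4) by (cases \<sigma>) auto
qed

lemma collinear_opposite:
  assumes "l mod 14 = n mod 14"
  shows "collinear {0, rcis R (point_angle l), rcis R (point_angle n)}"
proof -
  have "int l - int n = 14 * (int (l div 14) - int (n div 14))"
  proof -
    have "int l = 14 * int (l div 14) + int (l mod 14)" "int n = 14 * int (n div 14) + int (n mod 14)"
      by (metis mult_div_mod_eq of_nat_add of_nat_mult of_nat_numeral)+
    then show ?thesis using assms by simp
  qed
  then obtain q where q: "int l = int n + 14 * q" by (metis diff_eq_eq add.commute)
  then have lr: "real l = real n + 14 * of_int q" by linarith
  define q' where "q' = (if plus then q else - q)"
  have a: "point_angle l = point_angle n + of_int q' * pi"
    unfolding point_angle_def q'_def lr by (simp add: field_simps)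
  have "cos (point_angle l) = cos (of_int q' * pi) * cos (point_angle n)"
    "sin (point_angle l) = cos (of_int q' * pi) * sin (point_angle n)"
    unfolding a by (simp_all add: cos_add sin_add sin_times_pi_eq_0 mult.commute)
  then have "rcis R (point_angle l) = cos (of_int q' * pi) *\<^sub>R rcis R (point_angle n)"
    by (simp add: complex_eq_iff)
  then show ?thesis by (metis collinear_lemma insert_commute)
qed

text \<open>The tables hold only pairs with i < j; the unordered pair of diagrams in the hypothesis
  lets either diagram be the first in the conditions.\<close>

lemma main_ordered:
  assumes ij: "i < 42" "j < 42" "i < j" and "{C1, C2} = {seg ` set (DG ! i), seg ` set (DG ! j)}"
  shows "j \<in> set (compat_table ! i) \<longleftrightarrow> no_crossing_condition S c X C1 C2 \<and> gray_zone_condition S c X C1 C2"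
proof -
  define D where "D = set (DG ! i) \<union> set (DG ! j)"
  have C: "C1 \<union> C2 = seg ` D" using assms(4) by (auto simp: D_def doubleton_eq_iff)
  have v: "valid_seg T" if "T \<in> D" for T using that valid_DG[of i T] valid_DG[of j T] ij unfolding D_def by blast
  have A: "B \<in> active (ring_radii S c X) (seg ` D) \<longleftrightarrow> (\<exists>T\<in>D. B = seg T \<and> act D T)" for B
    by (rule active_seg) (rule v)
  show ?thesis
  proof
    assume comp: "j \<in> set (compat_table ! i)"
    have "no_crossing_condition S c X C1 C2"
      unfolding no_crossing_condition_def C
    proof (intro ballI)
      fix A1 A2 assume a: "A1 \<in> active (ring_radii S c X) (seg ` D)" "A2 \<in> active (ring_radii S c X) (seg ` D)"
      obtain T where T: "T \<in> D" "A1 = seg T" "act D T" using a(1) unfolding A by blast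
      obtain U where U: "U \<in> D" "A2 = seg U" "act D U" using a(2) unfolding A by blast
      note TU = T U
      have sub: "seg_interior T \<subseteq> convex hull vertices 1" if "\<not> outerT T" "T \<in> D" for T
        using that seg_interior_subset(2)[of i T] seg_interior_subset(2)[of j T] ij unfolding D_def by blast
      have h: "harmless T U" if "outerT T = outerT U"
        using compatible_harmless[OF ij(1,3) comp, of T U] TU that by (simp add: D_def)
      have radT: "outer_radius A1 = (if outerT T then kappa * r else r)" "outer_radius A2 = (if outerT U then kappa * r else r)"
        using outer_radius_iff v TU by auto
      show "\<not> cross_within (annulus S c X (max (outer_radius A1) (outer_radius A2))) A1 A2"
      proof (cases "outerT T \<or> outerT U")
        case True
        then have "max (outer_radius A1) (outer_radius A2) = kappa * r" using radT radii by auto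
        then have e: "cross_within (annulus S c X (max (outer_radius A1) (outer_radius A2))) A1 A2 \<longleftrightarrow>
            seg_ends T \<noteq> seg_ends U \<and> (\<exists>z\<in>convex hull vertices 2 - convex hull vertices 1. z \<in> seg_interior T \<and> z \<in> seg_interior U)"
          using cross_within_seg[OF v v] TU by (simp add: annulus_eq)
        show ?thesis
        proof (cases "outerT T = outerT U")
          case True
          then show ?thesis unfolding e using h unfolding harmless_def by blast
        next
          case False
          \<comment> \<open>A mixed pair: one of the interiors lies in the inner polygon, which the
            outer annulus leaves out.\<close>
          then show ?thesis unfolding e using sub TU True by blast
        qed
      next
        case False
        then have "max (outer_radius A1) (outer_radius A2) = r" using radT by simp
        then have e: "cross_within (annulus S c X (max (outer_radius A1) (outer_radius A2))) A1 A2 \<longleftrightarrow>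
            seg_ends T \<noteq> seg_ends U \<and> (\<exists>z\<in>convex hull vertices 1. z \<in> seg_interior T \<and> z \<in> seg_interior U)"
          using cross_within_seg[OF v v] TU by (simp add: annulus_eq)
        show ?thesis unfolding e using h False unfolding harmless_def by blast
      qed
    qed
    moreover have "gray_zone_condition S c X C1 C2"
      unfolding gray_zone_condition_def Let_def C
    proof (intro allI impI)
      fix x y z
      assume a: "{Origin x, Vertex y} \<in> C1 \<and> {Origin x, Vertex z} \<in> C2 \<and>
        {Origin x, Vertex y} \<in> active (ring_radii S c X) (seg ` D) \<and>
        {Origin x, Vertex z} \<in> active (ring_radii S c X) (seg ` D) \<and>
        cmod y = Min (ring_radii S c X) \<and> cmod z = Min (ring_radii S c X)"
      have dec: "\<exists>k l. T = ((0, k), (1, l)) \<and> pt (0, k) = Origin x \<and> w = rcis r (point_angle l) \<and> l < 28 \<and> k < 3"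
        if "valid_seg T" "{Origin x, Vertex w} = seg T" "cmod w = r" for T w
      proof -
        obtain t k u l where T: "T = ((t, k), (u, l))" by (metis surj_pair)
        have vv: "valid_code (t, k)" "valid_code (u, l)" "u \<noteq> 0" using that(1) T by auto
        have pu: "pt (u, l) = Vertex (rcis (r * ring_radius u) (point_angle l))" using vv by (simp add: pt_def)
        then have p: "pt (t, k) = Origin x" "Vertex w = pt (u, l)"
          using that(2) unfolding T seg_def by (auto simp: doubleton_eq_iff)
        then have t: "t = 0" by (auto simp: pt_def split: if_splits)
        have "cmod w = r * ring_radius u" using p(2) cmod_loc[of "(u, l)"] by (metis fst_conv loc.simps(2))
        then have "u = 1" using that(3) vv radii r_pos by (auto simp: ring_radius_def split: if_splits)
        then show ?thesis using T t p pu vv by (auto simp: ring_radius_def)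
      qed
      have in_row: "(\<exists>T\<in>set (DG ! i). \<exists>U\<in>set (DG ! j). A1 = seg T \<and> A2 = seg U) \<or>
          (\<exists>T\<in>set (DG ! j). \<exists>U\<in>set (DG ! i). A1 = seg T \<and> A2 = seg U)" if "A1 \<in> C1" "A2 \<in> C2" for A1 A2
        using that assms(4) by (auto simp: doubleton_eq_iff)
      \<comment> \<open>Activity is known only for some code with the same set of points; for radial
        segments that code is unique.\<close>
      have inj: "T = U" if "T \<in> D" "U \<in> D" "seg T = seg U" "fst T = (0, k)" "fst U = (0, l)" for T U k l
      proof -
        have "pt (fst T) \<in> seg U" "pt (snd T) \<in> seg U" using that(3) unfolding seg_def by auto
        then have "fst T \<in> {fst U, snd U}" "snd T \<in> {fst U, snd U}"
          using pt_inj valid_seg_codes[OF v[OF that(1)]] valid_seg_codes[OF v[OF that(2)]] unfolding seg_def by blast+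
        then show ?thesis using valid_seg_codes[OF v[OF that(1)]] valid_seg_codes[OF v[OF that(2)]] that(4,5)
          by (cases T; cases U) auto
      qed
      have key: "T \<in> D \<Longrightarrow> U \<in> D \<Longrightarrow> {Origin x, Vertex y} = seg T \<Longrightarrow> {Origin x, Vertex z} = seg U \<Longrightarrow>
          \<exists>k l n. T = ((0, k), (1, l)) \<and> U = ((0, k), (1, n)) \<and> l < 28 \<and> n < 28 \<and>
            y = rcis r (point_angle l) \<and> z = rcis r (point_angle n) \<and> act D T \<and> act D U" for T U
      proof -
        assume TU: "T \<in> D" "U \<in> D" "{Origin x, Vertex y} = seg T" "{Origin x, Vertex z} = seg U"
        obtain k l where kl: "T = ((0, k), (1, l))" "pt (0, k) = Origin x" "y = rcis r (point_angle l)" "l < 28" "k < 3"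
          using dec[OF v[OF TU(1)] TU(3)] a max_radii(2) by metis
        obtain m n where mn: "U = ((0, m), (1, n))" "pt (0, m) = Origin x" "z = rcis r (point_angle n)" "n < 28" "m < 3"
          using dec[OF v[OF TU(2)] TU(4)] a max_radii(2) by metis
        have "k = m" using pt_inj[of "(0, k)" "(0, m)"] kl mn by simp
        have "act D T"
        proof -
          obtain T' where T': "T' \<in> D" "seg T = seg T'" "act D T'" using A a TU(3) by metis
          obtain k' l' where "T' = ((0, k'), (1, l'))" using dec[OF v[OF T'(1)], of y] a TU(3) T'(2) max_radii(2) by metis
          then have "T = T'" using inj[OF TU(1) T'(1,2)] kl by simp
          then show ?thesis using T' by simp
        qed
        moreover have "act D U"
        proof -
          obtain T' where T': "T' \<in> D" "seg U = seg T'" "act D T'" using A a TU(4) by metis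
          obtain k' l' where "T' = ((0, k'), (1, l'))" using dec[OF v[OF T'(1)], of z] a TU(4) T'(2) max_radii(2) by metis
          then have "U = T'" using inj[OF TU(2) T'(1,2)] mn by simp
          then show ?thesis using T' by simp
        qed
        ultimately show ?thesis using kl mn \<open>k = m\<close> by blast
      qed
      have fin: "collinear {0, y, z} \<or> \<not> crosses_gray_zone (coxeter_number S + 2) y z"
        if "l mod 14 = n mod 14 \<or> upper_wedge l = upper_wedge n" "l < 28" "n < 28"
          "y = rcis r (point_angle l)" "z = rcis r (point_angle n)" for l n
        using that not_crosses_gray_zone[of r l n] collinear_opposite[of l n r] r_pos by (auto simp: coxeter_number_eq)
      have "{Origin x, Vertex y} \<in> C1" "{Origin x, Vertex z} \<in> C2" using a by blast+
      from in_row[OF this] show "collinear {0, y, z} \<or> \<not> crosses_gray_zone (coxeter_number S + 2) y z"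
      proof (elim disjE bexE conjE)
        fix T U assume TU: "T \<in> set (DG ! i)" "U \<in> set (DG ! j)" "{Origin x, Vertex y} = seg T" "{Origin x, Vertex z} = seg U"
        then have D: "T \<in> D" "U \<in> D" by (simp_all add: D_def)
        obtain k l n where k: "T = ((0, k), (1, l))" "U = ((0, k), (1, n))" "l < 28" "n < 28"
          "y = rcis r (point_angle l)" "z = rcis r (point_angle n)" "act D T" "act D U"
          using key[OF D TU(3,4)] by blast
        have "l mod 14 = n mod 14 \<or> upper_wedge l = upper_wedge n"
          using compatible_gray[OF ij(1,3) comp, of T U k] TU(1,2) k(7,8) unfolding D_def k(1,2) by auto
        then show ?thesis by (rule fin[OF _ k(3-6)])
      next
        fix T U assume TU: "T \<in> set (DG ! j)" "U \<in> set (DG ! i)" "{Origin x, Vertex y} = seg T" "{Origin x, Vertex z} = seg U"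
        then have D: "T \<in> D" "U \<in> D" by (simp_all add: D_def)
        obtain k l n where k: "T = ((0, k), (1, l))" "U = ((0, k), (1, n))" "l < 28" "n < 28"
          "y = rcis r (point_angle l)" "z = rcis r (point_angle n)" "act D T" "act D U"
          using key[OF D TU(3,4)] by blast
        have "l mod 14 = n mod 14 \<or> upper_wedge l = upper_wedge n"
          using compatible_gray[OF ij(1,3) comp, of U T k] TU(1,2) k(7,8) unfolding D_def k(1,2) by auto
        then show ?thesis by (rule fin[OF _ k(3-6)])
      qed
    qed
    ultimately show "no_crossing_condition S c X C1 C2 \<and> gray_zone_condition S c X C1 C2" by blast
  next
    assume nc: "no_crossing_condition S c X C1 C2 \<and> gray_zone_condition S c X C1 C2"
    show "j \<in> set (compat_table ! i)"
    proof (rule ccontr)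
      assume "j \<notin> set (compat_table ! i)"
      then obtain T U z where w: "T \<in> D" "U \<in> D" "act D T" "act D U" "outerT T = outerT U" "seg_ends T \<noteq> seg_ends U"
        "z \<in> seg_interior T" "z \<in> seg_interior U" "outerT T \<longrightarrow> z \<notin> convex hull vertices 1"
        using incompatible_crossing[OF ij(1,3,2)] unfolding D_def by blast
      have act: "seg T \<in> active (ring_radii S c X) (C1 \<union> C2)" "seg U \<in> active (ring_radii S c X) (C1 \<union> C2)"
        unfolding C using A w by blast+
      have z2: "z \<in> convex hull vertices 2" and z1: "\<not> outerT T \<Longrightarrow> z \<in> convex hull vertices 1"
        using seg_interior_subset ij w(1,7) unfolding D_def by blast+
      have "cross_within (annulus S c X (max (outer_radius (seg T)) (outer_radius (seg U)))) (seg T) (seg U)"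
      proof (cases "outerT T")
        case True
        then have "outer_radius (seg T) = kappa * r" "outer_radius (seg U) = kappa * r"
          using outer_radius_iff v w by auto
        then show ?thesis using True cross_within_seg[OF v v] w z2 by (auto simp: annulus_eq)
      next
        case False
        then have "outer_radius (seg T) = r" "outer_radius (seg U) = r"
          using outer_radius_iff v w by auto
        then show ?thesis using False cross_within_seg[OF v v] w z1 by (auto simp: annulus_eq)
      qed
      then show False using nc act unfolding no_crossing_condition_def by blast
    qed
  qed
qed

theorem compatible_iff_conditions:
  assumes "\<alpha> \<in> almost_positive_roots \<Phi> (simples S)" "\<beta> \<in> almost_positive_roots \<Phi> (simples S)" "\<alpha> \<noteq> \<beta>"
    "C1 = diagram \<Phi> S c X \<alpha>" "C2 = diagram \<Phi> S c X \<beta>"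
  shows "(\<alpha>, \<beta>) \<in> compatible \<Phi> S \<longleftrightarrow> no_crossing_condition S c X C1 C2 \<and> gray_zone_condition S c X C1 C2"
proof -
  obtain i j where ij: "i < 42" "\<alpha> = vec (apr ! i)" "j < 42" "\<beta> = vec (apr ! j)"
    using assms(1,2) unfolding almost_positive_roots_eq by auto
  then have "i \<noteq> j" using assms(3) by blast
  have C: "C1 = seg ` set (DG ! i)" "C2 = seg ` set (DG ! j)" using assms(4,5) ij diagram_eq by simp_all
  have comp: "(\<alpha>, \<beta>) \<in> compatible \<Phi> S \<longleftrightarrow> j \<in> set (compat_table ! i)" using compatible_iff ij by simp
  show ?thesis
  proof (cases "i < j")
    case True
    then show ?thesis using main_ordered[of i j C1 C2] ij C comp by simp
  next
    case False
    then have "j < i" using \<open>i \<noteq> j\<close> by simp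
    moreover have "{C1, C2} = {seg ` set (DG ! j), seg ` set (DG ! i)}" using C by auto
    ultimately have "i \<in> set (compat_table ! j) \<longleftrightarrow> no_crossing_condition S c X C1 C2 \<and> gray_zone_condition S c X C1 C2"
      using main_ordered[of j i C1 C2] ij by blast
    moreover have "j \<in> set (compat_table ! i) \<longleftrightarrow> i \<in> set (compat_table ! j)" using compat_table_sym ij by blast
    ultimately show ?thesis using comp by simp
  qed
qed

end

theorem mainTheorem7:
  fixes \<Phi> :: "'a::euclidean_space set"
    and S :: "sign \<Rightarrow> 'a set"
    and c :: "'a \<Rightarrow> real"
    and X :: "'a set"
    and \<alpha>\<^sub>1 \<alpha>\<^sub>2 :: 'a
    and C\<^sub>1 C\<^sub>2 :: "'a segment set"
  assumes "root_system \<Phi>"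
    and "simple_system \<Phi> (simples S)"
    and "type_E6 (simples S)"
    and "fixes_only_origin (simples S)"
    and "bipartition S"
    and "coxeter_eigenvector (simples S) c"
    and "smallest_nonzero_orbit (simples S) X"
    and "\<alpha>\<^sub>1 \<in> almost_positive_roots \<Phi> (simples S)"
    and "\<alpha>\<^sub>2 \<in> almost_positive_roots \<Phi> (simples S)"
    and "\<alpha>\<^sub>1 \<noteq> \<alpha>\<^sub>2"
    and "C\<^sub>1 = diagram \<Phi> S c X \<alpha>\<^sub>1"
    and "C\<^sub>2 = diagram \<Phi> S c X \<alpha>\<^sub>2"
  shows "(\<alpha>\<^sub>1, \<alpha>\<^sub>2) \<in> compatible \<Phi> S \<longleftrightarrow>
    no_crossing_condition S c X C\<^sub>1 C\<^sub>2 \<and> gray_zone_condition S c X C\<^sub>1 C\<^sub>2"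
proof -
  obtain a N \<epsilon> where a: "E6_roots a N" "S \<epsilon> = a ` {0,3,5}" "S (opp \<epsilon>) = a ` {1,2,4}"
    using E6_roots_exist[OF assms(1-5)] by blast
  then have E: "E6_setting a N \<Phi> S \<epsilon>"
    using assms(1,2) by (simp add: E6_setting_def E6_setting_axioms_def)
  obtain s where s: "s > 0" "X = orbit (simples S) (s *\<^sub>R E6_roots.vec a (W27 ! 0)) \<or>
      X = orbit (simples S) (s *\<^sub>R E6_roots.vec a (flip_coords (W27 ! 0)))"
    using E6_setting.smallest_orbit[OF E assms(7)] by blast
  \<comment> \<open>If the orbit belongs to the other minuscule weight, renumbering the simple roots
    by the diagram automorphism makes it the orbit of the first one.\<close>
  obtain a' where E': "E6_setting a' N \<Phi> S \<epsilon>" and X: "X = orbit (simples S) (s *\<^sub>R E6_roots.vec a' (W27 ! 0))"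
  proof (cases "X = orbit (simples S) (s *\<^sub>R E6_roots.vec a (W27 ! 0))")
    case True
    then show ?thesis using E that by blast
  next
    case False
    have "length (W27 ! 0) = 6" by (simp add: W27_def)
    then show ?thesis using s(2) False E6_setting_flip[OF E] that by metis
  qed
  have D: "E6_diagram a' N \<Phi> S \<epsilon> c s"
    using E' assms(6) s(1) by (simp add: E6_diagram_def E6_diagram_axioms_def)
  have "X = E6_diagram.X a' s"
    unfolding X E6_diagram.X_def[OF D] by (rule E6_setting.orbit_minuscule[OF E'])
  then show ?thesis
    using E6_diagram.compatible_iff_conditions[OF D assms(8-10)] assms(11,12) by simp
qed

end
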